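(* Let $1<p<+\infty$, $1<q<+\infty$, $\alpha>1$, and let $w$ be an $A_p$-weight on $\mathbf{S}^n$. Let $p',q'$ be the conjugate exponents of $p,q$. Then the dual of $F^{\alpha,p,q}(w)$ is $F^{\alpha,p',q'}(w)$, with the pairing given by $$(f,g)_\alpha=\int_{\mathbf{B}^n}\int_{\mathbf{S}^n} f(z)\overline{g(z)}\,\chi_{D_\alpha(\zeta)}(z)\,w(\zeta)\,d\sigma(\zeta)\,\frac{dv(z)}{(1-|z|^2)^{n+1}},\qquad f\in F^{\alpha,p,q}(w),\ g\in F^{\alpha,p',q'}(w).$$
   Context: $\mathbf{B}^n$ is the open unit ball of $\mathbf{C}^n$, $\mathbf{S}^n$ the unit sphere, $\sigma$ the normalized Lebesgue measure on $\mathbf{S}^n$, $dv$ Lebesgue measure on $\mathbf{B}^n$, and $z\overline{\zeta}=\sum_i z_i\overline{\zeta_i}$. Nonisotropic balls are $B(\zeta,r)=\{\eta\in\mathbf{S}^n: |1-\zeta\overline{\eta}|<r\}$. A weight $w\ge 0$ on $\mathbf{S}^n$ is an $A_p$-weight if there is $C>0$ with $\left(\frac1{|B|}\int_B w\,d\sigma\right)\left(\frac1{|B|}\int_B w^{-1/(p-1)}d\sigma\right)^{p-1}\le C$ for every nonisotropic ball $B$ ($|B|$ is its Lebesgue measure). For $\alpha>1$ and $\zeta\in\mathbf{S}^n$, $D_\alpha(\zeta)=\{z\in\mathbf{B}^n: |1-z\overline{\zeta}|<\alpha(1-|z|)\}$, and $E_\alpha(z)=\left(\int_{\mathbf{S}^n}\chi_{D_\alpha(\zeta)}(z)\,d\sigma(\zeta)\right)^{-1}\simeq(1-|z|^2)^{-n}$.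 For $1<p,q<\infty$, $F^{\alpha,p,q}(w)$ is the space of measurable functions $f$ on $\mathbf{B}^n$ with $$\|f\|_{\alpha,p,q,w}=\left(\int_{\mathbf{S}^n}\left(\int_{\mathbf{B}^n}\chi_{D_\alpha(\zeta)}(z)|f(z)|^q\frac{E_\alpha(z)}{1-|z|^2}dv(z)\right)^{p/q}w(\zeta)\,d\sigma(\zeta)\right)^{1/p}<+\infty .$$ $F^{\alpha,p',q'}(w)$ is defined in the same way with the same weight $w$ and the exponents $p',q'$. *)

theory Defs
  imports "HOL-Analysis.Analysis"
begin

text \<open>
  The space \<open>C^n\<close> is \<^typ>\<open>complex ^ 'n\<close> with \<open>n = CARD('n)\<close>; its norm is the Euclidean one and
  \<^const>\<open>lebesgue\<close> is Lebesgue measure on \<open>R^(2n)\<close>. The open unit ball and the unit sphere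
  are \<open>ball 0 1\<close> and \<open>sphere 0 1\<close>.
\<close>

definition herm :: "complex ^ 'n \<Rightarrow> complex ^ 'n \<Rightarrow> complex" where
  "herm z \<zeta> = (\<Sum>i\<in>UNIV. z $ i * cnj (\<zeta> $ i))"

text \<open>
  Normalized surface measure, defined through polar coordinates: a Borel set \<open>A\<close> of the sphere
  has measure \<open>vol {t x | 0 < t < 1, x \<in> A} / vol (ball 0 1)\<close>. Note that \<open>sgn x = x /\<^sub>R norm x\<close>.
  The measure is completed, so that measurable means Lebesgue measurable.
\<close>

definition sphere_measure :: "(complex ^ 'n) measure" where
  "sphere_measure =
     completion (restrict_space (distr (uniform_measure lborel (ball 0 1)) borel sgn) (sphere 0 1))"

lemma emeasure_sphere_measure:
  fixes A :: "(complex ^ 'n) set"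
  assumes "A \<in> sets borel" "A \<subseteq> sphere 0 1"
  shows "emeasure sphere_measure A =
    emeasure lborel {x \<in> ball 0 1. sgn x \<in> A} / emeasure lborel (ball 0 1 :: (complex ^ 'n) set)"
proof -
  let ?D = "distr (uniform_measure lborel (ball 0 1 :: (complex ^ 'n) set)) borel sgn"
  have m: "(sgn :: complex ^ 'n \<Rightarrow> _) \<in> borel_measurable borel"
    unfolding sgn_div_norm by measurable
  have S: "(sphere 0 1 :: (complex ^ 'n) set) \<in> sets borel"
    by (intro borel_closed closed_sphere)
  have A: "A \<in> sets (restrict_space ?D (sphere 0 1))"
    using assms S by (auto simp: sets_restrict_space_iff)
  have v: "sgn -` A \<in> sets (borel :: (complex ^ 'n) measure)"
    using measurable_sets[OF m assms(1)] by simp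
  have "emeasure sphere_measure A = emeasure ?D A"
    unfolding sphere_measure_def using A S assms(2)
    by (simp add: emeasure_restrict_space)
  also have "\<dots> = emeasure (uniform_measure lborel (ball 0 1)) (sgn -` A)"
    using m assms(1) by (subst emeasure_distr) auto
  also have "\<dots> = emeasure lborel (ball 0 1 \<inter> sgn -` A) / emeasure lborel (ball 0 1 :: (complex ^ 'n) set)"
    using v by (subst emeasure_uniform_measure) auto
  also have "ball 0 1 \<inter> sgn -` A = {x \<in> ball 0 1. sgn x \<in> A}" by auto
  finally show ?thesis .
qed

lemma emeasure_sphere_measure_UNIV:
  "emeasure sphere_measure (sphere 0 1 :: (complex ^ 'n) set) = 1"
proof -
  have "{x \<in> ball 0 1. sgn x \<in> sphere 0 1} = ball 0 1 - {0 :: complex ^ 'n}"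
    by (auto simp: norm_sgn)
  moreover have "emeasure lborel (ball 0 1 - {0 :: complex ^ 'n}) = emeasure lborel (ball 0 1 :: (complex ^ 'n) set)"
    by (rule emeasure_Diff_null_set) auto
  moreover have "emeasure lborel (ball 0 1 :: (complex ^ 'n) set) \<noteq> 0"
    by (simp add: emeasure_ball unit_ball_vol_pos less_imp_neq[symmetric])
  moreover have "emeasure lborel (ball 0 1 :: (complex ^ 'n) set) \<noteq> \<infinity>"
    using emeasure_lborel_ball_finite[of "0 :: complex ^ 'n" 1] by simp
  ultimately show ?thesis
    by (subst emeasure_sphere_measure) (auto intro!: borel_closed ennreal_divide_self simp: less_top)
qed

definition noniso_ball :: "complex ^ 'n \<Rightarrow> real \<Rightarrow> (complex ^ 'n) set" where
  "noniso_ball \<zeta> r = {\<eta> \<in> sphere 0 1. cmod (1 - herm \<zeta> \<eta>) < r}"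

text \<open>Powers with exponent \<open>a > 0\<close> on \<open>[0, \<infinity>]\<close>.\<close>

definition enn_powr :: "ennreal \<Rightarrow> real \<Rightarrow> ennreal" where
  "enn_powr x a = (if x = \<infinity> then \<infinity> else ennreal (enn2real x powr a))"

text \<open>
  The integrals may a priori be infinite; the bound on the ball \<open>noniso_ball \<zeta> 3 = sphere 0 1\<close>
  forces \<open>w\<close> and \<open>w powr (-1/(p-1))\<close> to be integrable. Positivity almost everywhere is
  what gives \<open>w powr (-1/(p-1))\<close> a meaning; it only excludes the weights
  that vanish almost everywhere (and \<open>0 powr a = 0\<close> becomes irrelevant).
\<close>

definition Ap_weight :: "real \<Rightarrow> (complex ^ 'n \<Rightarrow> real) \<Rightarrow> bool" where
  "Ap_weight p w \<longleftrightarrow>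
     w \<in> borel_measurable sphere_measure \<and>
     (\<forall>\<zeta>\<in>sphere 0 1. 0 \<le> w \<zeta>) \<and>
     (AE \<zeta> in sphere_measure. 0 < w \<zeta>) \<and>
     (\<exists>C>0. \<forall>\<zeta>\<in>sphere 0 1. \<forall>r>0. let B = noniso_ball \<zeta> r in
        ((\<integral>\<^sup>+\<eta>\<in>B. ennreal (w \<eta>) \<partial>sphere_measure) / emeasure sphere_measure B) *
        enn_powr ((\<integral>\<^sup>+\<eta>\<in>B. ennreal (w \<eta> powr (- 1 / (p - 1))) \<partial>sphere_measure)
                    / emeasure sphere_measure B) (p - 1)
        \<le> ennreal C)"

definition admissible :: "real \<Rightarrow> complex ^ 'n \<Rightarrow> (complex ^ 'n) set" where
  "admissible \<alpha> \<zeta> = {z \<in> ball 0 1. cmod (1 - herm z \<zeta>) < \<alpha> * (1 - norm z)}"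

definition E_fun :: "real \<Rightarrow> complex ^ 'n \<Rightarrow> real" where
  "E_fun \<alpha> z = inverse (LINT \<zeta>|sphere_measure. indicator (admissible \<alpha> \<zeta>) z)"

text \<open>The \<open>p\<close>-th power of the norm, with values in \<open>[0, \<infinity>]\<close>.\<close>

definition F_integral ::
    "real \<Rightarrow> real \<Rightarrow> real \<Rightarrow> (complex ^ 'n \<Rightarrow> real) \<Rightarrow> (complex ^ 'n \<Rightarrow> complex) \<Rightarrow> ennreal" where
  "F_integral \<alpha> p q w f =
     (\<integral>\<^sup>+\<zeta>. enn_powr
          (\<integral>\<^sup>+z. ennreal (indicator (admissible \<alpha> \<zeta>) z * cmod (f z) powr q
                        * (E_fun \<alpha> z / (1 - (norm z)\<^sup>2)))
             \<partial>lebesgue_on (ball 0 1))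
          (p / q) * ennreal (w \<zeta>)
        \<partial>sphere_measure)"

definition F_norm ::
    "real \<Rightarrow> real \<Rightarrow> real \<Rightarrow> (complex ^ 'n \<Rightarrow> real) \<Rightarrow> (complex ^ 'n \<Rightarrow> complex) \<Rightarrow> real" where
  "F_norm \<alpha> p q w f = enn2real (F_integral \<alpha> p q w f) powr (1 / p)"

text \<open>
  Elements are functions, not classes modulo equality almost everywhere. This does not change the
  dual: a functional bounded by \<^const>\<open>F_norm\<close> takes equal values on functions that agree
  almost everywhere.
\<close>

definition F_space ::
    "real \<Rightarrow> real \<Rightarrow> real \<Rightarrow> (complex ^ 'n \<Rightarrow> real) \<Rightarrow> (complex ^ 'n \<Rightarrow> complex) set" where
  "F_space \<alpha> p q w =
     {f \<in> borel_measurable (lebesgue_on (ball 0 1)). F_integral \<alpha> p q w f < \<infinity>}"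

text \<open>
  Bounded complex-linear functionals on \<^const>\<open>F_space\<close>; only their values on that space matter.
\<close>

definition F_dual ::
    "real \<Rightarrow> real \<Rightarrow> real \<Rightarrow> (complex ^ 'n \<Rightarrow> real) \<Rightarrow> ((complex ^ 'n \<Rightarrow> complex) \<Rightarrow> complex) set" where
  "F_dual \<alpha> p q w =
     {T. (\<forall>f\<in>F_space \<alpha> p q w. \<forall>g\<in>F_space \<alpha> p q w. T (\<lambda>z. f z + g z) = T f + T g) \<and>
         (\<forall>c. \<forall>f\<in>F_space \<alpha> p q w. T (\<lambda>z. c * f z) = c * T f) \<and>
         (\<exists>C. \<forall>f\<in>F_space \<alpha> p q w. cmod (T f) \<le> C * F_norm \<alpha> p q w f)}"

definition F_dual_norm ::
    "real \<Rightarrow> real \<Rightarrow> real \<Rightarrow> (complex ^ 'n \<Rightarrow> real) \<Rightarrow> ((complex ^ 'n \<Rightarrow> complex) \<Rightarrow> complex) \<Rightarrow> real" where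
  "F_dual_norm \<alpha> p q w T = (SUP f\<in>{f \<in> F_space \<alpha> p q w. F_norm \<alpha> p q w f \<le> 1}. cmod (T f))"

definition F_pairing ::
    "real \<Rightarrow> (complex ^ 'n \<Rightarrow> real) \<Rightarrow> (complex ^ 'n \<Rightarrow> complex) \<Rightarrow> (complex ^ 'n \<Rightarrow> complex) \<Rightarrow> complex" where
  "F_pairing \<alpha> w f g =
     (LINT z|lebesgue_on (ball 0 1).
        (LINT \<zeta>|sphere_measure.
            f z * cnj (g z) * indicator (admissible \<alpha> \<zeta>) z * complex_of_real (w \<zeta>))
        / complex_of_real ((1 - (norm z)\<^sup>2) ^ (CARD('n) + 1)))"

definition F_pairing_abs_convergent ::
    "real \<Rightarrow> (complex ^ 'n \<Rightarrow> real) \<Rightarrow> (complex ^ 'n \<Rightarrow> complex) \<Rightarrow> (complex ^ 'n \<Rightarrow> complex) \<Rightarrow> bool" where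
  "F_pairing_abs_convergent \<alpha> w f g \<longleftrightarrow>
     (\<integral>\<^sup>+z. (\<integral>\<^sup>+\<zeta>. ennreal (cmod (f z * cnj (g z)) * indicator (admissible \<alpha> \<zeta>) z * w \<zeta>)
               \<partial>sphere_measure)
          * ennreal (1 / (1 - (norm z)\<^sup>2) ^ (CARD('n) + 1))
        \<partial>lebesgue_on (ball 0 1)) < \<infinity>"

end

theory Submission
  imports Defs
begin

text \<open>
  The space \<open>F^{\<alpha>,p,q}(w)\<close> is the subspace of those elements of the mixed-norm space
  \<open>L^p(w d\<sigma>; L^q)\<close> of functions of \<open>(\<zeta>, z)\<close> that have the form \<open>\<chi>_{D(\<zeta>)}(z) f(z)\<close>. That the
  pairing is bounded is Hoelder's inequality, applied in \<open>z\<close> and then in \<open>\<zeta>\<close>, together with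
  \<open>E(z) \<simeq> (1 - |z|\<^sup>2)^{-n}\<close>. The substance of the theorem is the converse of this
  inequality: the norm of \<open>g\<close> is controlled by the norm of the functional \<open>f \<mapsto> (f, g)\<close>. In the
  mixed-norm space the extremal function for \<open>g\<close> is \<open>|g(z)|^{q'-2} g(z) N(\<zeta>)^{p'-q'}\<close>, where
  \<open>N(\<zeta>)\<close> is the \<open>L^{q'}\<close> norm of \<open>g\<close> over the approach region at \<open>\<zeta>\<close>. It depends on \<open>\<zeta>\<close>, so it is not in
  the subspace. Averaging it with respect to \<open>w d\<sigma>\<close> over the shadow \<open>{\<zeta>. z \<in> D(\<zeta>)}\<close> of \<open>z\<close>
  produces a function of \<open>z\<close> alone with the same pairing with \<open>g\<close>, and it remains to see that this
  averaging increases the norm by at most a constant factor (\<open>test_bound\<close>). For \<open>p < q\<close> this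
  follows from the pointwise bound of the average by a maximal function. For \<open>p > q\<close> the
  averaging is moved, being self-adjoint, onto a test function in the dual exponent of \<open>p/q\<close>,
  where it is again bounded by the maximal function; for \<open>p = q\<close> it is a contraction. The
  resulting norm inequality is \<open>norm_le_functional\<close>.

  The maximal function belongs to the measure \<open>w d\<sigma>\<close> and to the nonisotropic balls, and its
  boundedness on \<open>L^s\<close> for \<open>s > 1\<close> (\<open>maximal_strong_type\<close>) rests on a Vitali selection. It
  requires that \<open>w d\<sigma>\<close> is doubling. The \<open>A_p\<close> condition transfers the doubling property from \<open>\<sigma>\<close> to
  \<open>w d\<sigma>\<close> (\<open>\<mu>_compare\<close>), and for \<open>\<sigma>\<close> it is a consequence of \<open>\<sigma>(B(\<zeta>, r)) \<simeq> min(r, 1)^n\<close>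
  (\<open>measure_noniso_ball\<close>), which also gives the behaviour of \<open>E\<close>. That estimate is obtained by
  comparing a radially thickened ball with a box of sides \<open>r\<close> in one complex direction and
  \<open>sqrt r\<close> in the others.

  A bounded functional \<open>T\<close> is represented as follows. Fix an integrable function \<open>h > 0\<close> on the
  ball and put \<open>\<rho> = h^{1/q}\<close>. The set function \<open>X \<mapsto> T(\<rho> \<chi>_X)\<close> is a complex measure; its
  Radon--Nikodym density yields a function \<open>g\<close> such that \<open>T f = (f, g)\<close> whenever \<open>|f|\<close> is
  bounded by a multiple of \<open>\<rho>\<close>. These functions suffice for the norm inequality, so \<open>g\<close> is in
  \<open>F^{\<alpha>,p',q'}(w)\<close>, and dominated convergence extends the formula to all \<open>f\<close> (\<open>representation\<close>).
  Uniqueness of \<open>g\<close> and the equivalence of norms are the norm inequality again.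

  The geometry of the sphere enters the duality argument through the maximal inequality and
  the bounds for \<open>E\<close>. The argument is therefore carried out for an arbitrary measurable family
  of approach regions (locales \<open>tent_space\<close> and \<open>weighted_tent_space\<close>), and the sphere provides an
  instance.
\<close>

section \<open>Powers and Hoelder's inequality on the extended half-line\<close>

lemma enn_powr_ennreal [simp]: "0 \<le> x \<Longrightarrow> enn_powr (ennreal x) a = ennreal (x powr a)"
  by (simp add: enn_powr_def)

lemma enn_powr_top [simp]: "enn_powr top a = top"
  by (simp add: enn_powr_def infinity_ennreal_def)

lemma enn_powr_0 [simp]: "enn_powr 0 a = 0"
  by (simp add: enn_powr_def)

lemma enn_powr_1 [simp]: "enn_powr x 1 = x"
  by (cases x) auto

lemma enn_powr_one_left [simp]: "enn_powr 1 a = 1"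
  by (simp add: enn_powr_def)

lemma enn_powr_mono: "x \<le> y \<Longrightarrow> 0 \<le> a \<Longrightarrow> enn_powr x a \<le> enn_powr y a"
  by (cases x; cases y) (auto simp: ennreal_leI powr_mono2 top_unique)

lemma enn_powr_mult: "enn_powr (x * y) a = enn_powr x a * enn_powr y a"
proof (cases x; cases y)
  fix r s assume "x = ennreal r" "0 \<le> r" "y = ennreal s" "0 \<le> s"
  then show ?thesis by (simp add: ennreal_mult[symmetric] powr_mult)
next
  fix r assume x: "x = ennreal r" "0 \<le> r" and y: "y = top"
  show ?thesis
  proof (cases "r = 0")
    case True then show ?thesis using x by simp
  next
    case False then show ?thesis using x y by (simp add: ennreal_mult_top)
  qed
next
  fix r assume x: "y = ennreal r" "0 \<le> r" and y: "x = top"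
  show ?thesis
  proof (cases "r = 0")
    case True then show ?thesis using x by simp
  next
    case False then show ?thesis using x y by (simp add: ennreal_top_mult)
  qed
qed simp

lemma enn_powr_powr: "enn_powr (enn_powr x a) b = enn_powr x (a * b)"
  by (cases x) (auto simp: powr_powr)

lemma enn_powr_add: "0 \<le> a \<Longrightarrow> 0 \<le> b \<Longrightarrow> enn_powr x (a + b) = enn_powr x a * enn_powr x b"
  by (cases x) (auto simp: powr_add ennreal_mult)

lemma enn_powr_eq_0_iff [simp]: "enn_powr x a = 0 \<longleftrightarrow> x = 0"
  by (cases x) auto

lemma enn_powr_eq_top_iff [simp]: "enn_powr x a = top \<longleftrightarrow> x = top"
  by (cases x) auto

lemma enn_powr_less_top_iff [simp]: "enn_powr x a < top \<longleftrightarrow> x < top"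
  by (simp add: less_top[symmetric])

lemma enn_powr_measurable [measurable]:
  assumes [measurable]: "f \<in> borel_measurable M"
  shows "(\<lambda>x. enn_powr (f x) a) \<in> borel_measurable M"
  unfolding enn_powr_def by measurable

text \<open>
  For \<open>a > 0\<close> the power map is an order automorphism of \<open>[0, \<infinity>]\<close>, with inverse the power of
  exponent \<open>1 / a\<close>, and therefore preserves suprema.
\<close>

lemma enn_powr_SUP:
  assumes "0 < a"
  shows "enn_powr (SUP i\<in>I. x i) a = (SUP i\<in>I. enn_powr (x i) a)"
proof (rule antisym)
  have "x i \<le> enn_powr (SUP i\<in>I. enn_powr (x i) a) (1 / a)" if "i \<in> I" for i
  proof -
    have "enn_powr (enn_powr (x i) a) (1 / a) \<le> enn_powr (SUP i\<in>I. enn_powr (x i) a) (1 / a)"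
      using assms that by (intro enn_powr_mono) (auto intro: SUP_upper)
    then show ?thesis using assms by (simp add: enn_powr_powr)
  qed
  then have "(SUP i\<in>I. x i) \<le> enn_powr (SUP i\<in>I. enn_powr (x i) a) (1 / a)"
    by (rule SUP_least)
  then have "enn_powr (SUP i\<in>I. x i) a \<le> enn_powr (enn_powr (SUP i\<in>I. enn_powr (x i) a) (1 / a)) a"
    using assms by (intro enn_powr_mono) auto
  then show "enn_powr (SUP i\<in>I. x i) a \<le> (SUP i\<in>I. enn_powr (x i) a)"
    using assms by (simp add: enn_powr_powr)
  show "(SUP i\<in>I. enn_powr (x i) a) \<le> enn_powr (SUP i\<in>I. x i) a"
    using assms by (intro SUP_least enn_powr_mono) (auto intro: SUP_upper)
qed

lemma enn_powr_Young:
  assumes "1 < p" "1 < q" "1 / p + 1 / q = 1"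
  shows "x * y \<le> enn_powr x p * ennreal (1 / p) + enn_powr y q * ennreal (1 / q)"
proof (cases x; cases y)
  fix r s assume "x = ennreal r" "0 \<le> r" "y = ennreal s" "0 \<le> s"
  then show ?thesis
    using Youngs_inequality[of p q r s] assms
    by (simp add: ennreal_mult[symmetric] ennreal_plus[symmetric] ennreal_leI del: ennreal_plus)
qed (use assms in \<open>auto simp: ennreal_top_mult ennreal_mult_top\<close>)

text \<open>
  Divide both functions by their norms and integrate Young's inequality. Division makes sense
  only if both norms are positive and finite; the other cases are immediate.
\<close>

lemma nn_integral_Hoelder:
  assumes pq: "1 < p" "1 < q" "1 / p + 1 / q = 1"
    and [measurable]: "f \<in> borel_measurable M" "g \<in> borel_measurable M"
  shows "(\<integral>\<^sup>+x. f x * g x \<partial>M) \<le>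
    enn_powr (\<integral>\<^sup>+x. enn_powr (f x) p \<partial>M) (1 / p) * enn_powr (\<integral>\<^sup>+x. enn_powr (g x) q \<partial>M) (1 / q)"
proof -
  define F where "F = (\<integral>\<^sup>+x. enn_powr (f x) p \<partial>M)"
  define G where "G = (\<integral>\<^sup>+x. enn_powr (g x) q \<partial>M)"
  consider "F = 0 \<or> G = 0" | "F \<noteq> 0" "G \<noteq> 0" "F = top \<or> G = top" | "F \<noteq> 0" "G \<noteq> 0" "F \<noteq> top" "G \<noteq> top"
    by blast
  then show ?thesis
  proof cases
    case 1
    then have "(AE x in M. f x = 0) \<or> (AE x in M. g x = 0)"
      unfolding F_def G_def by (simp add: nn_integral_0_iff_AE)
    then have "AE x in M. f x * g x = 0" by auto
    then have "(\<integral>\<^sup>+x. f x * g x \<partial>M) = 0" by (simp add: nn_integral_0_iff_AE)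
    then show ?thesis by simp
  next
    case 2
    then have "enn_powr F (1 / p) * enn_powr G (1 / q) = top"
      by (auto simp: ennreal_mult_eq_top_iff)
    then show ?thesis by (simp add: F_def G_def)
  next
    case 3
    then obtain a b where a: "F = ennreal a" "0 < a" and b: "G = ennreal b" "0 < b"
      by (cases F; cases G) (auto simp: less_le)
    define u where "u = a powr (1 / p)"
    define v where "v = b powr (1 / q)"
    have uv: "0 < u" "0 < v" using a b by (auto simp: u_def v_def)
    have up: "(1 / u) powr p = 1 / a" and vq: "(1 / v) powr q = 1 / b"
      using a b pq by (auto simp: u_def v_def powr_divide powr_powr)
    have "f x * g x \<le> ennreal (u * v) * (enn_powr (f x) p * ennreal (1 / (p * a)) + enn_powr (g x) q * ennreal (1 / (q * b)))" for x
    proof -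
      have "f x * g x = ennreal (u * v) * ((f x * ennreal (1 / u)) * (g x * ennreal (1 / v)))"
      proof -
        have "ennreal (u * v) * (ennreal (1 / u) * ennreal (1 / v)) = 1"
          using uv by (simp add: ennreal_mult[symmetric])
        then show ?thesis by (metis mult.assoc mult.commute mult.left_neutral)
      qed
      also have "\<dots> \<le> ennreal (u * v) * (enn_powr (f x * ennreal (1 / u)) p * ennreal (1 / p)
           + enn_powr (g x * ennreal (1 / v)) q * ennreal (1 / q))"
        by (intro mult_left_mono enn_powr_Young pq) auto
      also have "enn_powr (f x * ennreal (1 / u)) p * ennreal (1 / p) = enn_powr (f x) p * ennreal (1 / (p * a))"
        using uv a pq ennreal_mult[of "1 / a" "1 / p"]
        by (simp add: enn_powr_mult up mult.assoc mult.commute[of p])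
      also have "enn_powr (g x * ennreal (1 / v)) q * ennreal (1 / q) = enn_powr (g x) q * ennreal (1 / (q * b))"
        using uv b pq ennreal_mult[of "1 / b" "1 / q"]
        by (simp add: enn_powr_mult vq mult.assoc mult.commute[of q])
      finally show ?thesis .
    qed
    then have "(\<integral>\<^sup>+x. f x * g x \<partial>M) \<le> (\<integral>\<^sup>+x. ennreal (u * v) * (enn_powr (f x) p * ennreal (1 / (p * a)) + enn_powr (g x) q * ennreal (1 / (q * b))) \<partial>M)"
      by (rule nn_integral_mono)
    also have "\<dots> = ennreal (u * v) * (F * ennreal (1 / (p * a)) + G * ennreal (1 / (q * b)))"
      by (simp add: nn_integral_cmult nn_integral_add nn_integral_multc F_def G_def)
    also have "F * ennreal (1 / (p * a)) + G * ennreal (1 / (q * b)) = 1"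
      using a b pq by (simp add: ennreal_mult[symmetric] ennreal_plus[symmetric] del: ennreal_plus)
    finally have "(\<integral>\<^sup>+x. f x * g x \<partial>M) \<le> ennreal (u * v)" by simp
    also have "\<dots> = enn_powr F (1 / p) * enn_powr G (1 / q)"
      using a b by (simp add: u_def v_def ennreal_mult)
    finally show ?thesis by (simp add: F_def G_def)
  qed
qed

lemma nn_integral_powr_0_to:
  assumes "0 < a" "0 \<le> c"
  shows "(\<integral>\<^sup>+t\<in>{0<..<c}. ennreal (a * t powr (a - 1)) \<partial>lborel) = ennreal (c powr a)"
proof -
  have hi: "((\<lambda>t. t powr (a - 1)) has_integral (c powr (a - 1 + 1) / (a - 1 + 1))) {0..c}"
    using has_integral_powr_from_0[of "a - 1" c] assms by simp
  have "((\<lambda>t. a * t powr (a - 1)) has_integral (c powr a)) {0..c}"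
    using has_integral_mult_right[OF hi, of a] assms by simp
  then have "((\<lambda>t. a * t powr (a - 1)) has_integral (c powr a)) {0<..<c}"
    using has_integral_Icc_iff_Ioo by blast
  then show ?thesis
    using assms by (intro nn_integral_has_integral_lebesgue') auto
qed

section \<open>The maximal function of a countable doubling family\<close>

text \<open>
  Greedy selection: keep a set of largest radius, discard every set that meets it, since such
  a set lies in the enlargement of the set that is kept, and continue with the remaining ones.
\<close>

lemma Vitali_selection:
  fixes r :: "'i \<Rightarrow> real"
  assumes "finite I"
    and engulf: "\<And>i j. i \<in> I \<Longrightarrow> j \<in> I \<Longrightarrow> V i \<inter> V j \<noteq> {} \<Longrightarrow> r i \<le> r j \<Longrightarrow> V i \<subseteq> V' j"
    and self: "\<And>i. i \<in> I \<Longrightarrow> V i \<subseteq> V' i"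
  shows "\<exists>J\<subseteq>I. disjoint_family_on V J \<and> (\<Union>i\<in>I. V i) \<subseteq> (\<Union>j\<in>J. V' j)"
  using assms
proof (induction "card I" arbitrary: I rule: less_induct)
  case less
  show ?case
  proof (cases "I = {}")
    case True then show ?thesis by (auto simp: disjoint_family_on_def)
  next
    case False
    have "Max (r ` I) \<in> r ` I" using False less.prems(1) by simp
    then obtain m where m: "m \<in> I" "r m = Max (r ` I)" by auto
    have rm: "r i \<le> r m" if "i \<in> I" for i using that m less.prems(1) by simp
    define I' where "I' = {i \<in> I - {m}. V i \<inter> V m = {}}"
    have I': "I' \<subseteq> I" "finite I'" using less.prems(1) by (auto simp: I'_def)
    have "card I' < card I"
      using m less.prems(1) by (intro psubset_card_mono) (auto simp: I'_def)
    moreover have "\<And>i j. i \<in> I' \<Longrightarrow> j \<in> I' \<Longrightarrow> V i \<inter> V j \<noteq> {} \<Longrightarrow> r i \<le> r j \<Longrightarrow> V i \<subseteq> V' j"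
      using I' by (meson less.prems(2) subsetD)
    moreover have "\<And>i. i \<in> I' \<Longrightarrow> V i \<subseteq> V' i"
      using I' by (meson less.prems(3) subsetD)
    ultimately obtain J where J: "J \<subseteq> I'" "disjoint_family_on V J" "(\<Union>i\<in>I'. V i) \<subseteq> (\<Union>j\<in>J. V' j)"
      using less.hyps[of I'] I'(2) by blast
    have "disjoint_family_on V (insert m J)"
      using J(1,2) unfolding disjoint_family_on_def I'_def by blast
    moreover have "V i \<subseteq> (\<Union>j\<in>insert m J. V' j)" if "i \<in> I" for i
    proof (cases "i \<in> I'")
      case True then show ?thesis using J(3) by auto
    next
      case False
      then have "i = m \<or> V i \<inter> V m \<noteq> {}" using that by (auto simp: I'_def)
      then have "V i \<subseteq> V' m" using less.prems(2)[OF that m(1) _ rm[OF that]] less.prems(3)[OF m(1)] by auto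
      then show ?thesis by auto
    qed
    ultimately show ?thesis using J(1) m(1) I'(1)
      by (intro exI[of _ "insert m J"]) auto
  qed
qed

text \<open>
  The domain of integration is not written as an interval because the formula is also needed
  for \<open>y = \<infinity>\<close>.
\<close>

lemma layer_cake:
  assumes "0 < s"
  shows "enn_powr y s = (\<integral>\<^sup>+t. ennreal (s * t powr (s - 1)) * indicator {t. 0 < t \<and> ennreal t < y} t \<partial>lborel)"
    (is "_ = ?I y")
proof (cases y)
  case (real c)
  have "{t. 0 < t \<and> ennreal t < y} = {0<..<c}"
    using real by (auto simp: ennreal_less_iff)
  then show ?thesis
    using real assms nn_integral_powr_0_to[of s c] by simp
next
  case top
  have "of_nat n \<le> ?I y" for n :: nat
  proof -
    define c where "c = real n powr (1 / s)"
    have "of_nat n = ennreal (c powr s)"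
      using assms by (simp add: c_def powr_powr ennreal_of_nat_eq_real_of_nat)
    also have "\<dots> = (\<integral>\<^sup>+t\<in>{0<..<c}. ennreal (s * t powr (s - 1)) \<partial>lborel)"
      using assms by (intro nn_integral_powr_0_to[symmetric]) (auto simp: c_def)
    also have "\<dots> \<le> ?I y"
      by (intro nn_integral_mono) (auto simp: top split: split_indicator)
    finally show ?thesis .
  qed
  then have "(SUP n. of_nat n) \<le> ?I y" by (rule SUP_least)
  then show ?thesis using top by (simp add: ennreal_SUP_of_nat_eq_top top_unique)
qed

text \<open>
  The sets \<open>V i\<close> play the part of balls of radius \<open>r i\<close>, and \<open>V' i\<close> that of a fixed dilate of
  \<open>V i\<close>. Countability of the family makes the maximal function measurable and lets finite
  subfamilies, for which a greedy selection is possible, exhaust it.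
\<close>

locale doubling_family = finite_measure M for M :: "'a measure" +
  fixes V V' :: "'i :: countable \<Rightarrow> 'a set" and r :: "'i \<Rightarrow> real" and K :: real
  assumes sets_V [measurable]: "\<And>i. V i \<in> sets M" "\<And>i. V' i \<in> sets M"
    and V_pos: "\<And>i. 0 < emeasure M (V i)"
    and engulf: "\<And>i j. V i \<inter> V j \<noteq> {} \<Longrightarrow> r i \<le> r j \<Longrightarrow> V i \<subseteq> V' j"
    and dbl: "\<And>i. emeasure M (V' i) \<le> ennreal K * emeasure M (V i)"
    and K_pos: "0 < K"
begin

definition avg :: "('a \<Rightarrow> ennreal) \<Rightarrow> 'i \<Rightarrow> ennreal" where
  "avg \<phi> i = (\<integral>\<^sup>+x\<in>V i. \<phi> x \<partial>M) / emeasure M (V i)"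

definition maximal_fun :: "('a \<Rightarrow> ennreal) \<Rightarrow> 'a \<Rightarrow> ennreal" where
  "maximal_fun \<phi> x = (SUP i. indicator (V i) x * avg \<phi> i)"

lemma maximal_fun_measurable [measurable]: "maximal_fun \<phi> \<in> borel_measurable M"
  unfolding maximal_fun_def by measurable

lemma avg_le_maximal_fun: "x \<in> V i \<Longrightarrow> avg \<phi> i \<le> maximal_fun \<phi> x"
  unfolding maximal_fun_def by (rule SUP_upper2[of i]) auto

lemma self_subset: "V i \<subseteq> V' i"
  using V_pos[of i] engulf[of i i] by (cases "V i = {}") auto

text \<open>
  The enlargements of the selected disjoint sets cover the union, so by doubling these
  disjoint sets carry a fixed proportion of its measure; on disjoint sets the hypotheses can
  be added up.
\<close>

lemma finite_union_bound:
  assumes [measurable]: "\<phi> \<in> borel_measurable M" and "finite I"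
    and I: "\<And>i. i \<in> I \<Longrightarrow> ennreal t * emeasure M (V i) \<le> (\<integral>\<^sup>+x\<in>V i. \<phi> x \<partial>M)"
  shows "ennreal t * emeasure M (\<Union>i\<in>I. V i) \<le> ennreal K * (\<integral>\<^sup>+x. \<phi> x \<partial>M)"
proof -
  obtain J where J: "J \<subseteq> I" "disjoint_family_on V J" "(\<Union>i\<in>I. V i) \<subseteq> (\<Union>j\<in>J. V' j)"
    using Vitali_selection[of I V r V'] \<open>finite I\<close> engulf self_subset by metis
  have fJ: "finite J" using J(1) \<open>finite I\<close> finite_subset by auto
  have "emeasure M (\<Union>i\<in>I. V i) \<le> emeasure M (\<Union>j\<in>J. V' j)"
    using J(3) fJ by (intro emeasure_mono) (auto intro!: sets.finite_UN)
  also have "\<dots> \<le> (\<Sum>j\<in>J. emeasure M (V' j))"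
    using fJ by (intro emeasure_subadditive_finite) auto
  also have "\<dots> \<le> (\<Sum>j\<in>J. ennreal K * emeasure M (V j))"
    by (intro sum_mono dbl)
  finally have "ennreal t * emeasure M (\<Union>i\<in>I. V i) \<le> ennreal t * (\<Sum>j\<in>J. ennreal K * emeasure M (V j))"
    by (intro mult_left_mono) auto
  also have "\<dots> = ennreal K * (\<Sum>j\<in>J. ennreal t * emeasure M (V j))"
    by (simp add: sum_distrib_left mult_ac)
  also have "\<dots> \<le> ennreal K * (\<Sum>j\<in>J. \<integral>\<^sup>+x\<in>V j. \<phi> x \<partial>M)"
    using J(1) I by (intro mult_left_mono sum_mono) auto
  also have "(\<Sum>j\<in>J. \<integral>\<^sup>+x\<in>V j. \<phi> x \<partial>M) = (\<integral>\<^sup>+x. (\<Sum>j\<in>J. \<phi> x * indicator (V j) x) \<partial>M)"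
    by (subst nn_integral_sum) auto
  also have "\<dots> \<le> (\<integral>\<^sup>+x. \<phi> x \<partial>M)"
  proof (intro nn_integral_mono)
    fix x
    have "(\<Sum>j\<in>J. \<phi> x * indicator (V j) x) = \<phi> x * (\<Sum>j\<in>J. indicator (V j) x)"
      by (simp add: sum_distrib_left)
    also have "(\<Sum>j\<in>J. indicator (V j) x :: ennreal) = indicator (\<Union>j\<in>J. V j) x"
      by (rule indicator_UN_disjoint[OF fJ J(2), symmetric])
    finally show "(\<Sum>j\<in>J. \<phi> x * indicator (V j) x) \<le> \<phi> x"
      by (simp split: split_indicator)
  qed
  finally show ?thesis by (simp add: mult_left_mono)
qed

text \<open>
  The set where the maximal function exceeds \<open>t\<close> is the union of those \<open>V i\<close> on which the average
  of \<open>\<phi>\<close> exceeds \<open>t\<close>, hence an increasing limit of finite unions.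
\<close>

lemma maximal_weak_type:
  assumes [measurable]: "\<phi> \<in> borel_measurable M"
  shows "ennreal t * emeasure M {x \<in> space M. ennreal t < maximal_fun \<phi> x} \<le> ennreal K * (\<integral>\<^sup>+x. \<phi> x \<partial>M)"
proof -
  \<comment> \<open>The indices whose sets make up the level set.\<close>
  define I where "I = {i. ennreal t < avg \<phi> i}"
  define e where "e = (to_nat :: 'i \<Rightarrow> nat)"
  define A where "A n = (\<Union>i\<in>{i \<in> I. e i \<le> n}. V i)" for n
  have fin: "finite {i \<in> I. e i \<le> n}" for n
  proof (rule finite_imageD)
    show "finite (e ` {i \<in> I. e i \<le> n})" by (rule finite_subset[of _ "{..n}"]) auto
    show "inj_on e {i \<in> I. e i \<le> n}" unfolding e_def by (simp add: inj_on_def)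
  qed
  have eq: "{x \<in> space M. ennreal t < maximal_fun \<phi> x} = (\<Union>n. A n)"
  proof (intro set_eqI iffI)
    fix x assume "x \<in> {x \<in> space M. ennreal t < maximal_fun \<phi> x}"
    then obtain i where "ennreal t < indicator (V i) x * avg \<phi> i"
      by (auto simp: maximal_fun_def less_SUP_iff)
    then have "x \<in> V i" "i \<in> I" by (auto simp: I_def split: split_indicator_asm)
    then show "x \<in> (\<Union>n. A n)" by (auto simp: A_def)
  next
    fix x assume "x \<in> (\<Union>n. A n)"
    then obtain i where i: "x \<in> V i" "i \<in> I" by (auto simp: A_def)
    then have "ennreal t < maximal_fun \<phi> x"
      using avg_le_maximal_fun[OF i(1), of \<phi>] by (auto simp: I_def)
    then show "x \<in> {x \<in> space M. ennreal t < maximal_fun \<phi> x}"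
      using i(1) sets.sets_into_space[OF sets_V(1)[of i]] by auto
  qed
  have A [measurable]: "A n \<in> sets M" for n unfolding A_def using fin by (intro sets.finite_UN) auto
  have "incseq A" unfolding A_def incseq_def by fastforce
  then have "emeasure M (\<Union>n. A n) = (SUP n. emeasure M (A n))"
    by (intro SUP_emeasure_incseq[symmetric]) auto
  moreover have "ennreal t * emeasure M (A n) \<le> ennreal K * (\<integral>\<^sup>+x. \<phi> x \<partial>M)" for n
    unfolding A_def
  proof (rule finite_union_bound[OF assms fin])
    fix i assume "i \<in> {i \<in> I. e i \<le> n}"
    then have "ennreal t \<le> (\<integral>\<^sup>+x\<in>V i. \<phi> x \<partial>M) / emeasure M (V i)"
      by (auto simp: I_def avg_def)
    then have "ennreal t * emeasure M (V i) \<le> (\<integral>\<^sup>+x\<in>V i. \<phi> x \<partial>M) / emeasure M (V i) * emeasure M (V i)"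
      by (rule mult_right_mono) auto
    also have "\<dots> = (\<integral>\<^sup>+x\<in>V i. \<phi> x \<partial>M)"
      using V_pos[of i] by (simp add: ennreal_divide_times ennreal_divide_self less_top[symmetric])
    finally show "ennreal t * emeasure M (V i) \<le> (\<integral>\<^sup>+x\<in>V i. \<phi> x \<partial>M)" .
  qed
  ultimately show ?thesis
    unfolding eq by (simp add: SUP_mult_left_ennreal SUP_least)
qed

text \<open>
  The part of \<open>\<phi>\<close> below \<open>t / 2\<close> contributes at most \<open>t / 2\<close> to any average, so the excess over \<open>t\<close>
  is due to the part above \<open>t / 2\<close>.
\<close>

lemma maximal_weak_type_truncated:
  assumes [measurable]: "\<phi> \<in> borel_measurable M" and "0 < t"
  shows "ennreal t * emeasure M {x \<in> space M. ennreal t < maximal_fun \<phi> x}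
    \<le> ennreal (2 * K) * (\<integral>\<^sup>+x\<in>{x \<in> space M. ennreal (t / 2) < \<phi> x}. \<phi> x \<partial>M)"
proof -
  define \<psi> where "\<psi> x = \<phi> x * indicator {x \<in> space M. ennreal (t / 2) < \<phi> x} x" for x
  have [measurable]: "\<psi> \<in> borel_measurable M" unfolding \<psi>_def by measurable
  have le: "\<phi> x \<le> \<psi> x + ennreal (t / 2)" if "x \<in> space M" for x
    using that by (auto simp: \<psi>_def split: split_indicator)
  have avg: "avg \<phi> i \<le> avg \<psi> i + ennreal (t / 2)" for i
  proof -
    have "(\<integral>\<^sup>+x\<in>V i. \<phi> x \<partial>M) \<le> (\<integral>\<^sup>+x. \<psi> x * indicator (V i) x + ennreal (t / 2) * indicator (V i) x \<partial>M)"
      using le by (intro nn_integral_mono) (auto split: split_indicator)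
    also have "\<dots> = (\<integral>\<^sup>+x\<in>V i. \<psi> x \<partial>M) + ennreal (t / 2) * emeasure M (V i)"
      by (simp add: nn_integral_add nn_integral_cmult_indicator)
    finally have "avg \<phi> i \<le> ((\<integral>\<^sup>+x\<in>V i. \<psi> x \<partial>M) + ennreal (t / 2) * emeasure M (V i)) / emeasure M (V i)"
      unfolding avg_def by (rule divide_right_mono_ennreal)
    also have "\<dots> = avg \<psi> i + ennreal (t / 2)"
      using V_pos[of i] emeasure_finite[of "V i"]
      by (simp add: avg_def add_divide_distrib_ennreal mult_divide_eq_ennreal)
    finally show ?thesis .
  qed
  have "{x \<in> space M. ennreal t < maximal_fun \<phi> x} \<subseteq> {x \<in> space M. ennreal (t / 2) < maximal_fun \<psi> x}"
  proof safe
    fix x assume x: "x \<in> space M" "ennreal t < maximal_fun \<phi> x"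
    then obtain i where i: "ennreal t < indicator (V i) x * avg \<phi> i"
      by (auto simp: maximal_fun_def less_SUP_iff)
    then have xi: "x \<in> V i" and "ennreal t < avg \<phi> i" by (auto split: split_indicator_asm)
    then have "ennreal (t / 2) + ennreal (t / 2) < avg \<psi> i + ennreal (t / 2)"
      using avg[of i] \<open>0 < t\<close> by (simp add: ennreal_plus[symmetric] del: ennreal_plus)
    then have "ennreal (t / 2) < avg \<psi> i"
      by (metis add_right_mono linorder_not_less)
    then show "ennreal (t / 2) < maximal_fun \<psi> x"
      using avg_le_maximal_fun[OF xi, of \<psi>] by simp
  qed
  then have "emeasure M {x \<in> space M. ennreal t < maximal_fun \<phi> x} \<le> emeasure M {x \<in> space M. ennreal (t / 2) < maximal_fun \<psi> x}"
    by (intro emeasure_mono) auto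
  then have "ennreal t * emeasure M {x \<in> space M. ennreal t < maximal_fun \<phi> x}
      \<le> ennreal 2 * (ennreal (t / 2) * emeasure M {x \<in> space M. ennreal (t / 2) < maximal_fun \<psi> x})"
    using \<open>0 < t\<close> by (simp add: mult.assoc[symmetric] ennreal_mult[symmetric] mult_left_mono del: ennreal_numeral)
  also have "\<dots> \<le> ennreal 2 * (ennreal K * (\<integral>\<^sup>+x. \<psi> x \<partial>M))"
    by (intro mult_left_mono maximal_weak_type) auto
  also have "\<dots> = ennreal (2 * K) * (\<integral>\<^sup>+x\<in>{x \<in> space M. ennreal (t / 2) < \<phi> x}. \<phi> x \<partial>M)"
    using K_pos by (simp add: \<psi>_def ennreal_mult mult.assoc)
  finally show ?thesis .
qed

text \<open>
  Integrate the truncated weak type inequality against \<open>s t^{s-1} dt\<close>. After an exchange of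
  the integrals the inner one is \<open>\<integral> s t^{s-2} dt\<close> over \<open>0 < t < 2 \<phi>\<close>, which converges at \<open>0\<close>
  because \<open>s > 1\<close>.
\<close>

lemma maximal_strong_type:
  assumes [measurable]: "\<phi> \<in> borel_measurable M" and s: "1 < s"
  shows "(\<integral>\<^sup>+x. enn_powr (maximal_fun \<phi> x) s \<partial>M)
    \<le> ennreal (2 * K * s / (s - 1) * 2 powr (s - 1)) * (\<integral>\<^sup>+x. enn_powr (\<phi> x) s \<partial>M)"
proof -
  interpret pair_sigma_finite M lborel ..
  \<comment> \<open>This turns the truncation level into a bound for \<open>t\<close> that also makes sense for \<open>y = \<infinity>\<close>.\<close>
  have scale: "ennreal (t / 2) < y \<longleftrightarrow> ennreal t < 2 * y" if "0 < t" for t and y :: ennreal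
  proof (cases y)
    case (real c)
    then have "2 * y = ennreal (2 * c)" by (simp add: ennreal_mult)
    then show ?thesis using real that by (simp add: ennreal_less_iff field_simps)
  qed (simp add: ennreal_mult_top)
  have "(\<integral>\<^sup>+x. enn_powr (maximal_fun \<phi> x) s \<partial>M)
    = (\<integral>\<^sup>+x. (\<integral>\<^sup>+t. ennreal (s * t powr (s - 1)) * indicator {t. 0 < t \<and> ennreal t < maximal_fun \<phi> x} t \<partial>lborel) \<partial>M)"
    using s by (intro nn_integral_cong layer_cake) auto
  also have "\<dots> = (\<integral>\<^sup>+t. (\<integral>\<^sup>+x. ennreal (s * t powr (s - 1)) * indicator {t. 0 < t \<and> ennreal t < maximal_fun \<phi> x} t \<partial>M) \<partial>lborel)"
    by (rule Fubini'[symmetric]) measurable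
  also have "\<dots> \<le> (\<integral>\<^sup>+t. (\<integral>\<^sup>+x. \<phi> x * (ennreal (2 * K * s * t powr (s - 2)) * indicator {t. 0 < t \<and> ennreal t < 2 * \<phi> x} t) \<partial>M) \<partial>lborel)"
  proof (rule nn_integral_mono)
    fix t :: real
    show "(\<integral>\<^sup>+x. ennreal (s * t powr (s - 1)) * indicator {t. 0 < t \<and> ennreal t < maximal_fun \<phi> x} t \<partial>M)
      \<le> (\<integral>\<^sup>+x. \<phi> x * (ennreal (2 * K * s * t powr (s - 2)) * indicator {t. 0 < t \<and> ennreal t < 2 * \<phi> x} t) \<partial>M)"
    proof (cases "0 < t")
      case False
      then show ?thesis by simp
    next
      case True
      have "(\<integral>\<^sup>+x. ennreal (s * t powr (s - 1)) * indicator {t. 0 < t \<and> ennreal t < maximal_fun \<phi> x} t \<partial>M)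
        = (\<integral>\<^sup>+x. ennreal (s * t powr (s - 1)) * indicator {x \<in> space M. ennreal t < maximal_fun \<phi> x} x \<partial>M)"
        using True by (intro nn_integral_cong) (auto split: split_indicator)
      also have "\<dots> = ennreal (s * t powr (s - 1)) * emeasure M {x \<in> space M. ennreal t < maximal_fun \<phi> x}"
        by (simp add: nn_integral_cmult_indicator)
      also have "\<dots> = ennreal (s * t powr (s - 2)) * (ennreal t * emeasure M {x \<in> space M. ennreal t < maximal_fun \<phi> x})"
      proof -
        have "t powr (s - 1) = t powr (s - 2) * t"
          using True powr_add[of t "s - 2" 1] by simp
        then show ?thesis using True s by (simp add: ennreal_mult mult_ac)
      qed
      also have "\<dots> \<le> ennreal (s * t powr (s - 2)) * (ennreal (2 * K) * (\<integral>\<^sup>+x\<in>{x \<in> space M. ennreal (t / 2) < \<phi> x}. \<phi> x \<partial>M))"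
        using True by (intro mult_left_mono maximal_weak_type_truncated) auto
      also have "\<dots> = ennreal (2 * K * s * t powr (s - 2)) * (\<integral>\<^sup>+x\<in>{x \<in> space M. ennreal (t / 2) < \<phi> x}. \<phi> x \<partial>M)"
        using K_pos s by (simp add: ennreal_mult mult_ac)
      also have "\<dots> = (\<integral>\<^sup>+x. ennreal (2 * K * s * t powr (s - 2)) * (\<phi> x * indicator {x \<in> space M. ennreal (t / 2) < \<phi> x} x) \<partial>M)"
        by (rule nn_integral_cmult[symmetric]) measurable
      also have "\<dots> = (\<integral>\<^sup>+x. \<phi> x * (ennreal (2 * K * s * t powr (s - 2)) * indicator {t. 0 < t \<and> ennreal t < 2 * \<phi> x} t) \<partial>M)"
        using True by (intro nn_integral_cong) (auto simp: scale mult_ac split: split_indicator)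
      finally show ?thesis .
    qed
  qed
  also have "\<dots> = (\<integral>\<^sup>+x. (\<integral>\<^sup>+t. \<phi> x * (ennreal (2 * K * s * t powr (s - 2)) * indicator {t. 0 < t \<and> ennreal t < 2 * \<phi> x} t) \<partial>lborel) \<partial>M)"
    by (rule Fubini') measurable
  also have "\<dots> = (\<integral>\<^sup>+x. ennreal (2 * K * s / (s - 1) * 2 powr (s - 1)) * enn_powr (\<phi> x) s \<partial>M)"
  proof (rule nn_integral_cong)
    fix x
    have "(\<integral>\<^sup>+t. \<phi> x * (ennreal (2 * K * s * t powr (s - 2)) * indicator {t. 0 < t \<and> ennreal t < 2 * \<phi> x} t) \<partial>lborel)
       = (\<integral>\<^sup>+t. \<phi> x * ennreal (2 * K * s / (s - 1)) * (ennreal ((s - 1) * t powr (s - 1 - 1)) * indicator {t. 0 < t \<and> ennreal t < 2 * \<phi> x} t) \<partial>lborel)"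
    proof (rule nn_integral_cong)
      fix t :: real
      have "2 * K * s * t powr (s - 2) = 2 * K * s / (s - 1) * ((s - 1) * t powr (s - 1 - 1))"
        using s by (simp add: field_simps)
      then have "ennreal (2 * K * s * t powr (s - 2)) = ennreal (2 * K * s / (s - 1)) * ennreal ((s - 1) * t powr (s - 1 - 1))"
        using s K_pos by (subst ennreal_mult[symmetric]) auto
      then show "\<phi> x * (ennreal (2 * K * s * t powr (s - 2)) * indicator {t. 0 < t \<and> ennreal t < 2 * \<phi> x} t)
        = \<phi> x * ennreal (2 * K * s / (s - 1)) * (ennreal ((s - 1) * t powr (s - 1 - 1)) * indicator {t. 0 < t \<and> ennreal t < 2 * \<phi> x} t)"
        by (simp add: mult.assoc)
    qed
    also have "\<dots> = \<phi> x * ennreal (2 * K * s / (s - 1)) * enn_powr (2 * \<phi> x) (s - 1)"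
      using s by (subst nn_integral_cmult, measurable) (subst layer_cake, auto)
    also have "\<dots> = ennreal (2 * K * s / (s - 1) * 2 powr (s - 1)) * (enn_powr (\<phi> x) 1 * enn_powr (\<phi> x) (s - 1))"
    proof -
      have "enn_powr 2 (s - 1) = ennreal (2 powr (s - 1))"
        using enn_powr_ennreal[of 2 "s - 1"] by simp
      moreover have "ennreal (2 * K * s / (s - 1) * 2 powr (s - 1)) = ennreal (2 * K * s / (s - 1)) * ennreal (2 powr (s - 1))"
        using s K_pos by (intro ennreal_mult) auto
      ultimately show ?thesis by (simp only: enn_powr_mult enn_powr_1 mult_ac)
    qed
    also have "enn_powr (\<phi> x) 1 * enn_powr (\<phi> x) (s - 1) = enn_powr (\<phi> x) s"
      using s enn_powr_add[of 1 "s - 1" "\<phi> x"] by simp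
    finally show "(\<integral>\<^sup>+t. \<phi> x * (ennreal (2 * K * s * t powr (s - 2)) * indicator {t. 0 < t \<and> ennreal t < 2 * \<phi> x} t) \<partial>lborel)
      = ennreal (2 * K * s / (s - 1) * 2 powr (s - 1)) * enn_powr (\<phi> x) s" .
  qed
  also have "\<dots> = ennreal (2 * K * s / (s - 1) * 2 powr (s - 1)) * (\<integral>\<^sup>+x. enn_powr (\<phi> x) s \<partial>M)"
    by (rule nn_integral_cmult) measurable
  finally show ?thesis .
qed

end

section \<open>Averages over shadows and the test function estimate\<close>

text \<open>
  Its purpose is to divide a power of \<open>X\<close> out of a bound for \<open>X\<close> in terms of itself, which
  requires that \<open>X\<close> is known to be finite.
\<close>

lemma enn_powr_absorb:
  assumes "1 < s" "1 < t" "1 / s + 1 / t = 1" "X < top" "X \<le> B * enn_powr X (1 / t)"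
  shows "X \<le> enn_powr B s"
proof (cases "X = 0 \<or> B = top")
  case True
  then show ?thesis by auto
next
  case False
  then obtain x b where x: "X = ennreal x" "0 < x" and b: "B = ennreal b" "0 \<le> b"
    using assms(4) by (cases X; cases B) (auto simp: less_le)
  have "x \<le> b * x powr (1 / t)"
    using assms(5) x b by (simp add: ennreal_mult[symmetric])
  moreover have "x = x powr (1 / s) * x powr (1 / t)"
    using x assms(3) by (simp add: powr_add[symmetric])
  ultimately have "x powr (1 / s) \<le> b"
    using x by (metis mult_le_cancel_right_pos powr_gt_zero less_numeral_extra(3))
  then have "(x powr (1 / s)) powr s \<le> b powr s"
    using assms(1) by (intro powr_mono2) auto
  then show ?thesis using x b assms(1) by (simp add: powr_powr ennreal_leI)
qed

lemma conj_exponent_facts: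
  fixes p p' q q' :: real
  assumes "1 < p" "1 / p + 1 / p' = 1" "1 < q" "1 / q + 1 / q' = 1"
  shows "1 < p'" "1 < q'" "p' * (p - 1) = p" "p * (p' - 1) = p'"
    "p * (p' / q' - 1) + p / q = p' / q'"
proof -
  have "1 / p' = (p - 1) / p" "1 / q' = (q - 1) / q"
    using assms by (simp_all add: diff_divide_distrib)
  then have "1 / (1 / p') = 1 / ((p - 1) / p)" "1 / (1 / q') = 1 / ((q - 1) / q)" by simp_all
  then have p': "p' = p / (p - 1)" and q': "q' = q / (q - 1)" by simp_all
  show "1 < p'" "1 < q'" using assms by (auto simp: p' q')
  show "p' * (p - 1) = p" "p * (p' - 1) = p'" using assms by (auto simp: p' field_simps)
  show "p * (p' / q' - 1) + p / q = p' / q'"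
    using assms by (simp add: p' q' field_simps)
qed

definition tent_mass :: "'a measure \<Rightarrow> ('a \<Rightarrow> 'b set) \<Rightarrow> 'b \<Rightarrow> ennreal" where
  "tent_mass M \<Gamma> z = (\<integral>\<^sup>+\<zeta>. indicator (\<Gamma> \<zeta>) z \<partial>M)"

text \<open>
  The mean over the shadow \<open>{\<zeta>. z \<in> \<Gamma> \<zeta>}\<close> of \<open>z\<close>. It replaces a function of \<open>\<zeta>\<close> by a function of
  the point \<open>z\<close>.
\<close>

definition tent_avg :: "'a measure \<Rightarrow> ('a \<Rightarrow> 'b set) \<Rightarrow> ('a \<Rightarrow> ennreal) \<Rightarrow> 'b \<Rightarrow> ennreal" where
  "tent_avg M \<Gamma> \<phi> z = (\<integral>\<^sup>+\<zeta>. \<phi> \<zeta> * indicator (\<Gamma> \<zeta>) z \<partial>M) / tent_mass M \<Gamma> z"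

text \<open>
  The boundary with its weighted measure is \<open>M\<close>, the ball with the measure that defines the
  inner norm is \<open>N\<close>, and \<open>\<Gamma> \<zeta>\<close> is the approach region at \<open>\<zeta>\<close>. The last assumption is the maximal
  theorem in the form in which the duality argument uses it: the mean over the shadow of \<open>z\<close> is
  bounded, at every point of that shadow, by a function whose \<open>L^s\<close> norm is under control.
\<close>

locale tent_space = M: finite_measure M + N: sigma_finite_measure N
  for M :: "'a measure" and N :: "'b measure" +
  fixes \<Gamma> :: "'a \<Rightarrow> 'b set"
  assumes \<Gamma>_pair: "Measurable.pred (M \<Otimes>\<^sub>M N) (\<lambda>x. snd x \<in> \<Gamma> (fst x))"
    and mass_pos: "\<And>z. z \<in> space N \<Longrightarrow> 0 < tent_mass M \<Gamma> z"
    and maximal: "\<And>s. 1 < s \<Longrightarrow> \<exists>C>0. \<forall>\<phi>\<in>borel_measurable M. \<exists>\<Phi>\<in>borel_measurable M.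
      (\<forall>\<zeta>\<in>space M. \<forall>z\<in>space N. z \<in> \<Gamma> \<zeta> \<longrightarrow> tent_avg M \<Gamma> \<phi> z \<le> \<Phi> \<zeta>) \<and>
      (\<integral>\<^sup>+\<zeta>. enn_powr (\<Phi> \<zeta>) s \<partial>M) \<le> ennreal C * (\<integral>\<^sup>+\<zeta>. enn_powr (\<phi> \<zeta>) s \<partial>M)"
begin

sublocale pair_sigma_finite M N ..

abbreviation "W \<equiv> tent_mass M \<Gamma>"
abbreviation "A \<equiv> tent_avg M \<Gamma>"

definition area :: "('b \<Rightarrow> ennreal) \<Rightarrow> 'a \<Rightarrow> ennreal" where
  "area k \<zeta> = (\<integral>\<^sup>+z. k z * indicator (\<Gamma> \<zeta>) z \<partial>N)"

lemma \<Gamma>_measurable [measurable (raw)]: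
  assumes [measurable]: "f \<in> measurable L M" "g \<in> measurable L N"
  shows "Measurable.pred L (\<lambda>x. g x \<in> \<Gamma> (f x))"
  using measurable_compose[OF measurable_Pair[OF assms] \<Gamma>_pair] by simp

lemma mass_finite: "W z < top"
proof -
  have "W z \<le> (\<integral>\<^sup>+\<zeta>. 1 \<partial>M)"
    unfolding tent_mass_def by (intro nn_integral_mono) (auto split: split_indicator)
  then show ?thesis using M.emeasure_finite[of "space M"] by (metis (full_types) less_top nn_integral_const mult_1 top_unique)
qed

lemma mass_measurable [measurable]: "W \<in> borel_measurable N"
  unfolding tent_mass_def by measurable

lemma avg_measurable [measurable]:
  assumes [measurable]: "\<phi> \<in> borel_measurable M"
  shows "A \<phi> \<in> borel_measurable N"
  unfolding tent_avg_def by measurable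

lemma area_measurable [measurable]:
  assumes [measurable]: "k \<in> borel_measurable N"
  shows "area k \<in> borel_measurable M"
  unfolding area_def by measurable

lemma avg_times_mass:
  assumes "z \<in> space N"
  shows "A \<phi> z * W z = (\<integral>\<^sup>+\<zeta>. \<phi> \<zeta> * indicator (\<Gamma> \<zeta>) z \<partial>M)"
  using mass_pos[OF assms] mass_finite[of z]
  by (simp add: tent_avg_def ennreal_divide_times ennreal_divide_self)

lemma area_mono:
  assumes "\<And>z. z \<in> space N \<Longrightarrow> z \<in> \<Gamma> \<zeta> \<Longrightarrow> k z \<le> k' z"
  shows "area k \<zeta> \<le> area k' \<zeta>"
  unfolding area_def by (intro nn_integral_mono) (use assms in \<open>auto split: split_indicator\<close>)

lemma area_cmult:
  assumes [measurable]: "k \<in> borel_measurable N" and \<zeta> [measurable]: "\<zeta> \<in> space M"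
  shows "area (\<lambda>z. c * k z) \<zeta> = c * area k \<zeta>"
  unfolding area_def by (simp add: mult.assoc nn_integral_cmult)

text \<open>
  Tonelli's theorem. In this sense averaging over shadows is adjoint to integration over
  approach regions, and it passes from one factor of an integral to the other.
\<close>

lemma avg_duality:
  assumes [measurable]: "k \<in> borel_measurable N" "\<phi> \<in> borel_measurable M"
  shows "(\<integral>\<^sup>+\<zeta>. \<phi> \<zeta> * area k \<zeta> \<partial>M) = (\<integral>\<^sup>+z. k z * (A \<phi> z * W z) \<partial>N)"
proof -
  have "(\<integral>\<^sup>+\<zeta>. \<phi> \<zeta> * area k \<zeta> \<partial>M) = (\<integral>\<^sup>+\<zeta>. (\<integral>\<^sup>+z. \<phi> \<zeta> * (k z * indicator (\<Gamma> \<zeta>) z) \<partial>N) \<partial>M)"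
    unfolding area_def by (intro nn_integral_cong nn_integral_cmult[symmetric]) measurable
  also have "\<dots> = (\<integral>\<^sup>+z. (\<integral>\<^sup>+\<zeta>. \<phi> \<zeta> * (k z * indicator (\<Gamma> \<zeta>) z) \<partial>M) \<partial>N)"
    by (rule Fubini'[symmetric]) measurable
  also have "\<dots> = (\<integral>\<^sup>+z. k z * (A \<phi> z * W z) \<partial>N)"
  proof (rule nn_integral_cong)
    fix z assume z [measurable]: "z \<in> space N"
    have "(\<integral>\<^sup>+\<zeta>. \<phi> \<zeta> * (k z * indicator (\<Gamma> \<zeta>) z) \<partial>M) = (\<integral>\<^sup>+\<zeta>. k z * (\<phi> \<zeta> * indicator (\<Gamma> \<zeta>) z) \<partial>M)"
      by (simp add: mult_ac)
    also have "\<dots> = k z * (\<integral>\<^sup>+\<zeta>. \<phi> \<zeta> * indicator (\<Gamma> \<zeta>) z \<partial>M)"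
      by (intro nn_integral_cmult) measurable
    finally show "(\<integral>\<^sup>+\<zeta>. \<phi> \<zeta> * (k z * indicator (\<Gamma> \<zeta>) z) \<partial>M) = k z * (A \<phi> z * W z)"
      using z by (simp add: avg_times_mass)
  qed
  finally show ?thesis .
qed

lemma avg_le_const:
  assumes "\<And>\<zeta>. \<zeta> \<in> space M \<Longrightarrow> \<phi> \<zeta> \<le> c" and z [measurable]: "z \<in> space N"
  shows "A \<phi> z \<le> c"
proof -
  have "(\<integral>\<^sup>+\<zeta>. \<phi> \<zeta> * indicator (\<Gamma> \<zeta>) z \<partial>M) \<le> (\<integral>\<^sup>+\<zeta>. c * indicator (\<Gamma> \<zeta>) z \<partial>M)"
    using assms by (intro nn_integral_mono mult_right_mono) auto
  also have "\<dots> = c * W z"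
    unfolding tent_mass_def by (intro nn_integral_cmult) measurable
  finally have "A \<phi> z \<le> c * W z / W z"
    unfolding tent_avg_def by (rule divide_right_mono_ennreal)
  also have "\<dots> = c"
    using mass_pos[OF z] mass_finite[of z] by (simp add: mult_divide_eq_ennreal)
  finally show ?thesis .
qed

text \<open>
  The mean is taken with respect to a probability measure on the shadow, so this is Hoelder's
  inequality with the constant function 1 as second factor.
\<close>

lemma avg_Jensen:
  assumes [measurable]: "\<phi> \<in> borel_measurable M" and z [measurable]: "z \<in> space N"
    and q: "1 < q" "1 < q'" "1 / q + 1 / q' = 1"
  shows "enn_powr (A \<phi> z) q \<le> A (\<lambda>\<zeta>. enn_powr (\<phi> \<zeta>) q) z"
proof -
  obtain c where c: "W z = ennreal c" "0 < c"
    using mass_pos[OF z] mass_finite[of z] by (cases "W z") (auto simp: ennreal_less_zero_iff)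
  define J where "J = (\<integral>\<^sup>+\<zeta>. enn_powr (\<phi> \<zeta>) q * indicator (\<Gamma> \<zeta>) z \<partial>M)"
  have "(\<integral>\<^sup>+\<zeta>. \<phi> \<zeta> * indicator (\<Gamma> \<zeta>) z \<partial>M)
      = (\<integral>\<^sup>+\<zeta>. (\<phi> \<zeta> * indicator (\<Gamma> \<zeta>) z) * indicator (\<Gamma> \<zeta>) z \<partial>M)"
    by (intro nn_integral_cong) (auto split: split_indicator)
  also have "\<dots> \<le> enn_powr (\<integral>\<^sup>+\<zeta>. enn_powr (\<phi> \<zeta> * indicator (\<Gamma> \<zeta>) z) q \<partial>M) (1 / q)
      * enn_powr (\<integral>\<^sup>+\<zeta>. enn_powr (indicator (\<Gamma> \<zeta>) z) q' \<partial>M) (1 / q')"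
    by (intro nn_integral_Hoelder q) measurable
  also have "(\<integral>\<^sup>+\<zeta>. enn_powr (\<phi> \<zeta> * indicator (\<Gamma> \<zeta>) z) q \<partial>M) = J"
    unfolding J_def by (intro nn_integral_cong) (auto split: split_indicator)
  also have "(\<integral>\<^sup>+\<zeta>. enn_powr (indicator (\<Gamma> \<zeta>) z) q' \<partial>M) = W z"
    unfolding tent_mass_def by (intro nn_integral_cong) (auto split: split_indicator)
  finally have "A \<phi> z \<le> (enn_powr J (1 / q) * enn_powr (W z) (1 / q')) / W z"
    unfolding tent_avg_def by (rule divide_right_mono_ennreal)
  then have "enn_powr (A \<phi> z) q \<le> enn_powr ((enn_powr J (1 / q) * enn_powr (W z) (1 / q')) / W z) q"
    using q by (intro enn_powr_mono) auto
  also have "\<dots> = J / W z"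
  proof -
    have e: "(1 / q') * q = q - 1" using q by (simp add: field_simps)
    have "enn_powr (inverse (W z)) q = ennreal (inverse c powr q)"
      using c by (simp add: inverse_ennreal)
    moreover have "c powr (q - 1) * inverse c powr q = inverse c"
      using c by (simp add: powr_diff powr_divide inverse_eq_divide)
    ultimately show ?thesis
      using c q e
      by (simp add: divide_ennreal_def enn_powr_mult enn_powr_powr mult.assoc ennreal_mult[symmetric] inverse_ennreal
          powr_mult powr_powr)
  qed
  finally show ?thesis by (simp add: tent_avg_def J_def)
qed

text \<open>
  This says that averaging the extremal function does not spoil its norm. For \<open>k = |g|^{q'}\<close>
  and \<open>N = (area k)^{1/q'}\<close>, the integral of \<open>(area k)^{p'/q'}\<close> is the \<open>p'\<close>-th power of the norm
  of \<open>g\<close>, and the third condition reads \<open>\<phi> \<le> N^{p'-q'}\<close>, with right-hand side the weight of the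
  extremal function. The left-hand side of the conclusion is the \<open>p\<close>-th power of the norm of
  \<open>|g|^{q'-1} A \<phi>\<close>. The bounds \<open>a\<close> and \<open>b\<close> keep all integrals finite; the constant \<open>C\<close> is
  independent of them.
\<close>

definition test_bounded :: "real \<Rightarrow> real \<Rightarrow> real \<Rightarrow> real \<Rightarrow> real \<Rightarrow> bool" where
  "test_bounded p q p' q' C \<longleftrightarrow>
    (\<forall>k\<in>borel_measurable N. \<forall>\<phi>\<in>borel_measurable M. \<forall>a b.
     (\<forall>\<zeta>\<in>space M. area k \<zeta> \<le> ennreal a) \<longrightarrow> (\<forall>\<zeta>\<in>space M. \<phi> \<zeta> \<le> ennreal b) \<longrightarrow>
     (\<forall>\<zeta>\<in>space M. \<phi> \<zeta> \<le> ennreal (enn2real (area k \<zeta>) powr (p' / q' - 1))) \<longrightarrow>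
     (\<integral>\<^sup>+\<zeta>. enn_powr (area (\<lambda>z. k z * enn_powr (A \<phi> z) q) \<zeta>) (p / q) \<partial>M)
       \<le> ennreal C * (\<integral>\<^sup>+\<zeta>. enn_powr (area k \<zeta>) (p' / q') \<partial>M))"

text \<open>
  Put \<open>s = p / q > 1\<close>, let \<open>t\<close> be the conjugate exponent, and let \<open>U\<close> be the area integral on
  the left. The integral \<open>X\<close> of \<open>U^s\<close> is the integral of \<open>U\<close> against \<open>\<psi> = U^{s-1}\<close>. Jensen's
  inequality brings the exponent \<open>q\<close> inside the average; by adjointness the average then falls
  on \<open>\<psi>\<close>, where it is bounded by a maximal function with \<open>L^t\<close> norm at most a multiple of
  \<open>(\<integral> \<psi>^t)^{1/t} = X^{1/t}\<close>. Hoelder's inequality gives \<open>X \<le> Y^{1/s} (C X)^{1/t}\<close>, and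
  since \<open>X\<close> is finite this bounds \<open>X\<close>.
\<close>

lemma test_bound_gt:
  assumes pq: "1 < q" "q < p" "1 / p + 1 / p' = 1" "1 / q + 1 / q' = 1"
  shows "\<exists>C>0. test_bounded p q p' q' C"
proof -
  define s where "s = p / q"
  define t where "t = s / (s - 1)"
  have st: "1 < s" "1 < t" "1 / s + 1 / t = 1" "(s - 1) * t = s"
    using pq by (auto simp: s_def t_def field_simps)
  have ts: "s / t = s - 1" using st by (simp add: field_simps)
  note ex = conj_exponent_facts[of p p' q q', OF _ pq(3,1,4)]
  obtain C where C: "C > 0" and max: "\<And>\<phi>. \<phi> \<in> borel_measurable M \<Longrightarrow> \<exists>\<Phi>\<in>borel_measurable M.
      (\<forall>\<zeta>\<in>space M. \<forall>z\<in>space N. z \<in> \<Gamma> \<zeta> \<longrightarrow> A \<phi> z \<le> \<Phi> \<zeta>) \<and>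
      (\<integral>\<^sup>+\<zeta>. enn_powr (\<Phi> \<zeta>) t \<partial>M) \<le> ennreal C * (\<integral>\<^sup>+\<zeta>. enn_powr (\<phi> \<zeta>) t \<partial>M)"
    using maximal[OF st(2)] by blast
  show ?thesis
    unfolding test_bounded_def
  proof (intro exI[of _ "C powr (s - 1)"] conjI ballI allI impI)
    show "C powr (s - 1) > 0" using C by simp
  next
    fix k \<phi> and a b :: real
    assume [measurable]: "k \<in> borel_measurable N" "\<phi> \<in> borel_measurable M"
      and a: "\<forall>\<zeta>\<in>space M. area k \<zeta> \<le> ennreal a" and b: "\<forall>\<zeta>\<in>space M. \<phi> \<zeta> \<le> ennreal b"
      and le: "\<forall>\<zeta>\<in>space M. \<phi> \<zeta> \<le> ennreal (enn2real (area k \<zeta>) powr (p' / q' - 1))"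
    define U where "U = area (\<lambda>z. k z * enn_powr (A \<phi> z) q)"
    define \<psi> where "\<psi> \<zeta> = enn_powr (U \<zeta>) (s - 1)" for \<zeta>
    define X where "X = (\<integral>\<^sup>+\<zeta>. enn_powr (U \<zeta>) s \<partial>M)"
    define Y where "Y = (\<integral>\<^sup>+\<zeta>. enn_powr (area k \<zeta>) (p' / q') \<partial>M)"
    have [measurable]: "U \<in> borel_measurable M" "\<psi> \<in> borel_measurable M"
      unfolding U_def \<psi>_def by measurable
    obtain \<Psi> where [measurable]: "\<Psi> \<in> borel_measurable M"
      and \<Psi>: "\<And>\<zeta> z. \<zeta> \<in> space M \<Longrightarrow> z \<in> space N \<Longrightarrow> z \<in> \<Gamma> \<zeta> \<Longrightarrow> A \<psi> z \<le> \<Psi> \<zeta>"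
      and \<Psi>_le: "(\<integral>\<^sup>+\<zeta>. enn_powr (\<Psi> \<zeta>) t \<partial>M) \<le> ennreal C * (\<integral>\<^sup>+\<zeta>. enn_powr (\<psi> \<zeta>) t \<partial>M)"
      using max[of \<psi>] by auto
    have U_le: "U \<zeta> \<le> ennreal (b powr q * a)" if \<zeta>: "\<zeta> \<in> space M" for \<zeta>
    proof -
      have "U \<zeta> \<le> area (\<lambda>z. enn_powr (ennreal b) q * k z) \<zeta>"
        unfolding U_def using pq b
        by (intro area_mono) (auto simp: mult.commute intro!: mult_left_mono enn_powr_mono avg_le_const)
      also have "\<dots> = enn_powr (ennreal b) q * area k \<zeta>"
        using \<zeta> by (intro area_cmult) auto
      also have "\<dots> \<le> enn_powr (ennreal b) q * ennreal a"
        using a \<zeta> by (intro mult_left_mono) auto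
      also have "\<dots> \<le> ennreal (b powr q * a)"
        by (cases "0 \<le> b"; cases "0 \<le> a") (auto simp: ennreal_mult ennreal_neg)
      finally show ?thesis .
    qed
    have "X \<le> (\<integral>\<^sup>+\<zeta>. enn_powr (ennreal (b powr q * a)) s \<partial>M)"
      unfolding X_def using st U_le by (intro nn_integral_mono enn_powr_mono) auto
    also have "\<dots> < top"
      using M.emeasure_finite[of "space M"] by (simp add: less_top[symmetric] ennreal_mult_eq_top_iff)
    finally have X_fin: "X < top" .
    have Y_ge: "(\<integral>\<^sup>+\<zeta>. enn_powr (enn_powr (\<phi> \<zeta>) q * area k \<zeta>) s \<partial>M) \<le> Y"
      unfolding Y_def
    proof (rule nn_integral_mono)
      fix \<zeta> assume \<zeta>: "\<zeta> \<in> space M"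
      obtain x where x: "area k \<zeta> = ennreal x" "0 \<le> x"
        using a \<zeta> by (cases "area k \<zeta>") (auto simp: top_unique)
      obtain f where f: "\<phi> \<zeta> = ennreal f" "0 \<le> f"
        using b \<zeta> by (cases "\<phi> \<zeta>") (auto simp: top_unique)
      have fx: "f \<le> x powr (p' / q' - 1)" using le \<zeta> x f by force
      have "(f powr q * x) powr s = f powr p * x powr (p / q)"
        using f x pq by (simp add: s_def powr_mult powr_powr)
      also have "\<dots> \<le> (x powr (p' / q' - 1)) powr p * x powr (p / q)"
        using fx f pq by (intro mult_right_mono powr_mono2) auto
      also have "\<dots> = x powr (p' / q')"
        using ex(5) pq by (simp add: powr_powr powr_add[symmetric] mult.commute add.commute)
      finally show "enn_powr (enn_powr (\<phi> \<zeta>) q * area k \<zeta>) s \<le> enn_powr (area k \<zeta>) (p' / q')"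
        using x f by (simp add: ennreal_mult[symmetric] ennreal_leI)
    qed
    have "X = (\<integral>\<^sup>+\<zeta>. \<psi> \<zeta> * U \<zeta> \<partial>M)"
      unfolding X_def \<psi>_def using st enn_powr_add[of "s - 1" 1] by (intro nn_integral_cong) auto
    also have "\<dots> = (\<integral>\<^sup>+z. k z * enn_powr (A \<phi> z) q * (A \<psi> z * W z) \<partial>N)"
      unfolding U_def by (intro avg_duality) measurable
    also have "\<dots> \<le> (\<integral>\<^sup>+z. (k z * A \<psi> z) * (A (\<lambda>\<zeta>. enn_powr (\<phi> \<zeta>) q) z * W z) \<partial>N)"
    proof (rule nn_integral_mono)
      fix z assume z: "z \<in> space N"
      have "k z * enn_powr (A \<phi> z) q * (A \<psi> z * W z) \<le> k z * A (\<lambda>\<zeta>. enn_powr (\<phi> \<zeta>) q) z * (A \<psi> z * W z)"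
        using avg_Jensen[OF _ z pq(1) ex(2) pq(4), of \<phi>] pq by (intro mult_right_mono mult_left_mono) auto
      then show "k z * enn_powr (A \<phi> z) q * (A \<psi> z * W z) \<le> (k z * A \<psi> z) * (A (\<lambda>\<zeta>. enn_powr (\<phi> \<zeta>) q) z * W z)"
        by (simp add: mult_ac)
    qed
    also have "\<dots> = (\<integral>\<^sup>+\<zeta>. enn_powr (\<phi> \<zeta>) q * area (\<lambda>z. k z * A \<psi> z) \<zeta> \<partial>M)"
      by (intro avg_duality[symmetric]) measurable
    also have "\<dots> \<le> (\<integral>\<^sup>+\<zeta>. (enn_powr (\<phi> \<zeta>) q * area k \<zeta>) * \<Psi> \<zeta> \<partial>M)"
    proof (rule nn_integral_mono)
      fix \<zeta> assume \<zeta>: "\<zeta> \<in> space M"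
      have "area (\<lambda>z. k z * A \<psi> z) \<zeta> \<le> area (\<lambda>z. \<Psi> \<zeta> * k z) \<zeta>"
        using \<Psi>[OF \<zeta>] by (intro area_mono) (auto simp: mult.commute[of "k _"] intro!: mult_right_mono)
      also have "\<dots> = \<Psi> \<zeta> * area k \<zeta>" using \<zeta> by (intro area_cmult) auto
      finally show "enn_powr (\<phi> \<zeta>) q * area (\<lambda>z. k z * A \<psi> z) \<zeta> \<le> (enn_powr (\<phi> \<zeta>) q * area k \<zeta>) * \<Psi> \<zeta>"
        by (simp add: mult.assoc mult_left_mono mult.commute[of "\<Psi> _"])
    qed
    also have "\<dots> \<le> enn_powr (\<integral>\<^sup>+\<zeta>. enn_powr (enn_powr (\<phi> \<zeta>) q * area k \<zeta>) s \<partial>M) (1 / s)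
        * enn_powr (\<integral>\<^sup>+\<zeta>. enn_powr (\<Psi> \<zeta>) t \<partial>M) (1 / t)"
      by (intro nn_integral_Hoelder st) measurable
    also have "\<dots> \<le> enn_powr Y (1 / s) * enn_powr (ennreal C * X) (1 / t)"
    proof (intro mult_mono enn_powr_mono Y_ge)
      have "(\<integral>\<^sup>+\<zeta>. enn_powr (\<psi> \<zeta>) t \<partial>M) = X"
        unfolding X_def \<psi>_def by (simp add: enn_powr_powr st)
      then show "(\<integral>\<^sup>+\<zeta>. enn_powr (\<Psi> \<zeta>) t \<partial>M) \<le> ennreal C * X" using \<Psi>_le by simp
    qed (use st in auto)
    also have "\<dots> = (enn_powr Y (1 / s) * ennreal (C powr (1 / t))) * enn_powr X (1 / t)"
      using C by (simp add: enn_powr_mult mult.assoc)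
    finally have "X \<le> enn_powr (enn_powr Y (1 / s) * ennreal (C powr (1 / t))) s"
      by (rule enn_powr_absorb[OF st(1-3) X_fin])
    also have "\<dots> = ennreal (C powr (s - 1)) * Y"
      using st by (simp add: enn_powr_mult enn_powr_powr powr_powr ts mult.commute)
    finally show "(\<integral>\<^sup>+\<zeta>. enn_powr (area (\<lambda>z. k z * enn_powr (A \<phi> z) q) \<zeta>) (p / q) \<partial>M)
      \<le> ennreal (C powr (s - 1)) * (\<integral>\<^sup>+\<zeta>. enn_powr (area k \<zeta>) (p' / q') \<partial>M)"
      by (simp add: X_def Y_def U_def s_def)
  qed
qed

text \<open>
  Inside the approach region at \<open>\<zeta>\<close> the average is at most the maximal function \<open>\<Phi> \<zeta>\<close>, which
  comes out of the area integral. Since now \<open>\<beta> = p' / q' > 1\<close>, the function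
  \<open>\<phi> \<le> (area k)^{\<beta>-1}\<close> has a finite \<open>L^s\<close> norm for \<open>s = \<beta> / (\<beta> - 1)\<close>, and Hoelder's
  inequality with exponents \<open>u\<close> and \<open>v\<close> separates \<open>\<Phi>\<close> from the area integral.
\<close>

lemma test_bound_lt:
  assumes pq: "1 < p" "p < q" "1 / p + 1 / p' = 1" "1 / q + 1 / q' = 1"
  shows "\<exists>C>0. test_bounded p q p' q' C"
proof -
  have q1: "1 < q" using pq by simp
  note ex = conj_exponent_facts[OF pq(1,3) q1 pq(4)]
  define \<beta> where "\<beta> = p' / q'"
  have e: "p * (\<beta> - 1) + p / q = \<beta>" using ex(5) by (simp add: \<beta>_def)
  have \<beta>0: "0 < \<beta>" using ex by (simp add: \<beta>_def)
  have \<beta>1: "1 < \<beta>"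
  proof -
    have "1 / q < 1 / p" using pq by (simp add: field_simps)
    then have "1 / p' < 1 / q'" using pq by linarith
    then show ?thesis using ex(1,2) by (simp add: \<beta>_def field_simps)
  qed
  define s where "s = \<beta> / (\<beta> - 1)"
  define u where "u = s / p"
  define v where "v = \<beta> / (p / q)"
  have s: "1 < s" using \<beta>1 by (simp add: s_def)
  have pos: "0 < p * (\<beta> - 1)" "0 < p / q" using pq \<beta>1 by auto
  have u_eq: "u = \<beta> / (p * (\<beta> - 1))" by (simp add: u_def s_def)
  have u1: "1 < u" 
  proof -
    have "p * (\<beta> - 1) < \<beta>" using pos e by linarith
    then show ?thesis unfolding u_eq using pos(1) by (subst less_divide_eq) auto
  qed
  have v1: "1 < v" 
  proof -
    have "p / q < \<beta>" using pos e by linarith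
    then show ?thesis unfolding v_def using pos(2) by (subst less_divide_eq) auto
  qed
  have "1 / u + 1 / v = (p * (\<beta> - 1) + p / q) / \<beta>"
    by (simp add: u_eq v_def add_divide_distrib)
  then have uv: "1 / u + 1 / v = 1" using e \<beta>0 by simp
  obtain C where C: "C > 0" and max: "\<And>\<phi>. \<phi> \<in> borel_measurable M \<Longrightarrow> \<exists>\<Phi>\<in>borel_measurable M.
      (\<forall>\<zeta>\<in>space M. \<forall>z\<in>space N. z \<in> \<Gamma> \<zeta> \<longrightarrow> A \<phi> z \<le> \<Phi> \<zeta>) \<and>
      (\<integral>\<^sup>+\<zeta>. enn_powr (\<Phi> \<zeta>) s \<partial>M) \<le> ennreal C * (\<integral>\<^sup>+\<zeta>. enn_powr (\<phi> \<zeta>) s \<partial>M)"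
    using maximal[OF s] by blast
  show ?thesis
    unfolding test_bounded_def
  proof (intro exI[of _ "C powr (1 / u)"] conjI ballI allI impI)
    show "C powr (1 / u) > 0" using C by simp
  next
    fix k \<phi> and a b :: real
    assume [measurable]: "k \<in> borel_measurable N" "\<phi> \<in> borel_measurable M"
      and a: "\<forall>\<zeta>\<in>space M. area k \<zeta> \<le> ennreal a" and b: "\<forall>\<zeta>\<in>space M. \<phi> \<zeta> \<le> ennreal b"
      and le: "\<forall>\<zeta>\<in>space M. \<phi> \<zeta> \<le> ennreal (enn2real (area k \<zeta>) powr (p' / q' - 1))"
    define Y where "Y = (\<integral>\<^sup>+\<zeta>. enn_powr (area k \<zeta>) \<beta> \<partial>M)"
    obtain \<Phi> where [measurable]: "\<Phi> \<in> borel_measurable M"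
      and \<Phi>: "\<And>\<zeta> z. \<zeta> \<in> space M \<Longrightarrow> z \<in> space N \<Longrightarrow> z \<in> \<Gamma> \<zeta> \<Longrightarrow> A \<phi> z \<le> \<Phi> \<zeta>"
      and \<Phi>_le: "(\<integral>\<^sup>+\<zeta>. enn_powr (\<Phi> \<zeta>) s \<partial>M) \<le> ennreal C * (\<integral>\<^sup>+\<zeta>. enn_powr (\<phi> \<zeta>) s \<partial>M)"
      using max[of \<phi>] by auto
    have "(\<integral>\<^sup>+\<zeta>. enn_powr (\<phi> \<zeta>) s \<partial>M) \<le> Y"
      unfolding Y_def
    proof (rule nn_integral_mono)
      fix \<zeta> assume \<zeta>: "\<zeta> \<in> space M"
      obtain x where x: "area k \<zeta> = ennreal x" "0 \<le> x"
        using a \<zeta> by (cases "area k \<zeta>") (auto simp: top_unique)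
      have "enn_powr (\<phi> \<zeta>) s \<le> enn_powr (ennreal (x powr (\<beta> - 1))) s"
        using le \<zeta> x s by (intro enn_powr_mono) (auto simp: \<beta>_def)
      also have "\<dots> = ennreal (x powr \<beta>)"
        using \<beta>1 by (simp add: powr_powr s_def)
      finally show "enn_powr (\<phi> \<zeta>) s \<le> enn_powr (area k \<zeta>) \<beta>" using x by simp
    qed
    then have \<Phi>_Y: "(\<integral>\<^sup>+\<zeta>. enn_powr (\<Phi> \<zeta>) s \<partial>M) \<le> ennreal C * Y"
      using \<Phi>_le by (meson mult_left_mono order_trans zero_le)
    have "(\<integral>\<^sup>+\<zeta>. enn_powr (area (\<lambda>z. k z * enn_powr (A \<phi> z) q) \<zeta>) (p / q) \<partial>M)
      \<le> (\<integral>\<^sup>+\<zeta>. enn_powr (\<Phi> \<zeta>) p * enn_powr (area k \<zeta>) (p / q) \<partial>M)"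
    proof (rule nn_integral_mono)
      fix \<zeta> assume \<zeta>: "\<zeta> \<in> space M"
      have "area (\<lambda>z. k z * enn_powr (A \<phi> z) q) \<zeta> \<le> area (\<lambda>z. enn_powr (\<Phi> \<zeta>) q * k z) \<zeta>"
        using \<Phi>[OF \<zeta>] q1 by (intro area_mono) (auto simp: mult.commute[of "k _"] intro!: mult_right_mono enn_powr_mono)
      also have "\<dots> = enn_powr (\<Phi> \<zeta>) q * area k \<zeta>" using \<zeta> by (intro area_cmult) auto
      finally have "enn_powr (area (\<lambda>z. k z * enn_powr (A \<phi> z) q) \<zeta>) (p / q)
          \<le> enn_powr (enn_powr (\<Phi> \<zeta>) q * area k \<zeta>) (p / q)"
        using pos by (intro enn_powr_mono) auto
      also have "\<dots> = enn_powr (\<Phi> \<zeta>) p * enn_powr (area k \<zeta>) (p / q)"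
        using q1 by (simp add: enn_powr_mult enn_powr_powr)
      finally show "enn_powr (area (\<lambda>z. k z * enn_powr (A \<phi> z) q) \<zeta>) (p / q)
         \<le> enn_powr (\<Phi> \<zeta>) p * enn_powr (area k \<zeta>) (p / q)" .
    qed
    also have "\<dots> \<le> enn_powr (\<integral>\<^sup>+\<zeta>. enn_powr (enn_powr (\<Phi> \<zeta>) p) u \<partial>M) (1 / u)
      * enn_powr (\<integral>\<^sup>+\<zeta>. enn_powr (enn_powr (area k \<zeta>) (p / q)) v \<partial>M) (1 / v)"
      by (intro nn_integral_Hoelder u1 v1 uv) measurable
    also have "(\<integral>\<^sup>+\<zeta>. enn_powr (enn_powr (\<Phi> \<zeta>) p) u \<partial>M) = (\<integral>\<^sup>+\<zeta>. enn_powr (\<Phi> \<zeta>) s \<partial>M)"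
      using pq by (simp add: enn_powr_powr u_def)
    also have "(\<integral>\<^sup>+\<zeta>. enn_powr (enn_powr (area k \<zeta>) (p / q)) v \<partial>M) = Y"
      using pq q1 by (simp add: enn_powr_powr v_def Y_def)
    also have "enn_powr (\<integral>\<^sup>+\<zeta>. enn_powr (\<Phi> \<zeta>) s \<partial>M) (1 / u) * enn_powr Y (1 / v)
      \<le> enn_powr (ennreal C * Y) (1 / u) * enn_powr Y (1 / v)"
      using \<Phi>_Y u1 by (intro mult_right_mono enn_powr_mono) auto
    also have "\<dots> = ennreal (C powr (1 / u)) * (enn_powr Y (1 / u) * enn_powr Y (1 / v))"
      using C by (simp add: enn_powr_mult mult.assoc)
    also have "enn_powr Y (1 / u) * enn_powr Y (1 / v) = Y"
      using enn_powr_add[of "1 / u" "1 / v" Y] u1 v1 uv by simp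
    finally show "(\<integral>\<^sup>+\<zeta>. enn_powr (area (\<lambda>z. k z * enn_powr (A \<phi> z) q) \<zeta>) (p / q) \<partial>M)
      \<le> ennreal (C powr (1 / u)) * (\<integral>\<^sup>+\<zeta>. enn_powr (area k \<zeta>) (p' / q') \<partial>M)"
      by (simp add: Y_def \<beta>_def)
  qed
qed

text \<open>
  In the remaining case \<open>p = q\<close> the condition on \<open>\<phi>\<close> becomes \<open>\<phi> \<le> 1\<close>, and so \<open>A \<phi> \<le> 1\<close>.
\<close>

lemma test_bound:
  assumes pq: "1 < p" "1 < q" "1 / p + 1 / p' = 1" "1 / q + 1 / q' = 1"
  shows "\<exists>C>0. test_bounded p q p' q' C"
proof -
  consider "q < p" | "p < q" | "p = q" by linarith
  then show ?thesis
  proof cases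
    case 1 then show ?thesis using test_bound_gt[OF pq(2) _ pq(3,4)] by blast
  next
    case 2 then show ?thesis using test_bound_lt[OF pq(1) _ pq(3,4)] by blast
  next
    case 3
    then have "1 / p' = 1 / q'" using pq by (metis add_diff_cancel_left')
    then have p': "p' = q'" "q' \<noteq> 0" using conj_exponent_facts(1,2)[OF pq(1,3,2,4)] by auto
    show ?thesis
      unfolding test_bounded_def
    proof (intro exI[of _ 1] conjI ballI allI impI)
      fix k \<phi> and a b :: real
      assume [measurable]: "k \<in> borel_measurable N" "\<phi> \<in> borel_measurable M"
        and le: "\<forall>\<zeta>\<in>space M. \<phi> \<zeta> \<le> ennreal (enn2real (area k \<zeta>) powr (p' / q' - 1))"
      have "\<phi> \<zeta> \<le> 1" if "\<zeta> \<in> space M" for \<zeta>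
        using le[rule_format, OF that] p'
        by (cases "enn2real (area k \<zeta>) = 0") (auto intro: order_trans)
      then have "A \<phi> z \<le> 1" if "z \<in> space N" for z using that by (intro avg_le_const) auto
      then have "enn_powr (A \<phi> z) q \<le> 1" if "z \<in> space N" for z
        using that pq enn_powr_mono[of "A \<phi> z" 1 q] by simp
      then have "area (\<lambda>z. k z * enn_powr (A \<phi> z) q) \<zeta> \<le> area k \<zeta>" for \<zeta>
        by (intro area_mono) (metis mult.right_neutral mult_left_mono zero_le)
      then show "(\<integral>\<^sup>+\<zeta>. enn_powr (area (\<lambda>z. k z * enn_powr (A \<phi> z) q) \<zeta>) (p / q) \<partial>M)
      \<le> ennreal 1 * (\<integral>\<^sup>+\<zeta>. enn_powr (area k \<zeta>) (p' / q') \<partial>M)"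
        using p' 3 pq by (auto intro!: nn_integral_mono)
    qed simp
  qed
qed

end

section \<open>Tent spaces, their pairing, and the converse of Hoelder's inequality\<close>

text \<open>
  A supplement to monotonicity: near \<open>0\<close> the inequality \<open>x^a < e\<close> means \<open>x < e^{1/a}\<close>.
\<close>

lemma enn_powr_tendsto_0:
  fixes x :: "nat \<Rightarrow> ennreal"
  assumes "0 < a" "x \<longlonglongrightarrow> 0"
  shows "(\<lambda>n. enn_powr (x n) a) \<longlonglongrightarrow> 0"
proof (rule order_tendstoI)
  fix e :: ennreal assume e: "0 < e"
  have "0 < enn_powr e (1 / a)" using e by (simp add: zero_less_iff_neq_zero)
  then have "eventually (\<lambda>n. x n < enn_powr e (1 / a)) sequentially"
    by (rule order_tendstoD(2)[OF assms(2)])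
  then show "eventually (\<lambda>n. enn_powr (x n) a < e) sequentially"
  proof eventually_elim
    case (elim n)
    show ?case
    proof (rule ccontr)
      assume "\<not> enn_powr (x n) a < e"
      then have "enn_powr e (1 / a) \<le> enn_powr (enn_powr (x n) a) (1 / a)"
        using assms(1) by (intro enn_powr_mono) auto
      then show False using elim assms(1) by (simp add: enn_powr_powr)
    qed
  qed
qed simp

lemma cnj_measurable [measurable (raw)]:
  "f \<in> borel_measurable M \<Longrightarrow> (\<lambda>x. cnj (f x)) \<in> borel_measurable M"
  by (rule measurable_compose[OF _ borel_measurable_continuous_onI]) (auto intro: continuous_intros)

context tent_space
begin

definition tent_integral :: "real \<Rightarrow> real \<Rightarrow> ('b \<Rightarrow> complex) \<Rightarrow> ennreal" where
  "tent_integral p q f = (\<integral>\<^sup>+\<zeta>. enn_powr (area (\<lambda>z. ennreal (cmod (f z) powr q)) \<zeta>) (p / q) \<partial>M)"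

definition tent_fun :: "real \<Rightarrow> real \<Rightarrow> ('b \<Rightarrow> complex) set" where
  "tent_fun p q = {f \<in> borel_measurable N. tent_integral p q f < top}"

definition tent_norm :: "real \<Rightarrow> real \<Rightarrow> ('b \<Rightarrow> complex) \<Rightarrow> real" where
  "tent_norm p q f = enn2real (tent_integral p q f) powr (1 / p)"

lemma enn_powr_tent_integral:
  "f \<in> tent_fun p q \<Longrightarrow> enn_powr (tent_integral p q f) (1 / p) = ennreal (tent_norm p q f)"
  by (cases "tent_integral p q f") (auto simp: tent_fun_def tent_norm_def)

lemma tent_norm_nonneg [simp]: "0 \<le> tent_norm p q f"
  by (simp add: tent_norm_def)

lemma tent_integral_mono:
  assumes "0 < p" "0 < q" "\<And>z. z \<in> space N \<Longrightarrow> cmod (f z) \<le> cmod (g z)"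
  shows "tent_integral p q f \<le> tent_integral p q g"
  unfolding tent_integral_def using assms
  by (intro nn_integral_mono enn_powr_mono area_mono) (auto intro!: ennreal_leI powr_mono2)

lemma dominated_in_tent_fun:
  assumes "0 < p" "0 < q" "F \<in> tent_fun p q" "f \<in> borel_measurable N" "\<And>z. z \<in> space N \<Longrightarrow> cmod (f z) \<le> cmod (F z)"
  shows "f \<in> tent_fun p q"
  using assms tent_integral_mono[OF assms(1,2), of f F] by (auto simp: tent_fun_def intro: le_less_trans)

lemma tent_norm_mono:
  assumes "0 < p" "0 < q" "F \<in> tent_fun p q" "\<And>z. z \<in> space N \<Longrightarrow> cmod (f z) \<le> cmod (F z)"
  shows "tent_norm p q f \<le> tent_norm p q F"
proof -
  have "tent_integral p q f \<le> tent_integral p q F" using assms by (intro tent_integral_mono)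
  then have "enn2real (tent_integral p q f) \<le> enn2real (tent_integral p q F)"
    using assms(3) by (intro enn2real_mono) (auto simp: tent_fun_def)
  then show ?thesis using assms(1) by (auto simp: tent_norm_def intro!: powr_mono2)
qed

lemma tent_integral_scale:
  assumes "0 < q" and [measurable]: "f \<in> borel_measurable N"
  shows "tent_integral p q (\<lambda>z. c * f z) = ennreal (cmod c powr p) * tent_integral p q f"
proof -
  have "area (\<lambda>z. ennreal (cmod (c * f z) powr q)) \<zeta> = ennreal (cmod c powr q) * area (\<lambda>z. ennreal (cmod (f z) powr q)) \<zeta>"
    if "\<zeta> \<in> space M" for \<zeta>
  proof -
    have "(\<lambda>z. ennreal (cmod (c * f z) powr q)) = (\<lambda>z. ennreal (cmod c powr q) * ennreal (cmod (f z) powr q))"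
      by (simp add: norm_mult powr_mult ennreal_mult)
    then show ?thesis using that by (simp add: area_cmult)
  qed
  then have "tent_integral p q (\<lambda>z. c * f z)
      = (\<integral>\<^sup>+\<zeta>. ennreal (cmod c powr p) * enn_powr (area (\<lambda>z. ennreal (cmod (f z) powr q)) \<zeta>) (p / q) \<partial>M)"
    unfolding tent_integral_def using assms(1) by (intro nn_integral_cong) (simp add: enn_powr_mult powr_powr)
  also have "\<dots> = ennreal (cmod c powr p) * tent_integral p q f"
    unfolding tent_integral_def by (rule nn_integral_cmult) measurable
  finally show ?thesis .
qed

lemma tent_integral_le:
  assumes "0 < p" "0 < q" and [measurable]: "f \<in> borel_measurable N"
  shows "tent_integral p q f \<le> emeasure M (space M) * enn_powr (\<integral>\<^sup>+z. ennreal (cmod (f z) powr q) \<partial>N) (p / q)"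
proof -
  have "tent_integral p q f \<le> (\<integral>\<^sup>+\<zeta>. enn_powr (\<integral>\<^sup>+z. ennreal (cmod (f z) powr q) \<partial>N) (p / q) \<partial>M)"
    unfolding tent_integral_def area_def using assms
    by (intro nn_integral_mono enn_powr_mono) (auto split: split_indicator)
  then show ?thesis by (simp add: mult.commute)
qed

text \<open>
  By adjointness, the integral of all area integrals is the integral of \<open>|f|^q\<close> against the mass
  of shadows, which is positive everywhere.
\<close>

lemma tent_integral_eq_0:
  assumes [measurable]: "f \<in> borel_measurable N" and "tent_integral p q f = 0"
  shows "AE z in N. f z = 0"
proof -
  define k where "k z = ennreal (cmod (f z) powr q)" for z
  have [measurable]: "k \<in> borel_measurable N" unfolding k_def by measurable
  have "AE \<zeta> in M. area k \<zeta> = 0"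
    using assms(2) unfolding tent_integral_def k_def[symmetric] by (subst (asm) nn_integral_0_iff_AE) auto
  then have "(\<integral>\<^sup>+\<zeta>. 1 * area k \<zeta> \<partial>M) = 0"
    by (subst nn_integral_0_iff_AE) auto
  then have "(\<integral>\<^sup>+z. k z * (A (\<lambda>_. 1) z * W z) \<partial>N) = 0"
    by (subst (asm) avg_duality) auto
  then have "AE z in N. k z * (A (\<lambda>_. 1) z * W z) = 0"
    by (subst (asm) nn_integral_0_iff_AE) auto
  with AE_space show ?thesis
  proof eventually_elim
    case (elim z)
    have "A (\<lambda>_. 1) z * W z = W z"
      using elim by (subst avg_times_mass) (auto simp: tent_mass_def)
    then have "k z = 0" using elim mass_pos[of z] by auto
    then show "f z = 0" by (auto simp: k_def ennreal_eq_0_iff)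
  qed
qed

end

text \<open>
  The pairing is taken with respect to the measure with density \<open>W \<theta>\<close>, where \<open>W\<close> is the mass of
  shadows; \<open>\<theta>\<close> accounts for the difference between \<open>E(z)\<close> and \<open>(1 - |z|\<^sup>2)^{-n}\<close>.
\<close>

locale weighted_tent_space = tent_space +
  fixes \<theta> :: "'b \<Rightarrow> real" and c1 c2 :: real
  assumes \<theta>_measurable [measurable]: "\<theta> \<in> borel_measurable N"
    and c1_pos: "0 < c1" and \<theta>_bounds: "\<And>z. z \<in> space N \<Longrightarrow> c1 \<le> \<theta> z" "\<And>z. z \<in> space N \<Longrightarrow> \<theta> z \<le> c2"
begin

definition \<kappa> :: "'b \<Rightarrow> real" where "\<kappa> z = enn2real (W z) * \<theta> z"

lemma \<kappa>_measurable [measurable]: "\<kappa> \<in> borel_measurable N"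
  unfolding \<kappa>_def by measurable

lemma ennreal_enn2real_mass [simp]: "ennreal (enn2real (W z)) = W z"
  using mass_finite[of z] by simp

lemma \<kappa>_pos: "z \<in> space N \<Longrightarrow> 0 < \<kappa> z"
  using mass_pos[of z] mass_finite[of z] \<theta>_bounds(1)[of z] c1_pos
  by (auto simp: \<kappa>_def enn2real_positive_iff intro!: mult_pos_pos)

lemma ennreal_\<kappa>: "z \<in> space N \<Longrightarrow> ennreal (\<kappa> z) = W z * ennreal (\<theta> z)"
  using \<theta>_bounds(1)[of z] c1_pos by (simp add: \<kappa>_def ennreal_mult)

text \<open>
  By adjointness the factor \<open>W\<close> of \<open>\<kappa>\<close> turns the integral over the ball into an integral over the
  boundary of area integrals; then apply Hoelder's inequality in each variable.
\<close>

lemma pairing_Hoelder: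
  assumes pq: "1 < p" "1 < q" "1 / p + 1 / p' = 1" "1 / q + 1 / q' = 1"
    and [measurable]: "f \<in> borel_measurable N" "g \<in> borel_measurable N"
  shows "(\<integral>\<^sup>+z. ennreal (cmod (f z * g z) * \<kappa> z) \<partial>N)
    \<le> ennreal c2 * (enn_powr (tent_integral p q f) (1 / p) * enn_powr (tent_integral p' q' g) (1 / p'))"
proof -
  note ex = conj_exponent_facts[OF pq(1,3,2,4)]
  define k where "k z = ennreal (cmod (f z * g z))" for z
  have [measurable]: "k \<in> borel_measurable N" unfolding k_def by measurable
  have "(\<integral>\<^sup>+z. ennreal (cmod (f z * g z) * \<kappa> z) \<partial>N) \<le> (\<integral>\<^sup>+z. ennreal c2 * (k z * (A (\<lambda>_. 1) z * W z)) \<partial>N)"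
  proof (rule nn_integral_mono)
    fix z assume z: "z \<in> space N"
    have "A (\<lambda>_. 1) z * W z = W z"
      using z by (subst avg_times_mass) (auto simp: tent_mass_def)
    moreover have "ennreal (cmod (f z * g z) * \<kappa> z) = k z * (W z * ennreal (\<theta> z))"
      using z \<kappa>_pos[OF z] by (simp add: ennreal_mult'' k_def ennreal_\<kappa>)
    moreover have "\<dots> \<le> k z * (W z * ennreal c2)"
      using \<theta>_bounds(2)[OF z] by (intro mult_left_mono ennreal_leI) auto
    ultimately show "ennreal (cmod (f z * g z) * \<kappa> z) \<le> ennreal c2 * (k z * (A (\<lambda>_. 1) z * W z))"
      by (simp add: mult_ac)
  qed
  also have "\<dots> = ennreal c2 * (\<integral>\<^sup>+\<zeta>. 1 * area k \<zeta> \<partial>M)"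
    by (subst avg_duality) (auto simp: nn_integral_cmult)
  also have "(\<integral>\<^sup>+\<zeta>. 1 * area k \<zeta> \<partial>M) \<le> (\<integral>\<^sup>+\<zeta>. enn_powr (area (\<lambda>z. ennreal (cmod (f z) powr q)) \<zeta>) (1 / q)
      * enn_powr (area (\<lambda>z. ennreal (cmod (g z) powr q')) \<zeta>) (1 / q') \<partial>M)"
  proof (rule nn_integral_mono)
    fix \<zeta> assume \<zeta> [measurable]: "\<zeta> \<in> space M"
    have "area k \<zeta> = (\<integral>\<^sup>+z. (ennreal (cmod (f z)) * indicator (\<Gamma> \<zeta>) z) * (ennreal (cmod (g z)) * indicator (\<Gamma> \<zeta>) z) \<partial>N)"
      unfolding area_def k_def by (intro nn_integral_cong) (auto simp: norm_mult ennreal_mult split: split_indicator)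
    also have "\<dots> \<le> enn_powr (\<integral>\<^sup>+z. enn_powr (ennreal (cmod (f z)) * indicator (\<Gamma> \<zeta>) z) q \<partial>N) (1 / q)
      * enn_powr (\<integral>\<^sup>+z. enn_powr (ennreal (cmod (g z)) * indicator (\<Gamma> \<zeta>) z) q' \<partial>N) (1 / q')"
      by (intro nn_integral_Hoelder pq ex) measurable
    also have "(\<integral>\<^sup>+z. enn_powr (ennreal (cmod (f z)) * indicator (\<Gamma> \<zeta>) z) q \<partial>N) = area (\<lambda>z. ennreal (cmod (f z) powr q)) \<zeta>"
      unfolding area_def by (intro nn_integral_cong) (auto split: split_indicator)
    also have "(\<integral>\<^sup>+z. enn_powr (ennreal (cmod (g z)) * indicator (\<Gamma> \<zeta>) z) q' \<partial>N) = area (\<lambda>z. ennreal (cmod (g z) powr q')) \<zeta>"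
      unfolding area_def by (intro nn_integral_cong) (auto split: split_indicator)
    finally show "1 * area k \<zeta> \<le> enn_powr (area (\<lambda>z. ennreal (cmod (f z) powr q)) \<zeta>) (1 / q)
      * enn_powr (area (\<lambda>z. ennreal (cmod (g z) powr q')) \<zeta>) (1 / q')" by simp
  qed
  also have "\<dots> \<le> enn_powr (tent_integral p q f) (1 / p) * enn_powr (tent_integral p' q' g) (1 / p')"
  proof -
    have "(\<integral>\<^sup>+\<zeta>. enn_powr (area (\<lambda>z. ennreal (cmod (f z) powr q)) \<zeta>) (1 / q)
      * enn_powr (area (\<lambda>z. ennreal (cmod (g z) powr q')) \<zeta>) (1 / q') \<partial>M)
      \<le> enn_powr (\<integral>\<^sup>+\<zeta>. enn_powr (enn_powr (area (\<lambda>z. ennreal (cmod (f z) powr q)) \<zeta>) (1 / q)) p \<partial>M) (1 / p)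
      * enn_powr (\<integral>\<^sup>+\<zeta>. enn_powr (enn_powr (area (\<lambda>z. ennreal (cmod (g z) powr q')) \<zeta>) (1 / q')) p' \<partial>M) (1 / p')"
      by (intro nn_integral_Hoelder pq ex) measurable
    then show ?thesis by (simp add: tent_integral_def enn_powr_powr)
  qed
  finally show ?thesis by (simp add: mult_left_mono)
qed

text \<open>
  Integrating \<open>|f|^q\<close> over an approach region gives at most its integral over the whole space,
  and \<open>M\<close> is finite.
\<close>

lemma tent_funI:
  assumes pq: "0 < p" "0 < q" and f [measurable]: "f \<in> borel_measurable N"
    and le: "\<And>z. z \<in> space N \<Longrightarrow> cmod (f z) powr q \<le> c * h z"
    and [measurable]: "h \<in> borel_measurable N" and h_pos: "\<And>z. z \<in> space N \<Longrightarrow> 0 < h z"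
    and h_int: "(\<integral>\<^sup>+z. ennreal (h z) \<partial>N) < top"
  shows "f \<in> tent_fun p q"
proof -
  have "(\<integral>\<^sup>+z. ennreal (cmod (f z) powr q) \<partial>N) \<le> (\<integral>\<^sup>+z. ennreal \<bar>c\<bar> * ennreal (h z) \<partial>N)"
  proof (rule nn_integral_mono)
    fix z assume z: "z \<in> space N"
    have "c * h z \<le> \<bar>c\<bar> * h z" using h_pos[OF z] by (intro mult_right_mono) auto
    with le[OF z] have "cmod (f z) powr q \<le> \<bar>c\<bar> * h z" by (rule order_trans)
    then show "ennreal (cmod (f z) powr q) \<le> ennreal \<bar>c\<bar> * ennreal (h z)"
      using h_pos[OF z] by (simp add: ennreal_mult[symmetric] ennreal_leI)
  qed
  also have "\<dots> = ennreal \<bar>c\<bar> * (\<integral>\<^sup>+z. ennreal (h z) \<partial>N)"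
    by (rule nn_integral_cmult) measurable
  also have "\<dots> < top" using h_int by (simp add: ennreal_mult_less_top)
  finally have "emeasure M (space M) * enn_powr (\<integral>\<^sup>+z. ennreal (cmod (f z) powr q) \<partial>N) (p / q) < top"
    using M.emeasure_finite[of "space M"] by (simp add: ennreal_mult_eq_top_iff less_top[symmetric])
  then show ?thesis
    using tent_integral_le[OF pq f] f by (auto simp: tent_fun_def intro: le_less_trans)
qed

definition pairing :: "('b \<Rightarrow> complex) \<Rightarrow> ('b \<Rightarrow> complex) \<Rightarrow> complex" where
  "pairing f g = (\<integral>z. f z * cnj (g z) * complex_of_real (\<kappa> z) \<partial>N)"

definition pairable :: "('b \<Rightarrow> complex) \<Rightarrow> ('b \<Rightarrow> complex) \<Rightarrow> bool" where
  "pairable f g \<longleftrightarrow> integrable N (\<lambda>z. f z * cnj (g z) * complex_of_real (\<kappa> z))"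

lemma pairing_bounded:
  assumes pq: "1 < p" "1 < q" "1 / p + 1 / p' = 1" "1 / q + 1 / q' = 1"
    and f: "f \<in> tent_fun p q" and g: "g \<in> tent_fun p' q'"
  shows "(\<integral>\<^sup>+z. ennreal (cmod (f z * g z) * \<kappa> z) \<partial>N) < top"
    and "pairable f g" and "cmod (pairing f g) \<le> \<bar>c2\<bar> * tent_norm p' q' g * tent_norm p q f"
proof -
  have [measurable]: "f \<in> borel_measurable N" "g \<in> borel_measurable N"
    using f g by (auto simp: tent_fun_def)
  have eq: "(\<integral>\<^sup>+z. ennreal (cmod (f z * cnj (g z) * complex_of_real (\<kappa> z))) \<partial>N) = (\<integral>\<^sup>+z. ennreal (cmod (f z * g z) * \<kappa> z) \<partial>N)"
    using \<kappa>_pos by (intro nn_integral_cong) (auto simp: norm_mult abs_of_pos)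
  have "(\<integral>\<^sup>+z. ennreal (cmod (f z * g z) * \<kappa> z) \<partial>N) \<le> ennreal c2 * (ennreal (tent_norm p q f) * ennreal (tent_norm p' q' g))"
    using pairing_Hoelder[OF pq, of f g] f g by (simp add: enn_powr_tent_integral)
  also have "\<dots> \<le> ennreal \<bar>c2\<bar> * (ennreal (tent_norm p q f) * ennreal (tent_norm p' q' g))"
    by (intro mult_right_mono ennreal_leI) auto
  also have "\<dots> = ennreal (\<bar>c2\<bar> * tent_norm p' q' g * tent_norm p q f)"
    by (simp add: ennreal_mult mult_ac)
  finally have H: "(\<integral>\<^sup>+z. ennreal (cmod (f z * g z) * \<kappa> z) \<partial>N) \<le> ennreal (\<bar>c2\<bar> * tent_norm p' q' g * tent_norm p q f)" .
  then show "(\<integral>\<^sup>+z. ennreal (cmod (f z * g z) * \<kappa> z) \<partial>N) < top" by (rule le_less_trans) simp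
  then show int: "pairable f g"
    unfolding pairable_def eq[symmetric] by (intro integrableI_bounded) simp_all
  have "ennreal (cmod (pairing f g)) \<le> (\<integral>\<^sup>+z. ennreal (cmod (f z * g z) * \<kappa> z) \<partial>N)"
    unfolding pairing_def eq[symmetric] using int unfolding pairable_def by (rule integral_norm_bound_ennreal)
  with H have "ennreal (cmod (pairing f g)) \<le> ennreal (\<bar>c2\<bar> * tent_norm p' q' g * tent_norm p q f)"
    by (rule order_trans[rotated])
  then show "cmod (pairing f g) \<le> \<bar>c2\<bar> * tent_norm p' q' g * tent_norm p q f"
    by (simp add: ennreal_le_iff)
qed

text \<open>
  For the test functions below the integrand of the pairing is nonnegative, so that no
  cancellation is lost by passing to absolute values.
\<close>

lemma nn_integral_pairing_nonneg:
  assumes "pairable f g" and u: "\<And>z. \<exists>u\<ge>0. f z * cnj (g z) = complex_of_real u"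
  shows "(\<integral>\<^sup>+z. ennreal (cmod (f z * g z) * \<kappa> z) \<partial>N) = ennreal (cmod (pairing f g))"
proof -
  have eq: "f z * cnj (g z) * complex_of_real (\<kappa> z) = complex_of_real (cmod (f z * g z) * \<kappa> z)" for z
  proof -
    obtain v where v: "0 \<le> v" "f z * cnj (g z) = complex_of_real v" using u by blast
    have "cmod (f z * g z) = cmod (f z * cnj (g z))" by (simp add: norm_mult)
    then show ?thesis using v by simp
  qed
  have i: "integrable N (\<lambda>z. cmod (f z * g z) * \<kappa> z)"
    using integrable_Re assms(1) unfolding pairable_def eq by fastforce
  have nn: "AE z in N. 0 \<le> cmod (f z * g z) * \<kappa> z"
    using \<kappa>_pos by (intro AE_I2 mult_nonneg_nonneg) (auto intro: less_imp_le)
  have "pairing f g = complex_of_real (\<integral>z. cmod (f z * g z) * \<kappa> z \<partial>N)"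
    unfolding pairing_def eq by (rule integral_complex_of_real)
  then have "cmod (pairing f g) = (\<integral>z. cmod (f z * g z) * \<kappa> z \<partial>N)"
    using integral_nonneg_AE[OF nn] by (simp only: norm_of_real)
  then show ?thesis using nn_integral_eq_integral[OF i nn] by simp
qed

text \<open>
  Only test functions bounded by a multiple of \<open>h^{1/q}\<close> occur. For the density \<open>g\<close> of an abstract
  functional, these are the functions on which the pairing is known to represent the
  functional before \<open>g\<close> has been shown to have finite norm.
\<close>

definition functional_bound :: "real \<Rightarrow> real \<Rightarrow> ('b \<Rightarrow> real) \<Rightarrow> ('b \<Rightarrow> complex) \<Rightarrow> real \<Rightarrow> bool" where
  "functional_bound p q h g L \<longleftrightarrow>
     (\<forall>f\<in>tent_fun p q. (\<exists>c. \<forall>z\<in>space N. cmod (f z) powr q \<le> c * h z) \<longrightarrow>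
        pairable f g \<and> cmod (pairing f g) \<le> L * tent_norm p q f)"

text \<open>
  The converse of Hoelder's inequality. Let \<open>k = |g|^{q'}\<close>. The function
  \<open>f = |g|^{q'-2} g A \<phi>\<close> with \<open>\<phi> = (area k)^{p'/q'-1}\<close> pairs with \<open>g\<close> to
  \<open>\<integral> \<phi> area k = \<integral> (area k)^{p'/q'}\<close>, up to the bounds for \<open>\<theta>\<close>, and by \<open>test_bound\<close> its norm
  is at most a multiple of the \<open>p\<close>-th root of this integral \<open>X\<close>. The assumption then reads
  \<open>X \<le> B X^{1/p}\<close>, that is, \<open>X \<le> B^{p'}\<close>. To be sure that \<open>X\<close> is finite and \<open>f\<close> admissible, \<open>g\<close> is
  first restricted to the set where \<open>|g|^{q'} \<le> j h\<close> and \<open>\<phi>\<close> is cut off at height \<open>l\<close>; both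
  truncations are removed by monotone convergence.
\<close>

lemma norm_le_functional:
  assumes pq: "1 < p" "1 < q" "1 / p + 1 / p' = 1" "1 / q + 1 / q' = 1"
    and h [measurable]: "h \<in> borel_measurable N" and h_pos': "\<forall>z\<in>space N. 0 < h z"
    and h_int: "(\<integral>\<^sup>+z. ennreal (h z) \<partial>N) < top"
  shows "\<exists>C>0. \<forall>g\<in>borel_measurable N. \<forall>L\<ge>0. functional_bound p q h g L \<longrightarrow>
    enn_powr (tent_integral p' q' g) (1 / p') \<le> ennreal (C * L)"
proof -
  note h_pos = h_pos'[THEN bspec]
  note ex = conj_exponent_facts[OF pq(1,3,2,4)]
  define \<beta> where "\<beta> = p' / q'"
  have \<beta>: "0 < \<beta>" using ex by (simp add: \<beta>_def)
  obtain C where C: "0 < C" and "test_bounded p q p' q' C" using test_bound[OF pq] by blast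
  note test0 = this(2)[unfolded test_bounded_def, folded \<beta>_def]
  note test = test0[THEN bspec, THEN bspec, THEN spec, THEN spec, THEN mp, THEN mp, THEN mp]
  show ?thesis
  proof (intro exI[of _ "C powr (1 / p) / c1"] conjI ballI allI impI)
    show "0 < C powr (1 / p) / c1" using C c1_pos by simp
  next
    fix g and L :: real
    assume g [measurable]: "g \<in> borel_measurable N" and L: "0 \<le> L"
      and H: "functional_bound p q h g L"
    \<comment> \<open>On \<open>G j\<close> the area integrals of \<open>|g|^{q'}\<close> are bounded because \<open>h\<close> is integrable.\<close>
    define G where "G j = {z \<in> space N. cmod (g z) powr q' \<le> real j * h z}" for j
    define k where "k j z = ennreal (cmod (g z) powr q' * indicator (G j) z)" for j z
    have [measurable]: "G j \<in> sets N" "k j \<in> borel_measurable N" for j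
      unfolding G_def k_def by measurable
    obtain hi where hi: "(\<integral>\<^sup>+z. ennreal (h z) \<partial>N) = ennreal hi" "0 \<le> hi"
      using h_int by (cases "\<integral>\<^sup>+z. ennreal (h z) \<partial>N") auto
    have area_k: "area (k j) \<zeta> \<le> ennreal (real j * hi)" for j \<zeta>
    proof -
      have "area (k j) \<zeta> \<le> (\<integral>\<^sup>+z. ennreal (real j) * ennreal (h z) \<partial>N)"
        unfolding area_def k_def G_def
        by (intro nn_integral_mono) (auto simp: ennreal_mult'[symmetric] ennreal_leI split: split_indicator)
      also have "\<dots> = ennreal (real j * hi)"
        using hi by (simp add: nn_integral_cmult ennreal_mult)
      finally show ?thesis .
    qed
    define X where "X j = (\<integral>\<^sup>+\<zeta>. enn_powr (area (k j) \<zeta>) \<beta> \<partial>M)" for j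
    have X_fin: "X j < top" for j
    proof -
      have "X j \<le> (\<integral>\<^sup>+\<zeta>. enn_powr (ennreal (real j * hi)) \<beta> \<partial>M)"
        unfolding X_def using \<beta> area_k by (intro nn_integral_mono enn_powr_mono) auto
      also have "\<dots> < top"
        using M.emeasure_finite[of "space M"] by (simp add: less_top[symmetric] ennreal_mult_eq_top_iff)
      finally show ?thesis .
    qed
    define B where "B = ennreal (C powr (1 / p) / c1 * L)"
    have X_le: "X j \<le> enn_powr B p'" for j
    proof (rule enn_powr_absorb[OF ex(1) pq(1) _ X_fin])
      show "1 / p' + 1 / p = 1" using pq by simp
      define x where "x \<zeta> = enn2real (area (k j) \<zeta>)" for \<zeta>
      have x: "area (k j) \<zeta> = ennreal (x \<zeta>)" "0 \<le> x \<zeta>" for \<zeta>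
        using area_k[of j \<zeta>] by (auto simp: x_def top_unique less_top[symmetric] ennreal_enn2real_if)
      have [measurable]: "x \<in> borel_measurable M" unfolding x_def by measurable
      \<comment> \<open>Where \<open>x \<zeta> = 0\<close> the convention \<open>0 powr a = 0\<close> makes \<open>\<phi> l \<zeta>\<close> vanish also for negative exponents.\<close>
      define \<phi> where "\<phi> l \<zeta> = ennreal (min (x \<zeta> powr (\<beta> - 1)) (real l))" for l \<zeta>
      have [measurable]: "\<phi> l \<in> borel_measurable M" for l unfolding \<phi>_def by measurable
      have bound: "ennreal c1 * (\<integral>\<^sup>+\<zeta>. \<phi> l \<zeta> * area (k j) \<zeta> \<partial>M) \<le> ennreal L * enn_powr (ennreal C * X j) (1 / p)" for l
      proof -
        define a where "a z = enn2real (A (\<phi> l) z)" for z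
        have A_le: "A (\<phi> l) z \<le> ennreal (real l)" if "z \<in> space N" for z
          using that by (intro avg_le_const) (auto simp: \<phi>_def intro!: ennreal_leI)
        have a: "A (\<phi> l) z = ennreal (a z)" "0 \<le> a z" "a z \<le> real l" if "z \<in> space N" for z
          using A_le[OF that] by (auto simp: a_def top_unique less_top[symmetric] ennreal_enn2real_if intro!: enn2real_leI)
        have a0: "0 \<le> a z" for z by (simp add: a_def)
        have [measurable]: "a \<in> borel_measurable N" unfolding a_def by measurable
        \<comment> \<open>The averaged extremal function of the truncated \<open>g\<close>.\<close>
        define f where "f z = g z * complex_of_real (cmod (g z) powr (q' - 2) * indicator (G j) z * a z)" for z
        have [measurable]: "f \<in> borel_measurable N" unfolding f_def by measurable
        have cf: "cmod (f z) = cmod (g z) powr (q' - 1) * indicator (G j) z * a z" for z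
        proof (cases "g z = 0")
          case False
          then have "cmod (g z) * cmod (g z) powr (q' - 2) = cmod (g z) powr (q' - 1)"
            using powr_add[of "cmod (g z)" 1 "q' - 2"] by simp
          then show ?thesis using a0 by (simp add: f_def norm_mult mult.assoc[symmetric])
        qed (simp add: f_def)
        have cfq: "cmod (f z) powr q = cmod (g z) powr q' * indicator (G j) z * a z powr q" for z
        proof -
          have "(q' - 1) * q = q'" using ex(4) conj_exponent_facts(4)[OF pq(2,4,1,3)] by (simp add: mult.commute)
          then show ?thesis using a0[of z] by (auto simp: cf powr_mult powr_powr split: split_indicator)
        qed
        have fg: "f z * cnj (g z) = complex_of_real (cmod (g z) powr q' * indicator (G j) z * a z)" for z
        proof (cases "g z = 0")
          case False
          then have "(cmod (g z))\<^sup>2 * cmod (g z) powr (q' - 2) = cmod (g z) powr q'"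
            using powr_add[of "cmod (g z)" 2 "q' - 2"] by (simp add: powr_numeral)
          moreover have "g z * cnj (g z) = complex_of_real ((cmod (g z))\<^sup>2)"
            by (simp add: complex_norm_square[symmetric])
          moreover have "f z * cnj (g z) = (g z * cnj (g z)) * complex_of_real (cmod (g z) powr (q' - 2) * indicator (G j) z * a z)"
            by (simp add: f_def)
          ultimately show ?thesis by (simp only: of_real_mult[symmetric] mult.assoc[symmetric])
        qed (simp add: f_def)
        have f_le: "cmod (f z) powr q \<le> real j * real l powr q * h z" if z: "z \<in> space N" for z
        proof -
          have "a z powr q \<le> real l powr q" using a[OF z] pq by (intro powr_mono2) auto
          moreover have "cmod (g z) powr q' * indicator (G j) z \<le> real j * h z"
            using h_pos[OF z] by (auto simp: G_def split: split_indicator)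
          moreover have "0 \<le> cmod (g z) powr q' * indicator (G j) z" by simp
          ultimately have "(cmod (g z) powr q' * indicator (G j) z) * a z powr q \<le> (real j * h z) * real l powr q"
            using h_pos[OF z] by - (rule mult_mono, auto)
          then show ?thesis by (simp add: cfq mult_ac)
        qed
        have int_f: "tent_integral p q f \<le> ennreal C * X j"
        proof -
          have "area (\<lambda>z. ennreal (cmod (f z) powr q)) \<zeta> \<le> area (\<lambda>z. k j z * enn_powr (A (\<phi> l) z) q) \<zeta>" for \<zeta>
            using a a0 by (intro area_mono) (simp add: cfq k_def ennreal_mult[symmetric])
          then have "tent_integral p q f \<le> (\<integral>\<^sup>+\<zeta>. enn_powr (area (\<lambda>z. k j z * enn_powr (A (\<phi> l) z) q) \<zeta>) (p / q) \<partial>M)"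
            unfolding tent_integral_def using pq by (intro nn_integral_mono enn_powr_mono) auto
          also have "\<dots> \<le> ennreal C * X j"
            unfolding X_def
            by (rule test[of "k j" "\<phi> l" "real j * hi" "real l"])
               (use area_k in \<open>auto simp: \<phi>_def x_def[symmetric] intro!: ennreal_leI\<close>)
          finally show ?thesis .
        qed
        have "ennreal c1 * (\<integral>\<^sup>+\<zeta>. \<phi> l \<zeta> * area (k j) \<zeta> \<partial>M) = (\<integral>\<^sup>+z. ennreal c1 * (k j z * (A (\<phi> l) z * W z)) \<partial>N)"
          by (subst avg_duality) (auto simp: nn_integral_cmult)
        also have "\<dots> \<le> (\<integral>\<^sup>+z. ennreal (cmod (f z * g z) * \<kappa> z) \<partial>N)"
        proof (rule nn_integral_mono)
          fix z assume z: "z \<in> space N"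
          have "cmod (f z * g z) = cmod (f z * cnj (g z))" by (simp add: norm_mult)
          also have "\<dots> = cmod (g z) powr q' * indicator (G j) z * a z"
            using a0[of z] by (simp only: fg norm_of_real) simp
          finally have eq: "ennreal (cmod (f z * g z)) = k j z * A (\<phi> l) z"
            using a[OF z] by (simp add: k_def ennreal_mult)
          have "ennreal (cmod (f z * g z) * \<kappa> z) = k j z * A (\<phi> l) z * (W z * ennreal (\<theta> z))"
            using z \<kappa>_pos[OF z] eq by (simp add: ennreal_mult'' ennreal_\<kappa>)
          moreover have "\<dots> \<ge> k j z * A (\<phi> l) z * (W z * ennreal c1)"
            using \<theta>_bounds(1)[OF z] by (intro mult_left_mono ennreal_leI) auto
          ultimately show "ennreal c1 * (k j z * (A (\<phi> l) z * W z)) \<le> ennreal (cmod (f z * g z) * \<kappa> z)"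
            by (simp add: mult_ac)
        qed
        also have "\<dots> \<le> ennreal L * enn_powr (tent_integral p q f) (1 / p)"
        proof -
          have f: "f \<in> tent_fun p q"
            by (rule tent_funI[OF _ _ _ f_le h h_pos h_int]) (use pq in auto)
          then have pairable: "pairable f g" and le: "cmod (pairing f g) \<le> L * tent_norm p q f"
            using H f_le unfolding functional_bound_def by blast+
          have "(\<integral>\<^sup>+z. ennreal (cmod (f z * g z) * \<kappa> z) \<partial>N) = ennreal (cmod (pairing f g))"
          proof (rule nn_integral_pairing_nonneg[OF pairable])
            show "\<exists>u\<ge>0. f z * cnj (g z) = complex_of_real u" for z
              using a0[of z] by (intro exI[of _ "cmod (g z) powr q' * indicator (G j) z * a z"]) (simp add: fg)
          qed
          also have "\<dots> \<le> ennreal (L * tent_norm p q f)" by (rule ennreal_leI[OF le])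
          also have "\<dots> = ennreal L * enn_powr (tent_integral p q f) (1 / p)"
            using L f by (simp add: enn_powr_tent_integral ennreal_mult)
          finally show ?thesis .
        qed
        also have "\<dots> \<le> ennreal L * enn_powr (ennreal C * X j) (1 / p)"
          using int_f pq by (intro mult_left_mono enn_powr_mono) auto
        finally show ?thesis .
      qed
      have "(\<integral>\<^sup>+\<zeta>. (SUP l. \<phi> l \<zeta> * area (k j) \<zeta>) \<partial>M) = (SUP l. \<integral>\<^sup>+\<zeta>. \<phi> l \<zeta> * area (k j) \<zeta> \<partial>M)"
        by (intro nn_integral_monotone_convergence_SUP)
           (auto simp: incseq_def le_fun_def \<phi>_def intro!: mult_right_mono ennreal_leI)
      moreover have "enn_powr (area (k j) \<zeta>) \<beta> \<le> (SUP l. \<phi> l \<zeta> * area (k j) \<zeta>)" for \<zeta>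
      proof -
        obtain l :: nat where l: "x \<zeta> powr (\<beta> - 1) \<le> real l" using real_arch_simple by blast
        have "enn_powr (area (k j) \<zeta>) \<beta> = \<phi> l \<zeta> * area (k j) \<zeta>"
        proof (cases "x \<zeta> = 0")
          case False
          then have "x \<zeta> powr \<beta> = x \<zeta> powr (\<beta> - 1) * x \<zeta>"
            using powr_add[of "x \<zeta>" "\<beta> - 1" 1] x(2)[of \<zeta>] by simp
          then show ?thesis using l x[of \<zeta>] by (simp add: \<phi>_def min_absorb1 ennreal_mult)
        qed (use x[of \<zeta>] in simp)
        then show ?thesis by (auto intro!: SUP_upper2[of l])
      qed
      ultimately have "X j \<le> (SUP l. \<integral>\<^sup>+\<zeta>. \<phi> l \<zeta> * area (k j) \<zeta> \<partial>M)"
        unfolding X_def by (metis (no_types, lifting) nn_integral_mono)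
      then have "ennreal c1 * X j \<le> ennreal c1 * (SUP l. \<integral>\<^sup>+\<zeta>. \<phi> l \<zeta> * area (k j) \<zeta> \<partial>M)"
        by (intro mult_left_mono) auto
      also have "\<dots> \<le> ennreal L * enn_powr (ennreal C * X j) (1 / p)"
        unfolding SUP_mult_left_ennreal by (intro SUP_least bound)
      finally have "ennreal (1 / c1) * (ennreal c1 * X j) \<le> ennreal (1 / c1) * (ennreal L * enn_powr (ennreal C * X j) (1 / p))"
        by (intro mult_left_mono) auto
      moreover have "ennreal (1 / c1) * (ennreal c1 * X j) = X j"
        using c1_pos by (simp add: mult.assoc[symmetric] ennreal_mult[symmetric])
      moreover have "ennreal (1 / c1) * (ennreal L * enn_powr (ennreal C * X j) (1 / p)) = B * enn_powr (X j) (1 / p)"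
        using c1_pos C L by (simp add: B_def enn_powr_mult mult.assoc[symmetric] ennreal_mult[symmetric] mult.commute[of L])
      ultimately show "X j \<le> B * enn_powr (X j) (1 / p)" by simp
    qed
    have incseq_k: "incseq k"
      unfolding incseq_def le_fun_def k_def
    proof (intro allI impI ennreal_leI)
      fix i j :: nat and z assume ij: "i \<le> j"
      show "cmod (g z) powr q' * indicator (G i) z \<le> cmod (g z) powr q' * indicator (G j) z"
      proof (cases "z \<in> G i")
        case True
        then have "z \<in> space N" "cmod (g z) powr q' \<le> real i * h z" by (auto simp: G_def)
        moreover have "real i * h z \<le> real j * h z"
          using ij h_pos[OF \<open>z \<in> space N\<close>] by (intro mult_right_mono) auto
        ultimately show ?thesis using True by (simp add: G_def)
      qed simp
    qed
    have sup_k: "(SUP j. k j z) = ennreal (cmod (g z) powr q')" if z: "z \<in> space N" for z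
    proof (rule antisym)
      show "(SUP j. k j z) \<le> ennreal (cmod (g z) powr q')"
        by (intro SUP_least) (auto simp: k_def intro!: ennreal_leI split: split_indicator)
      obtain j :: nat where "cmod (g z) powr q' / h z \<le> real j" using real_arch_simple by blast
      then have "z \<in> G j" using z h_pos[OF z] by (simp add: G_def divide_le_eq)
      then show "ennreal (cmod (g z) powr q') \<le> (SUP j. k j z)"
        by (intro SUP_upper2[of j]) (auto simp: k_def)
    qed
    have area_sup: "area (\<lambda>z. ennreal (cmod (g z) powr q')) \<zeta> = (SUP j. area (k j) \<zeta>)" if \<zeta> [measurable]: "\<zeta> \<in> space M" for \<zeta>
    proof -
      have "area (\<lambda>z. ennreal (cmod (g z) powr q')) \<zeta> = (\<integral>\<^sup>+z. (SUP j. k j z * indicator (\<Gamma> \<zeta>) z) \<partial>N)"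
        unfolding area_def by (intro nn_integral_cong) (simp add: SUP_mult_right_ennreal[symmetric] sup_k)
      also have "\<dots> = (SUP j. \<integral>\<^sup>+z. k j z * indicator (\<Gamma> \<zeta>) z \<partial>N)"
        using incseq_k by (intro nn_integral_monotone_convergence_SUP)
          (auto simp: incseq_def le_fun_def intro!: mult_right_mono)
      finally show ?thesis by (simp add: area_def)
    qed
    have "tent_integral p' q' g = (\<integral>\<^sup>+\<zeta>. (SUP j. enn_powr (area (k j) \<zeta>) \<beta>) \<partial>M)"
      unfolding tent_integral_def \<beta>_def[symmetric]
      by (intro nn_integral_cong) (simp add: area_sup enn_powr_SUP[OF \<beta>])
    also have "\<dots> = (SUP j. X j)"
      unfolding X_def using incseq_k \<beta>
      by (intro nn_integral_monotone_convergence_SUP)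
         (auto simp: incseq_def le_fun_def intro!: enn_powr_mono area_mono)
    also have "\<dots> \<le> enn_powr B p'" by (intro SUP_least X_le)
    finally have "enn_powr (tent_integral p' q' g) (1 / p') \<le> enn_powr (enn_powr B p') (1 / p')"
      using ex by (intro enn_powr_mono) auto
    also have "\<dots> = B" using ex by (simp add: enn_powr_powr)
    finally show "enn_powr (tent_integral p' q' g) (1 / p') \<le> ennreal (C powr (1 / p) / c1 * L)"
      by (simp add: B_def)
  qed
qed

end

section \<open>Densities of signed measures\<close>

text \<open>
  The set function \<open>P\<close> is the positive variation of \<open>\<nu>\<close>. Countable subadditivity is inherited from
  the additivity of \<open>\<nu>\<close>, and superadditivity follows by uniting near-optimal subsets of disjoint
  sets.
\<close>

lemma countably_additive_SUP_subsets:
  fixes \<nu> :: "'b set \<Rightarrow> real"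
  assumes sums: "\<And>A. range A \<subseteq> sets N \<Longrightarrow> disjoint_family A \<Longrightarrow> (\<lambda>i. \<nu> (A i)) sums \<nu> (\<Union>i. A i)"
  defines "P \<equiv> \<lambda>X. (SUP Y\<in>{Y \<in> sets N. Y \<subseteq> X}. ennreal (\<nu> Y))"
  shows "positive (sets N) P" "countably_additive (sets N) P"
proof -
  have emp: "\<nu> {} = 0"
  proof -
    have "(\<lambda>i::nat. \<nu> {}) sums \<nu> (\<Union>i::nat. {})"
      using sums[of "\<lambda>_. {}"] by (auto simp: disjoint_family_on_def)
    then have "(\<lambda>i::nat. \<nu> {}) \<longlonglongrightarrow> 0" by (intro summable_LIMSEQ_zero) (auto simp: sums_iff)
    then show ?thesis by (simp add: LIMSEQ_const_iff)
  qed
  have fin: "\<nu> (\<Union>i<n. A i) = (\<Sum>i<n. \<nu> (A i))" if A: "range A \<subseteq> sets N" "disjoint_family A" for A :: "nat \<Rightarrow> 'b set" and n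
  proof -
    define B where "B i = (if i < n then A i else {})" for i
    have "range B \<subseteq> sets N" "disjoint_family B"
      using A by (auto simp: B_def disjoint_family_on_def)
    then have "(\<lambda>i. \<nu> (B i)) sums \<nu> (\<Union>i. B i)" by (rule sums)
    moreover have "(\<lambda>i. \<nu> (B i)) sums (\<Sum>i<n. \<nu> (B i))"
      by (rule sums_finite) (auto simp: B_def emp)
    moreover have "(\<Union>i. B i) = (\<Union>i<n. A i)" by (auto simp: B_def split: if_splits)
    ultimately show ?thesis using sums_unique2 by (force simp: B_def)
  qed
  show "positive (sets N) P"
  proof -
    have "{Y \<in> sets N. Y \<subseteq> {}} = {{}}" by auto
    then show ?thesis by (simp add: positive_def P_def emp)
  qed
  show "countably_additive (sets N) P"
  proof (rule countably_additiveI)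
    fix A :: "nat \<Rightarrow> 'b set"
    assume A: "range A \<subseteq> sets N" "disjoint_family A" "(\<Union>i. A i) \<in> sets N"
    have upper: "P (\<Union>i. A i) \<le> (\<Sum>i. P (A i))"
    proof -
      have "ennreal (\<nu> Y) \<le> (\<Sum>i. P (A i))" if Y: "Y \<in> sets N" "Y \<subseteq> (\<Union>i. A i)" for Y
      proof -
        have "range (\<lambda>i. Y \<inter> A i) \<subseteq> sets N" using A Y by auto
        moreover have "disjoint_family (\<lambda>i. Y \<inter> A i)" using A by (auto simp: disjoint_family_on_def)
        ultimately have s: "(\<lambda>i. \<nu> (Y \<inter> A i)) sums \<nu> (\<Union>i. Y \<inter> A i)" by (rule sums)
        also have "(\<Union>i. Y \<inter> A i) = Y" using Y by auto
        finally have lim: "(\<lambda>n. \<Sum>i<n. \<nu> (Y \<inter> A i)) \<longlonglongrightarrow> \<nu> Y" by (simp add: sums_def)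
        have "ennreal (\<Sum>i<n. \<nu> (Y \<inter> A i)) \<le> (\<Sum>i. P (A i))" for n
        proof -
          have "ennreal (\<Sum>i<n. \<nu> (Y \<inter> A i)) \<le> ennreal (\<Sum>i<n. max 0 (\<nu> (Y \<inter> A i)))"
            by (intro ennreal_leI sum_mono) auto
          also have "\<dots> = (\<Sum>i<n. ennreal (max 0 (\<nu> (Y \<inter> A i))))" by (simp add: sum_ennreal)
          also have "\<dots> \<le> (\<Sum>i<n. P (A i))"
          proof (rule sum_mono)
            fix i
            have "ennreal (max 0 (\<nu> (Y \<inter> A i))) = ennreal (\<nu> (Y \<inter> A i))"
              by (cases "0 \<le> \<nu> (Y \<inter> A i)") (auto simp: max_def ennreal_neg)
            also have "\<dots> \<le> P (A i)" unfolding P_def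
              by (rule SUP_upper) (use A Y in auto)
            finally show "ennreal (max 0 (\<nu> (Y \<inter> A i))) \<le> P (A i)" .
          qed
          also have "\<dots> \<le> (\<Sum>i. P (A i))" by (rule sum_le_suminf) auto
          finally show ?thesis .
        qed
        then show ?thesis
          using tendsto_ennrealI[OF lim] by (intro LIMSEQ_le_const2) auto
      qed
      then show ?thesis unfolding P_def by (intro SUP_least) auto
    qed
    have mono: "P X \<le> P Y" if "X \<subseteq> Y" for X Y
      unfolding P_def using that by (intro SUP_subset_mono) auto
    have super: "P X + P Y \<le> P (X \<union> Y)" if disj: "X \<inter> Y = {}" for X Y
    proof -
      have le: "ennreal (\<nu> X') + ennreal (\<nu> Y') \<le> P (X \<union> Y)"
        if X': "X' \<in> sets N" "X' \<subseteq> X" and Y': "Y' \<in> sets N" "Y' \<subseteq> Y" for X' Y'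
      proof -
        have sub: "ennreal (\<nu> Z) \<le> P (X \<union> Y)" if "Z \<in> sets N" "Z \<subseteq> X \<union> Y" for Z
          unfolding P_def using that by (intro SUP_upper) auto
        consider "\<nu> X' \<le> 0" | "\<nu> Y' \<le> 0" | "0 \<le> \<nu> X'" "0 \<le> \<nu> Y'" by linarith
        then show ?thesis
        proof cases
          case 1 then show ?thesis using sub[of Y'] Y' by (auto simp: ennreal_neg)
        next
          case 2 then show ?thesis using sub[of X'] X' by (auto simp: ennreal_neg)
        next
          case 3
          define B where "B i = (if i = 0 then X' else if i = 1 then Y' else {})" for i :: nat
          have "range B \<subseteq> sets N" using X' Y' by (auto simp: B_def)
          moreover have "disjoint_family B"
            using X' Y' disj unfolding disjoint_family_on_def B_def by auto
          ultimately have "\<nu> (\<Union>i<2. B i) = (\<Sum>i<2. \<nu> (B i))" by (rule fin)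
          moreover have "(\<Union>i<2. B i) = X' \<union> Y'"
            by (auto simp: B_def lessThan_Suc numeral_2_eq_2)
          ultimately have "\<nu> (X' \<union> Y') = \<nu> X' + \<nu> Y'"
            by (simp add: B_def numeral_2_eq_2)
          then show ?thesis using sub[of "X' \<union> Y'"] X' Y' 3 by (auto simp: ennreal_plus[symmetric] simp del: ennreal_plus)
        qed
      qed
      have ne: "{Z \<in> sets N. Z \<subseteq> X} \<noteq> {}" "{Z \<in> sets N. Z \<subseteq> Y} \<noteq> {}" by auto
      have "P X + P Y = (SUP X'\<in>{Z \<in> sets N. Z \<subseteq> X}. SUP Y'\<in>{Z \<in> sets N. Z \<subseteq> Y}. ennreal (\<nu> X') + ennreal (\<nu> Y'))"
        unfolding P_def ennreal_SUP_add_left[OF ne(1), symmetric] ennreal_SUP_add_right[OF ne(2)]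
        by (rule SUP_commute)
      also have "\<dots> \<le> P (X \<union> Y)" using le by (intro SUP_least) auto
      finally show ?thesis .
    qed
    have lower: "(\<Sum>i<n. P (A i)) \<le> P (\<Union>i<n. A i)" for n
    proof (induction n)
      case 0 show ?case by simp
    next
      case (Suc n)
      have "(\<Union>i<n. A i) \<inter> A n = {}"
        using A(2) by (auto simp: disjoint_family_on_def) (metis IntI empty_iff less_irrefl)
      then have "P (\<Union>i<n. A i) + P (A n) \<le> P ((\<Union>i<n. A i) \<union> A n)" by (rule super)
      with add_right_mono[OF Suc, of "P (A n)"] have "(\<Sum>i<n. P (A i)) + P (A n) \<le> P ((\<Union>i<n. A i) \<union> A n)"
        by (rule order_trans)
      then show ?case by (simp add: lessThan_Suc Un_commute add.commute)
    qed
    have "(\<Sum>i. P (A i)) \<le> P (\<Union>i. A i)"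
      by (intro suminf_le_const) (auto intro!: order_trans[OF lower mono])
    then show "(\<Sum>i. P (A i)) = P (\<Union>i. A i)"
      by (intro antisym upper)
  qed
qed

text \<open>
  The positive variations of \<open>\<nu>\<close> and of \<open>- \<nu>\<close> are finite measures, and their difference is \<open>\<nu>\<close>: a
  subset \<open>Y\<close> of \<open>X\<close> has large \<open>\<nu> Y\<close> exactly if its complement in \<open>X\<close> has small \<open>\<nu> (X - Y)\<close>. Each of
  the two measures has a density.
\<close>

lemma (in sigma_finite_measure) signed_Radon_Nikodym:
  fixes \<nu> :: "'a set \<Rightarrow> real"
  assumes sums: "\<And>A. range A \<subseteq> sets M \<Longrightarrow> disjoint_family A \<Longrightarrow> (\<lambda>i. \<nu> (A i)) sums \<nu> (\<Union>i. A i)"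
    and null: "\<And>A. A \<in> null_sets M \<Longrightarrow> \<nu> A = 0"
    and bounded: "\<And>A. A \<in> sets M \<Longrightarrow> \<bar>\<nu> A\<bar> \<le> b"
  shows "\<exists>k. integrable M k \<and> (\<forall>A\<in>sets M. \<nu> A = (\<integral>x. indicator A x * k x \<partial>M))"
proof -
  define P where "P \<sigma> X = (SUP Y\<in>{Y \<in> sets M. Y \<subseteq> X}. ennreal (\<sigma> * \<nu> Y))" for \<sigma> :: real and X
  \<comment> \<open>For \<open>\<sigma> = 1\<close> and \<open>\<sigma> = -1\<close> this treats the positive and the negative variation at once.\<close>
  have dens: "\<exists>k. k \<in> borel_measurable M \<and> (\<forall>X\<in>sets M. P \<sigma> X = (\<integral>\<^sup>+x. indicator X x * k x \<partial>M))" if "\<sigma> \<in> {1, -1}" for \<sigma>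
  proof -
    have "\<And>A. range A \<subseteq> sets M \<Longrightarrow> disjoint_family A \<Longrightarrow> (\<lambda>i. \<sigma> * \<nu> (A i)) sums (\<sigma> * \<nu> (\<Union>i. A i))"
      using sums by (rule sums_mult)
    note ca = countably_additive_SUP_subsets[of M "\<lambda>Y. \<sigma> * \<nu> Y", OF this, folded P_def]
    define Q where "Q = measure_of (space M) (sets M) (P \<sigma>)"
    have em: "emeasure Q X = P \<sigma> X" if "X \<in> sets M" for X
      unfolding Q_def using ca that by (intro emeasure_measure_of_sigma sets.sigma_algebra_axioms)
    have sQ: "sets Q = sets M" by (simp add: Q_def)
    have "absolutely_continuous M Q"
    proof (unfold absolutely_continuous_def, safe)
      fix X assume X: "X \<in> null_sets M"
      have "P \<sigma> X \<le> 0" unfolding P_def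
      proof (rule SUP_least)
        fix Y assume "Y \<in> {Y \<in> sets M. Y \<subseteq> X}"
        then have "\<nu> Y = 0" using null_sets_subset[OF X, of Y] null[of Y] by auto
        then show "ennreal (\<sigma> * \<nu> Y) \<le> 0" by simp
      qed
      then have "P \<sigma> X = 0" by simp
      then show "X \<in> null_sets Q" using X em by (auto simp: null_sets_def sQ)
    qed
    from Radon_Nikodym[OF this sQ] obtain k where k: "k \<in> borel_measurable M" "density M k = Q" by blast
    have "P \<sigma> X = (\<integral>\<^sup>+x. indicator X x * k x \<partial>M)" if "X \<in> sets M" for X
      using em[OF that] k that by (simp add: emeasure_density[symmetric] mult.commute)
    then show ?thesis using k by blast
  qed
  obtain f g where f [measurable]: "f \<in> borel_measurable M" and f_eq: "\<And>X. X \<in> sets M \<Longrightarrow> P 1 X = (\<integral>\<^sup>+x. indicator X x * f x \<partial>M)"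
    and g [measurable]: "g \<in> borel_measurable M" and g_eq: "\<And>X. X \<in> sets M \<Longrightarrow> P (-1) X = (\<integral>\<^sup>+x. indicator X x * g x \<partial>M)"
    using dens[of 1] dens[of "-1"] by auto
  have P_le: "P \<sigma> X \<le> ennreal b" if "\<sigma> \<in> {1, -1}" for \<sigma> X
    unfolding P_def
  proof (rule SUP_least)
    fix Y assume "Y \<in> {Y \<in> sets M. Y \<subseteq> X}"
    then show "ennreal (\<sigma> * \<nu> Y) \<le> ennreal b" using bounded[of Y] that by (intro ennreal_leI) auto
  qed
  have fin: "(\<integral>\<^sup>+x. f x \<partial>M) \<noteq> \<infinity>" "(\<integral>\<^sup>+x. g x \<partial>M) \<noteq> \<infinity>"
  proof -
    have "(\<integral>\<^sup>+x. f x \<partial>M) = P 1 (space M)" "(\<integral>\<^sup>+x. g x \<partial>M) = P (-1) (space M)"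
      by (auto simp: f_eq g_eq intro!: nn_integral_cong)
    then show "(\<integral>\<^sup>+x. f x \<partial>M) \<noteq> \<infinity>" "(\<integral>\<^sup>+x. g x \<partial>M) \<noteq> \<infinity>"
      using P_le[of 1 "space M"] P_le[of "-1" "space M"] by (auto simp: top_unique)
  qed
  have fr: "AE x in M. ennreal (enn2real (f x)) = f x" and gr: "AE x in M. ennreal (enn2real (g x)) = g x"
    using nn_integral_PInf_AE[OF f fin(1)] nn_integral_PInf_AE[OF g fin(2)]
    by (eventually_elim, simp add: less_top[symmetric])+
  have int: "integrable M (\<lambda>x. enn2real (f x))" "integrable M (\<lambda>x. enn2real (g x))"
  proof -
    have "(\<integral>\<^sup>+x. ennreal (enn2real (f x)) \<partial>M) = (\<integral>\<^sup>+x. f x \<partial>M)" "(\<integral>\<^sup>+x. ennreal (enn2real (g x)) \<partial>M) = (\<integral>\<^sup>+x. g x \<partial>M)"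
      using fr gr by (auto intro!: nn_integral_cong_AE)
    then show "integrable M (\<lambda>x. enn2real (f x))" "integrable M (\<lambda>x. enn2real (g x))"
      using fin by (auto intro!: integrableI_nonneg simp: less_top[symmetric])
  qed
  have real_eq: "ennreal (\<integral>x. indicator X x * enn2real (f x) \<partial>M) = P 1 X"
    "ennreal (\<integral>x. indicator X x * enn2real (g x) \<partial>M) = P (-1) X" if [measurable]: "X \<in> sets M" for X
  proof -
    have "ennreal (\<integral>x. indicator X x * enn2real (f x) \<partial>M) = (\<integral>\<^sup>+x. ennreal (indicator X x * enn2real (f x)) \<partial>M)"
      using integrable_mult_indicator[OF that int(1)] by (intro nn_integral_eq_integral[symmetric]) auto
    also have "\<dots> = (\<integral>\<^sup>+x. indicator X x * f x \<partial>M)"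
      using fr by (intro nn_integral_cong_AE) (auto split: split_indicator)
    finally show "ennreal (\<integral>x. indicator X x * enn2real (f x) \<partial>M) = P 1 X" by (simp add: f_eq)
    have "ennreal (\<integral>x. indicator X x * enn2real (g x) \<partial>M) = (\<integral>\<^sup>+x. ennreal (indicator X x * enn2real (g x)) \<partial>M)"
      using integrable_mult_indicator[OF that int(2)] by (intro nn_integral_eq_integral[symmetric]) auto
    also have "\<dots> = (\<integral>\<^sup>+x. indicator X x * g x \<partial>M)"
      using gr by (intro nn_integral_cong_AE) (auto split: split_indicator)
    finally show "ennreal (\<integral>x. indicator X x * enn2real (g x) \<partial>M) = P (-1) X" by (simp add: g_eq)
  qed
  have split2: "\<nu> X = \<nu> Y + \<nu> (X - Y)" if XY: "X \<in> sets M" "Y \<in> sets M" "Y \<subseteq> X" for X Y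
  proof -
    define B where "B i = (if i = 0 then Y else if i = 1 then X - Y else {})" for i :: nat
    have "(\<lambda>i. \<nu> (B i)) sums \<nu> (\<Union>i. B i)"
      using XY by (intro sums) (auto simp: B_def disjoint_family_on_def)
    moreover have "(\<lambda>i. \<nu> (B i)) sums (\<Sum>i<2. \<nu> (B i))"
      by (rule sums_finite) (auto simp: B_def null)
    moreover have "(\<Union>i. B i) = X" using XY by (auto simp: B_def split: if_splits)
    ultimately have "\<nu> X = (\<Sum>i<2. \<nu> (B i))" using sums_unique2 by metis
    then show ?thesis by (simp add: B_def numeral_2_eq_2)
  qed
  have main: "\<nu> X = (\<integral>x. indicator X x * (enn2real (f x) - enn2real (g x)) \<partial>M)" if X [measurable]: "X \<in> sets M" for X
  proof -
    define F where "F = (\<integral>x. indicator X x * enn2real (f x) \<partial>M)"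
    define G where "G = (\<integral>x. indicator X x * enn2real (g x) \<partial>M)"
    have FG0: "0 \<le> F" "0 \<le> G" unfolding F_def G_def by (auto intro!: integral_nonneg_AE)
    have F: "\<nu> Y \<le> F" and G: "- \<nu> Y \<le> G" if Y: "Y \<in> sets M" "Y \<subseteq> X" for Y
    proof -
      have "ennreal (1 * \<nu> Y) \<le> P 1 X" "ennreal (- 1 * \<nu> Y) \<le> P (-1) X"
        unfolding P_def using Y by (auto intro!: SUP_upper)
      then have "ennreal (\<nu> Y) \<le> ennreal F" "ennreal (- \<nu> Y) \<le> ennreal G"
        unfolding F_def G_def by (simp_all add: real_eq[OF X])
      then show "\<nu> Y \<le> F" "- \<nu> Y \<le> G" using FG0 by (auto simp: ennreal_le_iff)
    qed
    have "ennreal F \<le> ennreal (\<nu> X + G)"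
      unfolding F_def real_eq(1)[OF X] P_def
    proof (rule SUP_least)
      fix Y assume Y: "Y \<in> {Y \<in> sets M. Y \<subseteq> X}"
      show "ennreal (1 * \<nu> Y) \<le> ennreal (\<nu> X + G)"
        using split2[of X Y] G[of "X - Y"] Y X by (intro ennreal_leI) auto
    qed
    moreover have "0 \<le> \<nu> X + G" using G[of X] X by auto
    ultimately have 1: "F \<le> \<nu> X + G" by (simp add: ennreal_le_iff)
    have "ennreal G \<le> ennreal (F - \<nu> X)"
      unfolding G_def real_eq(2)[OF X] P_def
    proof (rule SUP_least)
      fix Y assume Y: "Y \<in> {Y \<in> sets M. Y \<subseteq> X}"
      show "ennreal (- 1 * \<nu> Y) \<le> ennreal (F - \<nu> X)"
        using split2[of X Y] F[of "X - Y"] Y X by (intro ennreal_leI) auto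
    qed
    moreover have "0 \<le> F - \<nu> X" using F[of X] X by auto
    ultimately have 2: "G \<le> F - \<nu> X" by (simp add: ennreal_le_iff)
    have "(\<integral>x. indicator X x * (enn2real (f x) - enn2real (g x)) \<partial>M) = F - G"
      unfolding F_def G_def right_diff_distrib
      using integrable_mult_indicator[OF X int(1)] integrable_mult_indicator[OF X int(2)]
      by (intro Bochner_Integration.integral_diff) auto
    then show ?thesis using 1 2 by simp
  qed
  show ?thesis
    using main int by (intro exI[of _ "\<lambda>x. enn2real (f x) - enn2real (g x)"]) auto
qed

section \<open>Representation of bounded functionals\<close>

text \<open>
  The function \<open>h\<close> supplies a positive function \<open>\<rho> = h^{1/q}\<close> all of whose bounded multiples lie
  in the tent space. Restricted to these multiples, the functional can be read as a complex
  measure.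
\<close>

locale tent_functional = weighted_tent_space +
  fixes p q p' q' :: real and h :: "'b \<Rightarrow> real" and T :: "('b \<Rightarrow> complex) \<Rightarrow> complex" and C :: real
  assumes pq: "1 < p" "1 < q" "1 / p + 1 / p' = 1" "1 / q + 1 / q' = 1"
    and h_measurable [measurable]: "h \<in> borel_measurable N"
    and h_pos: "\<And>z. z \<in> space N \<Longrightarrow> 0 < h z"
    and h_int: "(\<integral>\<^sup>+z. ennreal (h z) \<partial>N) < top"
    and T_add: "\<And>f g. f \<in> tent_fun p q \<Longrightarrow> g \<in> tent_fun p q \<Longrightarrow> T (\<lambda>z. f z + g z) = T f + T g"
    and T_scale: "\<And>c f. f \<in> tent_fun p q \<Longrightarrow> T (\<lambda>z. c * f z) = c * T f"
    and T_bound: "\<And>f. f \<in> tent_fun p q \<Longrightarrow> cmod (T f) \<le> C * tent_norm p q f"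
begin

lemma pos: "0 < p" "0 < q" "0 < 1 / p" "0 < p / q" using pq by auto

definition \<rho> :: "'b \<Rightarrow> real" where "\<rho> z = h z powr (1 / q)"

lemma \<rho>_measurable [measurable]: "\<rho> \<in> borel_measurable N"
  unfolding \<rho>_def by measurable

lemma \<rho>_pos: "z \<in> space N \<Longrightarrow> 0 < \<rho> z"
  using h_pos[of z] by (simp add: \<rho>_def)

lemma \<rho>_powr: "z \<in> space N \<Longrightarrow> \<rho> z powr q = h z"
  using h_pos[of z] pos by (simp add: \<rho>_def powr_powr)

text \<open>
  After division by \<open>\<rho>\<close> these functions are bounded, so that on them \<open>T\<close> is determined by a
  measure.
\<close>

definition tame :: "('b \<Rightarrow> complex) set" where
  "tame = {f \<in> borel_measurable N. \<exists>c. \<forall>z\<in>space N. cmod (f z) \<le> c * \<rho> z}"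

lemma scaled_\<rho>_tent_fun: "(\<lambda>z. complex_of_real (c * \<rho> z)) \<in> tent_fun p q"
proof (rule tent_funI[OF pos(1,2) _ _ h_measurable h_pos h_int])
  show "cmod (complex_of_real (c * \<rho> z)) powr q \<le> \<bar>c\<bar> powr q * h z" if "z \<in> space N" for z
    using \<rho>_pos[OF that] \<rho>_powr[OF that] by (simp add: norm_mult powr_mult)
qed measurable

lemma tame_tent_fun: "f \<in> tame \<Longrightarrow> f \<in> tent_fun p q"
proof -
  assume f: "f \<in> tame"
  then obtain c where c: "\<And>z. z \<in> space N \<Longrightarrow> cmod (f z) \<le> c * \<rho> z" by (auto simp: tame_def)
  show ?thesis
  proof (rule dominated_in_tent_fun[OF pos(1,2) scaled_\<rho>_tent_fun[of c]])
    show "cmod (f z) \<le> cmod (complex_of_real (c * \<rho> z))" if "z \<in> space N" for z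
      using c[OF that] by (simp only: norm_of_real)
  qed (use f in \<open>simp add: tame_def\<close>)
qed

lemma tameI: "f \<in> borel_measurable N \<Longrightarrow> (\<And>z. z \<in> space N \<Longrightarrow> cmod (f z) \<le> c * \<rho> z) \<Longrightarrow> f \<in> tame"
  by (auto simp: tame_def)

lemma tame_add: "f \<in> tame \<Longrightarrow> g \<in> tame \<Longrightarrow> (\<lambda>z. f z + g z) \<in> tame"
proof -
  assume f: "f \<in> tame" and g: "g \<in> tame"
  then obtain a b where a: "\<And>z. z \<in> space N \<Longrightarrow> cmod (f z) \<le> a * \<rho> z" and b: "\<And>z. z \<in> space N \<Longrightarrow> cmod (g z) \<le> b * \<rho> z"
    by (auto simp: tame_def)
  show ?thesis
  proof (rule tameI[of _ "a + b"])
    show "(\<lambda>z. f z + g z) \<in> borel_measurable N" using f g by (auto simp: tame_def)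
    show "cmod (f z + g z) \<le> (a + b) * \<rho> z" if "z \<in> space N" for z
      using norm_triangle_ineq[of "f z" "g z"] a[OF that] b[OF that] by (simp add: distrib_right)
  qed
qed

lemma tame_scale: "f \<in> tame \<Longrightarrow> (\<lambda>z. c * f z) \<in> tame"
proof -
  assume f: "f \<in> tame"
  then obtain a where a: "\<And>z. z \<in> space N \<Longrightarrow> cmod (f z) \<le> a * \<rho> z"
    by (auto simp: tame_def)
  show ?thesis
  proof (rule tameI[of _ "cmod c * a"])
    show "(\<lambda>z. c * f z) \<in> borel_measurable N" using f by (auto simp: tame_def)
    show "cmod (c * f z) \<le> (cmod c * a) * \<rho> z" if "z \<in> space N" for z
      using a[OF that] by (simp add: norm_mult mult.assoc mult_left_mono)
  qed
qed

text \<open>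
  Dominated convergence in \<open>z\<close>, at almost every \<open>\<zeta>\<close>, shows that the area integrals tend to 0;
  dominated convergence in \<open>\<zeta>\<close> shows that the tent norms do.
\<close>

lemma T_dominated_tendsto_0:
  assumes F: "F \<in> tent_fun p q" and [measurable]: "\<And>n. f n \<in> borel_measurable N"
    and le: "\<And>n z. z \<in> space N \<Longrightarrow> cmod (f n z) \<le> cmod (F z)"
    and lim: "\<And>z. z \<in> space N \<Longrightarrow> (\<lambda>n. f n z) \<longlonglongrightarrow> 0"
  shows "(\<lambda>n. T (f n)) \<longlonglongrightarrow> 0"
proof -
  have [measurable]: "F \<in> borel_measurable N" and F_fin: "tent_integral p q F < top" using F by (auto simp: tent_fun_def)
  define kF where "kF z = ennreal (cmod (F z) powr q)" for z
  define k where "k n z = ennreal (cmod (f n z) powr q)" for n z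
  have [measurable]: "kF \<in> borel_measurable N" "k n \<in> borel_measurable N" for n
    unfolding kF_def k_def by measurable
  have k_le: "k n z \<le> kF z" if "z \<in> space N" for n z
    unfolding k_def kF_def using le[OF that] pos by (intro ennreal_leI powr_mono2) auto
  have k_lim: "(\<lambda>n. k n z) \<longlonglongrightarrow> 0" if "z \<in> space N" for z
  proof -
    have "(\<lambda>n. cmod (f n z)) \<longlonglongrightarrow> 0" using lim[OF that] by (rule tendsto_norm_zero)
    then have "(\<lambda>n. enn_powr (ennreal (cmod (f n z))) q) \<longlonglongrightarrow> 0"
      using pos tendsto_ennrealI[of "\<lambda>n. cmod (f n z)" 0] by (intro enn_powr_tendsto_0) auto
    then show ?thesis by (simp add: k_def)
  qed
  have "(\<lambda>n. \<integral>\<^sup>+\<zeta>. enn_powr (area (k n) \<zeta>) (p / q) \<partial>M) \<longlonglongrightarrow> (\<integral>\<^sup>+\<zeta>. 0 \<partial>M)"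
  proof (rule nn_integral_dominated_convergence[where w="\<lambda>\<zeta>. enn_powr (area kF \<zeta>) (p / q)"])
    show "AE \<zeta> in M. enn_powr (area (k n) \<zeta>) (p / q) \<le> enn_powr (area kF \<zeta>) (p / q)" for n
      using k_le pos by (intro AE_I2 enn_powr_mono area_mono) auto
    show "(\<integral>\<^sup>+\<zeta>. enn_powr (area kF \<zeta>) (p / q) \<partial>M) < \<infinity>"
      using F_fin by (simp add: tent_integral_def kF_def[abs_def])
    have "AE \<zeta> in M. enn_powr (area kF \<zeta>) (p / q) \<noteq> \<infinity>"
      using F_fin by (intro nn_integral_PInf_AE) (auto simp: tent_integral_def kF_def[abs_def])
    with AE_space show "AE \<zeta> in M. (\<lambda>n. enn_powr (area (k n) \<zeta>) (p / q)) \<longlonglongrightarrow> 0"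
    proof eventually_elim
      case (elim \<zeta>)
      then have [measurable]: "\<zeta> \<in> space M" and fin: "area kF \<zeta> < top" by (auto simp: less_top[symmetric])
      have "(\<lambda>n. \<integral>\<^sup>+z. k n z * indicator (\<Gamma> \<zeta>) z \<partial>N) \<longlonglongrightarrow> (\<integral>\<^sup>+z. 0 \<partial>N)"
      proof (rule nn_integral_dominated_convergence[where w="\<lambda>z. kF z * indicator (\<Gamma> \<zeta>) z"])
        show "AE z in N. k n z * indicator (\<Gamma> \<zeta>) z \<le> kF z * indicator (\<Gamma> \<zeta>) z" for n
          using k_le by (intro AE_I2 mult_right_mono) auto
        show "(\<integral>\<^sup>+z. kF z * indicator (\<Gamma> \<zeta>) z \<partial>N) < \<infinity>" using fin by (simp add: area_def)
        show "AE z in N. (\<lambda>n. k n z * indicator (\<Gamma> \<zeta>) z) \<longlonglongrightarrow> 0"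
          using k_lim by (intro AE_I2) (auto split: split_indicator)
      qed measurable
      then have "(\<lambda>n. area (k n) \<zeta>) \<longlonglongrightarrow> 0" by (simp add: area_def)
      then show ?case using pos by (intro enn_powr_tendsto_0)
    qed
  qed measurable
  moreover have "k n = (\<lambda>z. ennreal (cmod (f n z) powr q))" for n by (simp add: k_def fun_eq_iff)
  ultimately have "(\<lambda>n. tent_integral p q (f n)) \<longlonglongrightarrow> 0"
    by (simp add: tent_integral_def)
  then have "(\<lambda>n. enn2real (tent_integral p q (f n))) \<longlonglongrightarrow> 0"
    using tendsto_enn2real[of _ 0] by simp
  then have "(\<lambda>n. tent_norm p q (f n)) \<longlonglongrightarrow> 0"
    unfolding tent_norm_def using pos tendsto_powr'[of _ 0 sequentially "\<lambda>_. 1 / p" "1 / p"] by auto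
  then have l: "(\<lambda>n. C * tent_norm p q (f n)) \<longlonglongrightarrow> 0"
    using tendsto_mult[OF tendsto_const[of C]] by fastforce
  show ?thesis
  proof (rule Lim_null_comparison[OF _ l])
    have "f n \<in> tent_fun p q" for n using dominated_in_tent_fun[OF pos(1,2) F] le by auto
    then show "\<forall>\<^sub>F n in sequentially. cmod (T (f n)) \<le> C * tent_norm p q (f n)"
      using T_bound by simp
  qed
qed

lemma T_zero_on: 
  assumes f: "f \<in> borel_measurable N" and z: "AE z in N. f z = 0"
  shows "T f = 0"
proof -
  have [measurable]: "f \<in> borel_measurable N" by fact
  have "tent_integral p q f \<le> emeasure M (space M) * enn_powr (\<integral>\<^sup>+z. ennreal (cmod (f z) powr q) \<partial>N) (p / q)"
    using pos by (intro tent_integral_le) auto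
  also have "(\<integral>\<^sup>+z. ennreal (cmod (f z) powr q) \<partial>N) = 0"
    using z by (subst nn_integral_0_iff_AE) auto
  finally have 0: "tent_integral p q f = 0" by simp
  then have "f \<in> tent_fun p q" by (simp add: tent_fun_def)
  from T_bound[OF this] show ?thesis by (simp add: 0 tent_norm_def)
qed

lemma T_diff:
  assumes "f \<in> tent_fun p q" "g \<in> tame"
  shows "T (\<lambda>z. f z - g z) = T f - T g"
  using T_add[OF assms(1) tame_tent_fun[OF tame_scale[OF assms(2), of "-1"]]] T_scale[OF tame_tent_fun[OF assms(2)], of "-1"]
  by simp

lemma T_cong:
  assumes f: "f \<in> tame" and g: "g \<in> tame" and eq: "\<And>z. z \<in> space N \<Longrightarrow> f z = g z"
  shows "T f = T g"
proof -
  have "T (\<lambda>z. f z - g z) = 0"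
    using f g eq by (intro T_zero_on) (auto simp: tame_def)
  then show ?thesis using T_diff[OF tame_tent_fun[OF f] g] by simp
qed

lemma tame_real:
  assumes "u \<in> borel_measurable N" "\<And>z. z \<in> space N \<Longrightarrow> \<bar>u z\<bar> \<le> c"
  shows "(\<lambda>z. complex_of_real (\<rho> z * u z)) \<in> tame"
proof (rule tameI[of _ c])
  show "cmod (complex_of_real (\<rho> z * u z)) \<le> c * \<rho> z" if "z \<in> space N" for z
    using assms(2)[OF that] \<rho>_pos[OF that] by (simp add: norm_mult abs_mult mult.commute mult_right_mono)
qed (use assms in measurable)

definition \<nu> :: "'b set \<Rightarrow> complex" where
  "\<nu> X = T (\<lambda>z. complex_of_real (\<rho> z * indicator X z))"

lemma tame_indicator: "X \<in> sets N \<Longrightarrow> (\<lambda>z. complex_of_real (\<rho> z * indicator X z)) \<in> tame"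
  by (rule tame_real[of _ 1]) (auto split: split_indicator)

lemma \<nu>_Un:
  assumes "X \<in> sets N" "Y \<in> sets N" "X \<inter> Y = {}"
  shows "\<nu> (X \<union> Y) = \<nu> X + \<nu> Y"
proof -
  have "(\<lambda>z. complex_of_real (\<rho> z * indicator (X \<union> Y) z))
    = (\<lambda>z. complex_of_real (\<rho> z * indicator X z) + complex_of_real (\<rho> z * indicator Y z))"
    using assms(3) by (auto simp: fun_eq_iff split: split_indicator)
  then show ?thesis
    unfolding \<nu>_def using T_add[OF tame_tent_fun tame_tent_fun, OF tame_indicator tame_indicator] assms by simp
qed

text \<open>
  The remainders \<open>\<rho> \<chi>_{R n}\<close> tend to 0 pointwise and are dominated by \<open>\<rho>\<close>.
\<close>

lemma \<nu>_sums:
  assumes E: "range E \<subseteq> sets N" "disjoint_family E"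
  shows "(\<lambda>i. \<nu> (E i)) sums \<nu> (\<Union>i. E i)"
proof -
  have [measurable]: "E i \<in> sets N" for i using E by auto
  have part: "\<nu> (\<Union>i<n. E i) = (\<Sum>i<n. \<nu> (E i))" for n
  proof (induction n)
    case 0
    show ?case using T_zero_on[of "\<lambda>_. 0"] by (simp add: \<nu>_def)
  next
    case (Suc n)
    have "\<nu> ((\<Union>i<n. E i) \<union> E n) = \<nu> (\<Union>i<n. E i) + \<nu> (E n)"
      using E(2) by (intro \<nu>_Un) (auto simp: disjoint_family_on_def, metis IntI empty_iff less_irrefl)
    then show ?case using Suc by (simp add: lessThan_Suc Un_commute)
  qed
  define R where "R n = (\<Union>i. E i) - (\<Union>i<n. E i)" for n
  have [measurable]: "R n \<in> sets N" for n unfolding R_def by measurable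
  have split: "\<nu> (\<Union>i. E i) = \<nu> (\<Union>i<n. E i) + \<nu> (R n)" for n
  proof -
    have "\<nu> ((\<Union>i<n. E i) \<union> R n) = \<nu> (\<Union>i<n. E i) + \<nu> (R n)"
      by (rule \<nu>_Un) (auto simp: R_def)
    moreover have "(\<Union>i<n. E i) \<union> R n = (\<Union>i. E i)" by (auto simp: R_def)
    ultimately show ?thesis by (simp only:)
  qed
  have "(\<lambda>n. \<nu> (R n)) \<longlonglongrightarrow> 0"
    unfolding \<nu>_def
  proof (rule T_dominated_tendsto_0[OF scaled_\<rho>_tent_fun[of 1]])
    show "cmod (complex_of_real (\<rho> z * indicator (R n) z)) \<le> cmod (complex_of_real (1 * \<rho> z))" for n z
      by (auto split: split_indicator)
    show "(\<lambda>n. complex_of_real (\<rho> z * indicator (R n) z)) \<longlonglongrightarrow> 0" for z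
    proof (rule tendsto_eventually)
      show "\<forall>\<^sub>F n in sequentially. complex_of_real (\<rho> z * indicator (R n) z) = 0"
      proof (cases "z \<in> (\<Union>i. E i)")
        case True
        then obtain i where "z \<in> E i" by auto
        then have "z \<notin> R n" if "i < n" for n using that by (auto simp: R_def)
        then show ?thesis
          by (intro eventually_mono[OF eventually_gt_at_top[of i]]) simp
      qed (auto simp: R_def)
    qed
  qed measurable
  then have "(\<lambda>n. \<nu> (\<Union>i. E i) - \<nu> (R n)) \<longlonglongrightarrow> \<nu> (\<Union>i. E i) - 0"
    by (intro tendsto_diff tendsto_const)
  moreover have "\<nu> (\<Union>i. E i) - \<nu> (R n) = (\<Sum>i<n. \<nu> (E i))" for n
    using split[of n] part[of n] by simp
  ultimately show ?thesis by (simp add: sums_def)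
qed

lemma \<nu>_bounded: "\<exists>b. \<forall>X\<in>sets N. cmod (\<nu> X) \<le> b"
proof (intro exI ballI)
  fix X assume X: "X \<in> sets N"
  have "cmod (\<nu> X) \<le> C * tent_norm p q (\<lambda>z. complex_of_real (\<rho> z * indicator X z))"
    unfolding \<nu>_def by (rule T_bound[OF tame_tent_fun[OF tame_indicator[OF X]]])
  also have "\<dots> \<le> \<bar>C\<bar> * tent_norm p q (\<lambda>z. complex_of_real (1 * \<rho> z))"
    by (intro mult_mono tent_norm_mono pos scaled_\<rho>_tent_fun) (auto split: split_indicator)
  finally show "cmod (\<nu> X) \<le> \<bar>C\<bar> * tent_norm p q (\<lambda>z. complex_of_real (1 * \<rho> z))" .
qed

lemma \<nu>_null: "X \<in> null_sets N \<Longrightarrow> \<nu> X = 0"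
  unfolding \<nu>_def
proof (rule T_zero_on)
  assume X: "X \<in> null_sets N"
  then have [measurable]: "X \<in> sets N" by auto
  show "(\<lambda>z. complex_of_real (\<rho> z * indicator X z)) \<in> borel_measurable N" by measurable
  show "AE z in N. complex_of_real (\<rho> z * indicator X z) = 0"
    using AE_not_in[OF X] by eventually_elim auto
qed

lemma \<nu>_density: "\<exists>k. integrable N k \<and> (\<forall>X\<in>sets N. \<nu> X = (\<integral>z. complex_of_real (indicator X z) * k z \<partial>N))"
proof -
  obtain b where b: "\<And>X. X \<in> sets N \<Longrightarrow> cmod (\<nu> X) \<le> b" using \<nu>_bounded by blast
  have "\<exists>k. integrable N k \<and> (\<forall>X\<in>sets N. Re (\<nu> X) = (\<integral>z. indicator X z * k z \<partial>N))"
  proof (rule N.signed_Radon_Nikodym[where b=b])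
    show "\<bar>Re (\<nu> X)\<bar> \<le> b" if "X \<in> sets N" for X
      using b[OF that] abs_Re_le_cmod[of "\<nu> X"] by linarith
  qed (auto simp: \<nu>_null intro: sums_Re \<nu>_sums)
  then obtain k1 where k1: "integrable N k1" "\<And>X. X \<in> sets N \<Longrightarrow> Re (\<nu> X) = (\<integral>z. indicator X z * k1 z \<partial>N)" by blast
  have "\<exists>k. integrable N k \<and> (\<forall>X\<in>sets N. Im (\<nu> X) = (\<integral>z. indicator X z * k z \<partial>N))"
  proof (rule N.signed_Radon_Nikodym[where b=b])
    show "\<bar>Im (\<nu> X)\<bar> \<le> b" if "X \<in> sets N" for X
      using b[OF that] abs_Im_le_cmod[of "\<nu> X"] by linarith
  qed (auto simp: \<nu>_null intro: sums_Im \<nu>_sums)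
  then obtain k2 where k2: "integrable N k2" "\<And>X. X \<in> sets N \<Longrightarrow> Im (\<nu> X) = (\<integral>z. indicator X z * k2 z \<partial>N)" by blast
  define k where "k z = complex_of_real (k1 z) + \<i> * complex_of_real (k2 z)" for z
  have k: "integrable N k" unfolding k_def using k1(1) k2(1) by auto
  have "\<nu> X = (\<integral>z. complex_of_real (indicator X z) * k z \<partial>N)" if X: "X \<in> sets N" for X
  proof -
    have ik: "integrable N (\<lambda>z. complex_of_real (indicator X z) * k z)"
      using integrable_mult_indicator[OF X k] by (simp add: scaleR_conv_of_real)
    show ?thesis
      using integral_Re[OF ik] integral_Im[OF ik] k1(2)[OF X] k2(2)[OF X]
      by (intro complex_eqI) (simp_all add: k_def)
  qed
  with k show ?thesis by blast
qed

text \<open>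
  For indicators this is the definition of the density. Monotone approximation extends it to
  bounded nonnegative functions, where \<open>T\<close> passes to the limit by \<open>T_dominated_tendsto_0\<close>;
  linearity yields real and complex functions.
\<close>

lemma tame_representation: "\<exists>k. integrable N k \<and>
    (\<forall>f\<in>tame. T f = (\<integral>z. f z / complex_of_real (\<rho> z) * k z \<partial>N) \<and> integrable N (\<lambda>z. f z / complex_of_real (\<rho> z) * k z))"
proof -
  obtain k where k: "integrable N k" and \<nu>k: "\<And>X. X \<in> sets N \<Longrightarrow> \<nu> X = (\<integral>z. complex_of_real (indicator X z) * k z \<partial>N)"
    using \<nu>_density by blast
  have [measurable]: "k \<in> borel_measurable N" using k by simp
  have int: "integrable N (\<lambda>z. s z * k z)" if [measurable]: "s \<in> borel_measurable N" and "\<And>z. z \<in> space N \<Longrightarrow> cmod (s z) \<le> c" for s c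
  proof (rule Bochner_Integration.integrable_bound[OF integrable_mult_right[of "complex_of_real c", OF k]])
    show "AE z in N. cmod (s z * k z) \<le> cmod (complex_of_real c * k z)"
    proof (intro AE_I2)
      fix z assume z: "z \<in> space N"
      have "cmod (s z) \<le> \<bar>c\<bar>" using that(2)[OF z] by linarith
      then show "cmod (s z * k z) \<le> cmod (complex_of_real c * k z)"
        by (simp add: norm_mult mult_right_mono)
    qed
  qed measurable
  have pos_rep: "(\<exists>c. \<forall>z\<in>space N. u z \<le> c) \<longrightarrow> T (\<lambda>z. complex_of_real (\<rho> z * u z)) = (\<integral>z. complex_of_real (u z) * k z \<partial>N)"
    if "u \<in> borel_measurable N" "\<And>z. 0 \<le> u z" for u :: "'b \<Rightarrow> real"
    using that
  proof (induction rule: borel_measurable_induct_real)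
    case (set X)
    then show ?case using \<nu>k[OF set] by (simp add: \<nu>_def)
  next
    case (mult u c)
    show ?case
    proof (cases "c = 0")
      case True
      then show ?thesis using T_zero_on[of "\<lambda>_. 0"] by simp
    next
      case False
      show ?thesis
      proof (intro impI)
        assume "\<exists>b. \<forall>z\<in>space N. c * u z \<le> b"
        then obtain b where "\<forall>z\<in>space N. c * u z \<le> b" by blast
        then have b: "\<forall>z\<in>space N. u z \<le> b / c" using mult.hyps(1) False by (simp add: pos_le_divide_eq mult.commute)
        then have "(\<lambda>z. complex_of_real (\<rho> z * u z)) \<in> tame" using mult.hyps by (intro tame_real[of _ "b / c"]) auto
        from T_scale[OF tame_tent_fun[OF this], of c]
        have "T (\<lambda>z. complex_of_real (\<rho> z * (c * u z))) = c * T (\<lambda>z. complex_of_real (\<rho> z * u z))"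
          by (simp add: mult_ac)
        also have "T (\<lambda>z. complex_of_real (\<rho> z * u z)) = (\<integral>z. complex_of_real (u z) * k z \<partial>N)"
          using mult.IH b by blast
        finally show "T (\<lambda>z. complex_of_real (\<rho> z * (c * u z))) = (\<integral>z. complex_of_real (c * u z) * k z \<partial>N)"
          by (simp add: mult.assoc)
      qed
    qed
  next
    case (add u v)
    show ?case
    proof (intro impI)
      assume "\<exists>b. \<forall>z\<in>space N. v z + u z \<le> b"
      then obtain b where "\<And>z. z \<in> space N \<Longrightarrow> v z + u z \<le> b" by blast
      then have "u z \<le> b \<and> v z \<le> b" if "z \<in> space N" for z
        using add.hyps(2,4)[of z] that by fastforce
      then have b: "\<forall>z\<in>space N. u z \<le> b" "\<forall>z\<in>space N. v z \<le> b" by auto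
      then have t: "(\<lambda>z. complex_of_real (\<rho> z * u z)) \<in> tame" "(\<lambda>z. complex_of_real (\<rho> z * v z)) \<in> tame"
        using b add.hyps by (auto intro!: tame_real[of _ b] simp del: of_real_mult)
      have i: "integrable N (\<lambda>z. complex_of_real (u z) * k z)" "integrable N (\<lambda>z. complex_of_real (v z) * k z)"
        using b add.hyps by (auto intro!: int[of _ b])
      have Tuv: "T (\<lambda>z. complex_of_real (\<rho> z * u z)) = (\<integral>z. complex_of_real (u z) * k z \<partial>N)"
        "T (\<lambda>z. complex_of_real (\<rho> z * v z)) = (\<integral>z. complex_of_real (v z) * k z \<partial>N)"
        using add.IH b by blast+
      have "T (\<lambda>z. complex_of_real (\<rho> z * (v z + u z))) = T (\<lambda>z. complex_of_real (\<rho> z * v z) + complex_of_real (\<rho> z * u z))"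
        by (simp add: distrib_left)
      also have "\<dots> = (\<integral>z. complex_of_real (v z) * k z \<partial>N) + (\<integral>z. complex_of_real (u z) * k z \<partial>N)"
        using T_add[OF tame_tent_fun[OF t(2)] tame_tent_fun[OF t(1)]] Tuv by simp
      also have "\<dots> = (\<integral>z. complex_of_real (v z + u z) * k z \<partial>N)"
        using i by (simp add: distrib_right)
      finally show "T (\<lambda>z. complex_of_real (\<rho> z * (v z + u z))) = (\<integral>z. complex_of_real (v z + u z) * k z \<partial>N)" .
    qed
  next
    case (seq U)
    note [measurable] = seq.hyps(1)
    have [measurable]: "u \<in> borel_measurable N"
      using seq.hyps(1,4) by (rule borel_measurable_LIMSEQ_real[rotated])
    show ?case
    proof (intro impI)
      assume "\<exists>b. \<forall>z\<in>space N. u z \<le> b"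
      then obtain b where b: "\<And>z. z \<in> space N \<Longrightarrow> u z \<le> b" by blast
      have Uu: "U i z \<le> u z" if "z \<in> space N" for i z
        using seq.hyps(3) seq.hyps(4)[OF that] by (intro incseq_le) (auto simp: incseq_def le_fun_def)
      have Ub: "\<bar>U i z\<bar> \<le> b" if "z \<in> space N" for i z
        using Uu[OF that, of i] b[OF that] seq.hyps(2)[of i z] by auto
      have ub: "\<bar>u z\<bar> \<le> b" if "z \<in> space N" for z
        using Uu[OF that, of 0] b[OF that] seq.hyps(2)[of 0 z] by auto
      have tU: "(\<lambda>z. complex_of_real (\<rho> z * U i z)) \<in> tame" for i
        using Ub by (intro tame_real) auto
      have tu: "(\<lambda>z. complex_of_real (\<rho> z * u z)) \<in> tame"
        using ub by (intro tame_real) auto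
      have TU: "T (\<lambda>z. complex_of_real (\<rho> z * U i z)) = (\<integral>z. complex_of_real (U i z) * k z \<partial>N)" for i
        using seq.IH[of i] Ub[of _ i] by (metis abs_le_D1)
      have "(\<lambda>i. T (\<lambda>z. complex_of_real (\<rho> z * u z) - complex_of_real (\<rho> z * U i z))) \<longlonglongrightarrow> 0"
      proof (rule T_dominated_tendsto_0[OF tame_tent_fun[OF tu]])
        show "cmod (complex_of_real (\<rho> z * u z) - complex_of_real (\<rho> z * U i z)) \<le> cmod (complex_of_real (\<rho> z * u z))"
          if z: "z \<in> space N" for i z
        proof -
          have "complex_of_real (\<rho> z * u z) - complex_of_real (\<rho> z * U i z) = complex_of_real (\<rho> z * (u z - U i z))"
            by (simp add: right_diff_distrib)
          then show ?thesis
            using Uu[OF z, of i] seq.hyps(2)[of i z] \<rho>_pos[OF z]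
            by (simp only: norm_of_real) (auto simp: abs_mult intro!: mult_left_mono)
        qed
        show "(\<lambda>i. complex_of_real (\<rho> z * u z) - complex_of_real (\<rho> z * U i z)) \<longlonglongrightarrow> 0" if z: "z \<in> space N" for z
        proof -
          have "(\<lambda>i. complex_of_real (\<rho> z * u z) - complex_of_real (\<rho> z * U i z)) \<longlonglongrightarrow> complex_of_real (\<rho> z * u z) - complex_of_real (\<rho> z * u z)"
            by (intro tendsto_intros seq.hyps(4) z)
          then show ?thesis by simp
        qed
      qed measurable
      then have "(\<lambda>i. T (\<lambda>z. complex_of_real (\<rho> z * u z)) - (\<integral>z. complex_of_real (U i z) * k z \<partial>N)) \<longlonglongrightarrow> 0"
        by (simp only: T_diff[OF tame_tent_fun[OF tu] tU] TU)
      moreover have "(\<lambda>i. \<integral>z. complex_of_real (U i z) * k z \<partial>N) \<longlonglongrightarrow> (\<integral>z. complex_of_real (u z) * k z \<partial>N)"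
      proof (rule integral_dominated_convergence[where w="\<lambda>z. b * cmod (k z)"])
        show "integrable N (\<lambda>z. b * cmod (k z))" using k by auto
        show "AE z in N. (\<lambda>i. complex_of_real (U i z) * k z) \<longlonglongrightarrow> complex_of_real (u z) * k z"
          by (intro AE_I2 tendsto_intros seq.hyps(4))
        show "AE z in N. cmod (complex_of_real (U i z) * k z) \<le> b * cmod (k z)" for i
          using Ub by (intro AE_I2) (auto simp: norm_mult intro!: mult_right_mono)
      qed measurable
      then have "(\<lambda>i. T (\<lambda>z. complex_of_real (\<rho> z * u z)) - (\<integral>z. complex_of_real (U i z) * k z \<partial>N))
         \<longlonglongrightarrow> T (\<lambda>z. complex_of_real (\<rho> z * u z)) - (\<integral>z. complex_of_real (u z) * k z \<partial>N)"
        by (intro tendsto_diff tendsto_const)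
      ultimately have "T (\<lambda>z. complex_of_real (\<rho> z * u z)) - (\<integral>z. complex_of_real (u z) * k z \<partial>N) = 0"
        using LIMSEQ_unique by blast
      then show "T (\<lambda>z. complex_of_real (\<rho> z * u z)) = (\<integral>z. complex_of_real (u z) * k z \<partial>N)" by simp
    qed
  qed
  have real_rep: "T (\<lambda>z. complex_of_real (\<rho> z * v z)) = (\<integral>z. complex_of_real (v z) * k z \<partial>N)"
    if [measurable]: "v \<in> borel_measurable N" and v: "\<And>z. z \<in> space N \<Longrightarrow> \<bar>v z\<bar> \<le> c" for v c
  proof -
    define a where "a z = max 0 (v z)" for z
    define b where "b z = max 0 (- v z)" for z
    have [measurable]: "a \<in> borel_measurable N" "b \<in> borel_measurable N" unfolding a_def b_def by measurable
    have ab: "v z = a z - b z" "0 \<le> a z" "0 \<le> b z" for z by (auto simp: a_def b_def)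
    have bd: "\<bar>a z\<bar> \<le> c" "\<bar>b z\<bar> \<le> c" if "z \<in> space N" for z using v[OF that] by (auto simp: a_def b_def)
    have t: "(\<lambda>z. complex_of_real (\<rho> z * a z)) \<in> tame" "(\<lambda>z. complex_of_real (\<rho> z * b z)) \<in> tame"
      using bd by (auto intro!: tame_real[of _ c] simp del: of_real_mult)
    have i: "integrable N (\<lambda>z. complex_of_real (a z) * k z)" "integrable N (\<lambda>z. complex_of_real (b z) * k z)"
      using bd by (auto intro!: int[of _ c])
    have "T (\<lambda>z. complex_of_real (\<rho> z * v z)) = T (\<lambda>z. complex_of_real (\<rho> z * a z) - complex_of_real (\<rho> z * b z))"
      by (simp add: ab right_diff_distrib)
    also have "\<dots> = T (\<lambda>z. complex_of_real (\<rho> z * a z)) - T (\<lambda>z. complex_of_real (\<rho> z * b z))"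
      by (rule T_diff[OF tame_tent_fun[OF t(1)] t(2)])
    also have "T (\<lambda>z. complex_of_real (\<rho> z * a z)) = (\<integral>z. complex_of_real (a z) * k z \<partial>N)"
      using bd(1) ab(2) by (intro pos_rep[rule_format]) (auto intro: abs_le_D1)
    also have "T (\<lambda>z. complex_of_real (\<rho> z * b z)) = (\<integral>z. complex_of_real (b z) * k z \<partial>N)"
      using bd(2) ab(3) by (intro pos_rep[rule_format]) (auto intro: abs_le_D1)
    also have "(\<integral>z. complex_of_real (a z) * k z \<partial>N) - (\<integral>z. complex_of_real (b z) * k z \<partial>N) = (\<integral>z. complex_of_real (v z) * k z \<partial>N)"
      using i by (simp add: ab left_diff_distrib)
    finally show ?thesis .
  qed
  show ?thesis
  proof (intro exI[of _ k] conjI ballI k)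
    fix f assume f: "f \<in> tame"
    then have [measurable]: "f \<in> borel_measurable N" by (simp add: tame_def)
    obtain c where c: "\<And>z. z \<in> space N \<Longrightarrow> cmod (f z) \<le> c * \<rho> z" using f by (auto simp: tame_def)
    define s where "s z = f z / complex_of_real (\<rho> z)" for z
    have [measurable]: "s \<in> borel_measurable N" unfolding s_def by measurable
    have s: "cmod (s z) \<le> c" if "z \<in> space N" for z
      using c[OF that] \<rho>_pos[OF that] by (simp add: s_def norm_divide divide_le_eq)
    then have bd: "\<bar>Re (s z)\<bar> \<le> c" "\<bar>Im (s z)\<bar> \<le> c" if "z \<in> space N" for z
      using that abs_Re_le_cmod[of "s z"] abs_Im_le_cmod[of "s z"] by (meson order_trans)+
    have t: "(\<lambda>z. complex_of_real (\<rho> z * Re (s z))) \<in> tame" "(\<lambda>z. complex_of_real (\<rho> z * Im (s z))) \<in> tame"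
      using bd by (auto intro!: tame_real[of _ c] simp del: of_real_mult)
    have i: "integrable N (\<lambda>z. complex_of_real (Re (s z)) * k z)" "integrable N (\<lambda>z. complex_of_real (Im (s z)) * k z)"
      using bd by (auto intro!: int[of _ c])
    have f_eq: "f z = complex_of_real (\<rho> z * Re (s z)) + \<i> * complex_of_real (\<rho> z * Im (s z))" if "z \<in> space N" for z
    proof -
      have "f z = complex_of_real (\<rho> z) * s z" using \<rho>_pos[OF that] by (simp add: s_def)
      also have "\<dots> = complex_of_real (\<rho> z) * (complex_of_real (Re (s z)) + \<i> * complex_of_real (Im (s z)))"
        by (metis complex_eq)
      finally show ?thesis by (simp add: algebra_simps)
    qed
    have "T f = T (\<lambda>z. complex_of_real (\<rho> z * Re (s z)) + \<i> * complex_of_real (\<rho> z * Im (s z)))"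
      using f_eq t by (intro T_cong f tame_add tame_scale) auto
    also have "\<dots> = T (\<lambda>z. complex_of_real (\<rho> z * Re (s z))) + \<i> * T (\<lambda>z. complex_of_real (\<rho> z * Im (s z)))"
      using T_add[OF tame_tent_fun[OF t(1)] tame_tent_fun[OF tame_scale[OF t(2), of \<i>]]] T_scale[OF tame_tent_fun[OF t(2)], of \<i>]
      by simp
    also have "\<dots> = (\<integral>z. complex_of_real (Re (s z)) * k z \<partial>N) + \<i> * (\<integral>z. complex_of_real (Im (s z)) * k z \<partial>N)"
      using bd by (subst (1 2) real_rep[where c=c]) auto
    also have "\<dots> = (\<integral>z. complex_of_real (Re (s z)) * k z + \<i> * (complex_of_real (Im (s z)) * k z) \<partial>N)"
      using i by simp
    also have "\<dots> = (\<integral>z. s z * k z \<partial>N)"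
    proof (intro Bochner_Integration.integral_cong refl)
      fix z
      have "s z * k z = (complex_of_real (Re (s z)) + \<i> * complex_of_real (Im (s z))) * k z" by (metis complex_eq)
      then show "complex_of_real (Re (s z)) * k z + \<i> * (complex_of_real (Im (s z)) * k z) = s z * k z"
        by (simp add: algebra_simps)
    qed
    finally show "T f = (\<integral>z. f z / complex_of_real (\<rho> z) * k z \<partial>N)" by (simp add: s_def)
    show "integrable N (\<lambda>z. f z / complex_of_real (\<rho> z) * k z)"
      using int[of s c] s by (simp add: s_def)
  qed
qed

text \<open>
  The density \<open>k\<close> of \<open>\<nu>\<close> determines \<open>g\<close> through \<open>cnj g = k / (\<rho> \<kappa>)\<close>. The formula holds on tame
  functions, which is what \<open>norm_le_functional\<close> needs to conclude that \<open>g\<close> has finite norm. A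
  general \<open>f\<close> is the limit of its restrictions to the sets where \<open>|f|^q \<le> j h\<close>.
\<close>

theorem representation:
  "\<exists>g\<in>tent_fun p' q'. \<forall>f\<in>tent_fun p q. T f = pairing f g"
proof -
  obtain k where k: "integrable N k"
    and rep: "\<And>f. f \<in> tame \<Longrightarrow> T f = (\<integral>z. f z / complex_of_real (\<rho> z) * k z \<partial>N)"
    and int: "\<And>f. f \<in> tame \<Longrightarrow> integrable N (\<lambda>z. f z / complex_of_real (\<rho> z) * k z)"
    using tame_representation by blast
  have [measurable]: "k \<in> borel_measurable N" using k by simp
  define g where "g z = cnj (k z / complex_of_real (\<rho> z * \<kappa> z))" for z
  have g [measurable]: "g \<in> borel_measurable N" unfolding g_def by measurable
  have gk: "f z * cnj (g z) * complex_of_real (\<kappa> z) = f z / complex_of_real (\<rho> z) * k z" if "z \<in> space N" for f :: "'b \<Rightarrow> complex" and z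
    using \<rho>_pos[OF that] \<kappa>_pos[OF that] by (simp add: g_def)
  have rep': "T f = pairing f g" if "f \<in> tame" for f
    using rep[OF that] gk by (simp add: pairing_def cong: Bochner_Integration.integral_cong)
  have int': "pairable f g" if "f \<in> tame" for f
    using int[OF that] gk by (simp add: pairable_def cong: Bochner_Integration.integrable_cong)
  have tame_h: "f \<in> tame" if "f \<in> borel_measurable N" and c: "\<forall>z\<in>space N. cmod (f z) powr q \<le> c * h z" for f c
  proof (rule tameI[OF that(1), of "\<bar>c\<bar> powr (1 / q)"])
    fix z assume z: "z \<in> space N"
    have "cmod (f z) = (cmod (f z) powr q) powr (1 / q)" using pos by (simp add: powr_powr)
    also have "\<dots> \<le> (\<bar>c\<bar> * h z) powr (1 / q)"
    proof (intro powr_mono2)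
      have "c * h z \<le> \<bar>c\<bar> * h z" using h_pos[OF z] by (intro mult_right_mono) auto
      then show "cmod (f z) powr q \<le> \<bar>c\<bar> * h z" using c z by force
    qed (use pos in auto)
    also have "\<dots> = \<bar>c\<bar> powr (1 / q) * \<rho> z" using h_pos[OF z] by (simp add: \<rho>_def powr_mult)
    finally show "cmod (f z) \<le> \<bar>c\<bar> powr (1 / q) * \<rho> z" .
  qed
  have "\<forall>z\<in>space N. 0 < h z" using h_pos by blast
  from norm_le_functional[OF pq h_measurable this h_int]
  obtain K where norming: "\<forall>g\<in>borel_measurable N. \<forall>L\<ge>0. functional_bound p q h g L \<longrightarrow>
      enn_powr (tent_integral p' q' g) (1 / p') \<le> ennreal (K * L)"
    by blast
  have "functional_bound p q h g \<bar>C\<bar>"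
    unfolding functional_bound_def
  proof (intro ballI impI)
    fix f assume fF: "f \<in> tent_fun p q" and c: "\<exists>c. \<forall>z\<in>space N. cmod (f z) powr q \<le> c * h z"
    have f: "f \<in> tame" using tame_h[of f] fF c by (auto simp: tent_fun_def)
    have "C * tent_norm p q f \<le> \<bar>C\<bar> * tent_norm p q f" by (intro mult_right_mono) auto
    then show "pairable f g \<and> cmod (pairing f g) \<le> \<bar>C\<bar> * tent_norm p q f"
      using T_bound[OF fF] int'[OF f] rep'[OF f] by simp
  qed
  then have "enn_powr (tent_integral p' q' g) (1 / p') \<le> ennreal (K * \<bar>C\<bar>)"
    using norming g by simp
  then have "enn_powr (tent_integral p' q' g) (1 / p') < top"
    by (rule le_less_trans) (rule ennreal_less_top)
  then have gF: "g \<in> tent_fun p' q'" using g by (simp add: tent_fun_def)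
  show ?thesis
  proof (intro bexI[OF _ gF] ballI)
    fix f assume f: "f \<in> tent_fun p q"
    then have [measurable]: "f \<in> borel_measurable N" by (simp add: tent_fun_def)
    define G where "G j = {z \<in> space N. cmod (f z) powr q \<le> real j * h z}" for j
    have [measurable]: "G j \<in> sets N" for j unfolding G_def by measurable
    have ev: "\<forall>\<^sub>F j in sequentially. z \<in> G j" if z: "z \<in> space N" for z
    proof -
      obtain j0 :: nat where "cmod (f z) powr q / h z \<le> real j0" using real_arch_simple by blast
      then have j0: "cmod (f z) powr q \<le> real j0 * h z" using h_pos[OF z] by (simp add: divide_le_eq)
      show ?thesis
      proof (rule eventually_mono[OF eventually_ge_at_top[of j0]])
        fix j assume "j0 \<le> j"
        then have "real j0 * h z \<le> real j * h z" using h_pos[OF z] by (intro mult_right_mono) auto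
        then show "z \<in> G j" using z j0 by (simp add: G_def)
      qed
    qed
    define F1 where "F1 j z = f z * complex_of_real (indicator (G j) z)" for j z
    define F2 where "F2 j z = f z * complex_of_real (indicator (- G j) z)" for j z
    have [measurable]: "F1 j \<in> borel_measurable N" for j unfolding F1_def by measurable
    have F2m [measurable]: "F2 j \<in> borel_measurable N" for j
    proof -
      have "F2 j = (\<lambda>z. f z * (1 - complex_of_real (indicator (G j) z)))" by (auto simp: F2_def fun_eq_iff split: split_indicator)
      then show ?thesis by simp
    qed
    have F1t: "F1 j \<in> tame" for j
      using h_pos by (intro tame_h[of _ "real j"]) (auto simp: F1_def G_def less_imp_le split: split_indicator)
    have F2t: "F2 j \<in> tent_fun p q" for j
      by (rule dominated_in_tent_fun[OF pos(1,2) f F2m]) (auto simp: F2_def split: split_indicator)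
    have "f = (\<lambda>z. F1 j z + F2 j z)" for j by (auto simp: F1_def F2_def fun_eq_iff split: split_indicator)
    then have Tf: "T f = T (F1 j) + T (F2 j)" for j using T_add[OF tame_tent_fun[OF F1t] F2t] by metis
    have "(\<lambda>j. T (F2 j)) \<longlonglongrightarrow> 0"
    proof (rule T_dominated_tendsto_0[OF f F2m])
      show "cmod (F2 j z) \<le> cmod (f z)" for j z by (auto simp: F2_def split: split_indicator)
      show "(\<lambda>j. F2 j z) \<longlonglongrightarrow> 0" if "z \<in> space N" for z
        by (rule tendsto_eventually, rule eventually_mono[OF ev[OF that]]) (simp add: F2_def)
    qed
    then have "(\<lambda>j. T f - T (F2 j)) \<longlonglongrightarrow> T f - 0" by (intro tendsto_diff tendsto_const)
    moreover have "T f - T (F2 j) = T (F1 j)" for j using Tf[of j] by simp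
    ultimately have lim1: "(\<lambda>j. T (F1 j)) \<longlonglongrightarrow> T f" by simp
    have "(\<lambda>j. \<integral>z. F1 j z * cnj (g z) * complex_of_real (\<kappa> z) \<partial>N) \<longlonglongrightarrow> (\<integral>z. f z * cnj (g z) * complex_of_real (\<kappa> z) \<partial>N)"
    proof (rule integral_dominated_convergence[where w="\<lambda>z. cmod (f z * cnj (g z) * complex_of_real (\<kappa> z))"])
      show "integrable N (\<lambda>z. cmod (f z * cnj (g z) * complex_of_real (\<kappa> z)))"
        using pairing_bounded(2)[OF pq f gF] unfolding pairable_def by (rule integrable_norm)
      show "AE z in N. (\<lambda>j. F1 j z * cnj (g z) * complex_of_real (\<kappa> z)) \<longlonglongrightarrow> f z * cnj (g z) * complex_of_real (\<kappa> z)"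
      proof (intro AE_I2)
        fix z assume "z \<in> space N"
        then show "(\<lambda>j. F1 j z * cnj (g z) * complex_of_real (\<kappa> z)) \<longlonglongrightarrow> f z * cnj (g z) * complex_of_real (\<kappa> z)"
          by (intro tendsto_eventually eventually_mono[OF ev]) (auto simp: F1_def)
      qed
      show "AE z in N. cmod (F1 j z * cnj (g z) * complex_of_real (\<kappa> z)) \<le> cmod (f z * cnj (g z) * complex_of_real (\<kappa> z))" for j
        by (intro AE_I2) (auto simp: F1_def split: split_indicator)
    qed measurable
    then have "(\<lambda>j. T (F1 j)) \<longlonglongrightarrow> (\<integral>z. f z * cnj (g z) * complex_of_real (\<kappa> z) \<partial>N)"
      by (simp add: rep'[OF F1t] pairing_def)
    then show "T f = pairing f g"
      unfolding pairing_def using lim1 LIMSEQ_unique by blast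
  qed
qed

end

section \<open>The Hermitian product and linear isometries\<close>

lemma herm_add_left: "herm (x + y) z = herm x z + herm y z"
  by (simp add: herm_def distrib_right sum.distrib)

lemma herm_diff_left: "herm (x - y) z = herm x z - herm y z"
  by (simp add: herm_def left_diff_distrib sum_subtractf)

lemma herm_diff_right: "herm x (y - z) = herm x y - herm x z"
  by (simp add: herm_def right_diff_distrib sum_subtractf)

lemma herm_scale_left: "herm (c *s x) y = c * herm x y"
  by (simp add: herm_def sum_distrib_left mult.assoc)

lemma herm_scale_right: "herm x (c *s y) = cnj c * herm x y"
  by (simp add: herm_def sum_distrib_left mult_ac)

lemma herm_scaleR_left: "herm (r *\<^sub>R x) y = of_real r * herm x y"
  by (simp add: herm_def sum_distrib_left mult.assoc scaleR_conv_of_real[where 'a=complex])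

lemma herm_cnj: "cnj (herm x y) = herm y x"
  by (simp add: herm_def mult.commute)

lemma Re_herm: "Re (herm x y) = inner x y"
  by (simp add: herm_def inner_vec_def inner_complex_def)

lemma herm_self: "herm x x = of_real ((norm x)\<^sup>2)"
proof (rule complex_eqI)
  show "Re (herm x x) = Re (of_real ((norm x)\<^sup>2))" by (simp add: Re_herm power2_norm_eq_inner)
  have "cnj (herm x x) = herm x x" by (rule herm_cnj)
  then show "Im (herm x x) = Im (of_real ((norm x)\<^sup>2))" by (metis Im_complex_of_real complex_cnj_cancel_iff Reals_cnj_iff complex_is_Real_iff)
qed

lemma norm_vector_scale: "norm (c *s x) = cmod c * norm (x :: complex ^ 'n)"
proof -
  have "herm (c *s x) (c *s x) = (c * cnj c) * herm x x"
    by (simp add: herm_scale_left herm_scale_right)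
  also have "\<dots> = of_real ((cmod c * norm x)\<^sup>2)"
    unfolding complex_norm_square[symmetric] by (simp add: herm_self power_mult_distrib)
  finally have "(norm (c *s x))\<^sup>2 = (cmod c * norm x)\<^sup>2"
    unfolding herm_self of_real_eq_iff .
  then show ?thesis by (simp add: power2_eq_iff_nonneg)
qed

lemma herm_Cauchy_Schwarz: "cmod (herm x y) \<le> norm x * norm y"
proof -
  have "cmod (herm x y) \<le> (\<Sum>i\<in>UNIV. \<bar>cmod (x $ i)\<bar> * \<bar>cmod (y $ i)\<bar>)"
    unfolding herm_def by (rule order_trans[OF norm_sum]) (simp add: norm_mult)
  also have "\<dots> \<le> norm x * norm y"
    unfolding norm_vec_def by (rule L2_set_mult_ineq)
  finally show ?thesis .
qed

lemma continuous_on_herm [continuous_intros]: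
  assumes "continuous_on S f" "continuous_on S g"
  shows "continuous_on S (\<lambda>x. herm (f x) (g x))"
  unfolding herm_def using assms by (intro continuous_intros)

text \<open>
  The square root of this function is a metric on the sphere; the weaker \<open>pdist_triangle\<close> is
  sufficient for covering arguments.
\<close>

definition pdist :: "complex ^ 'n \<Rightarrow> complex ^ 'n \<Rightarrow> real" where
  "pdist x y = cmod (1 - herm x y)"

lemma pdist_commute: "pdist x y = pdist y x"
proof -
  have "1 - herm y x = cnj (1 - herm x y)" by (simp add: herm_cnj)
  then show ?thesis unfolding pdist_def by (metis complex_mod_cnj)
qed

lemma norm_diff_pdist:
  assumes "norm x \<le> 1" "norm y \<le> 1"
  shows "(norm (x - y))\<^sup>2 \<le> 2 * pdist x y"
proof -
  have "(norm (x - y))\<^sup>2 = (norm x)\<^sup>2 + (norm y)\<^sup>2 - 2 * inner x y"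
    by (simp add: power2_norm_eq_inner inner_diff_left inner_diff_right inner_commute)
  moreover have "(norm x)\<^sup>2 \<le> 1" "(norm y)\<^sup>2 \<le> 1"
    using assms by (auto simp: power_le_one)
  moreover have "1 - inner x y \<le> pdist x y"
    using complex_Re_le_cmod[of "1 - herm x y"] by (simp add: pdist_def Re_herm)
  ultimately show ?thesis by linarith
qed

text \<open>
  In
  \<open>1 - herm x z = (1 - herm x y) + herm (x - y) (y - z) + (1 - herm y z)\<close>
  the middle term is at most \<open>|x - y| |y - z|\<close>, and \<open>|x - y|\<^sup>2 \<le> 2 pdist x y\<close>.
\<close>

lemma pdist_triangle:
  assumes "norm x = 1" "norm y = 1" "norm z = 1"
  shows "pdist x z \<le> 2 * (pdist x y + pdist y z)"
proof -
  have "1 - herm x z = (1 - herm x y) + herm (x - y) (y - z) + (1 - herm y z)"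
    using assms by (simp add: herm_diff_left herm_diff_right herm_self)
  then have "pdist x z \<le> pdist x y + cmod (herm (x - y) (y - z)) + pdist y z"
    unfolding pdist_def by (metis norm_triangle_ineq norm_triangle_mono order_refl)
  moreover have "cmod (herm (x - y) (y - z)) \<le> pdist x y + pdist y z"
  proof -
    have "cmod (herm (x - y) (y - z)) \<le> norm (x - y) * norm (y - z)" by (rule herm_Cauchy_Schwarz)
    moreover have "2 * (norm (x - y) * norm (y - z)) \<le> (norm (x - y))\<^sup>2 + (norm (y - z))\<^sup>2"
      using sum_squares_bound[of "norm (x - y)" "norm (y - z)"] by simp
    ultimately show ?thesis
      using norm_diff_pdist[of x y] norm_diff_pdist[of y z] assms by simp
  qed
  ultimately show ?thesis by simp
qed

lemma nn_integral_lborel_shift: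
  fixes f :: "'a::euclidean_space \<Rightarrow> ennreal"
  assumes [measurable]: "f \<in> borel_measurable borel"
  shows "(\<integral>\<^sup>+x. f (c + x) \<partial>lborel) = (\<integral>\<^sup>+x. f x \<partial>lborel)"
proof -
  have "(\<integral>\<^sup>+x. f x \<partial>lborel) = (\<integral>\<^sup>+x. f x \<partial>distr lborel borel ((+) c))"
    by (simp add: lborel_distr_plus)
  also have "\<dots> = (\<integral>\<^sup>+x. f (c + x) \<partial>lborel)"
    by (rule nn_integral_distr) auto
  finally show ?thesis by simp
qed

text \<open>
  An instance of the uniqueness of translation-invariant measures. Integrate
  \<open>indicator B y * indicator A (U x + y)\<close>, where \<open>B\<close> is the unit ball, over both
  variables. Translation in \<open>x\<close> gives the measure of the preimage of \<open>A\<close> times that of \<open>B\<close>;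
  exchanging the integrals and translating in \<open>y\<close> gives the measure of \<open>A\<close> times that of \<open>B\<close>, as \<open>U\<close>
  preserves \<open>B\<close>.
\<close>

lemma emeasure_lborel_isometric_involution:
  fixes U :: "'a::euclidean_space \<Rightarrow> 'a"
  assumes lin: "linear U" and inv: "\<And>x. U (U x) = x" and iso: "\<And>x. norm (U x) = norm x"
    and A [measurable]: "A \<in> sets borel"
  shows "emeasure lborel (U -` A) = emeasure lborel A"
proof -
  have [measurable]: "U \<in> borel_measurable borel"
    using lin by (intro borel_measurable_continuous_onI linear_continuous_on linear_linear[THEN iffD2]) 
  have [measurable]: "ball (0 :: 'a) 1 \<in> sets borel" by simp
  define b where "b = emeasure lborel (ball 0 1 :: 'a set)"
  have Uadd: "U (x + y) = U x + U y" "U (x - y) = U x - U y" for x y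
    using lin by (simp_all add: linear_add linear_diff)
  have "emeasure lborel (U -` A) * b
      = (\<integral>\<^sup>+y. indicator (ball (0 :: 'a) 1) y * (\<integral>\<^sup>+x. indicator A (U x) \<partial>lborel) \<partial>lborel)"
  proof -
    have "(\<integral>\<^sup>+x. indicator A (U x) \<partial>lborel) = (\<integral>\<^sup>+x. indicator (U -` A) x \<partial>lborel)"
      by (intro nn_integral_cong) (auto split: split_indicator)
    also have "\<dots> = emeasure lborel (U -` A)"
      by (intro nn_integral_indicator) (use measurable_sets[of U borel borel A] in simp)
    moreover have "(\<integral>\<^sup>+y. indicator (ball (0 :: 'a) 1) y * emeasure lborel (U -` A) \<partial>lborel) = b * emeasure lborel (U -` A)"
      unfolding b_def by (subst nn_integral_multc) (auto intro!: borel_measurable_indicator)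
    ultimately show ?thesis by (simp add: mult.commute)
  qed
  also have "\<dots> = (\<integral>\<^sup>+y. (\<integral>\<^sup>+x. indicator (ball 0 1) y * indicator A (U x + y) \<partial>lborel) \<partial>lborel)"
  proof (rule nn_integral_cong)
    fix y
    have "(\<integral>\<^sup>+x. indicator A (U x) \<partial>lborel) = (\<integral>\<^sup>+x. (indicator A (U (U y + x)) :: ennreal) \<partial>lborel)"
      by (rule nn_integral_lborel_shift[symmetric]) measurable
    then show "indicator (ball 0 1) y * (\<integral>\<^sup>+x. indicator A (U x) \<partial>lborel)
       = (\<integral>\<^sup>+x. indicator (ball 0 1) y * indicator A (U x + y) \<partial>lborel)"
      by (simp add: nn_integral_cmult Uadd inv add.commute)
  qed
  also have "\<dots> = (\<integral>\<^sup>+x. (\<integral>\<^sup>+y. indicator (ball 0 1) y * indicator A (U x + y) \<partial>lborel) \<partial>lborel)"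
    by (rule lborel_pair.Fubini') measurable
  also have "\<dots> = (\<integral>\<^sup>+x. (\<integral>\<^sup>+y. indicator (ball 0 1) (y - U x) * indicator A y \<partial>lborel) \<partial>lborel)"
  proof (rule nn_integral_cong)
    fix x
    have "(\<integral>\<^sup>+y. (\<lambda>y. indicator (ball 0 1) (y - U x) * (indicator A y :: ennreal)) (U x + y) \<partial>lborel)
      = (\<integral>\<^sup>+y. indicator (ball 0 1) (y - U x) * indicator A y \<partial>lborel)"
      by (rule nn_integral_lborel_shift) measurable
    then show "(\<integral>\<^sup>+y. indicator (ball 0 1) y * indicator A (U x + y) \<partial>lborel)
       = (\<integral>\<^sup>+y. indicator (ball 0 1) (y - U x) * (indicator A y :: ennreal) \<partial>lborel)" by simp
  qed
  also have "\<dots> = (\<integral>\<^sup>+y. (\<integral>\<^sup>+x. indicator (ball 0 1) (y - U x) * indicator A y \<partial>lborel) \<partial>lborel)"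
    by (rule lborel_pair.Fubini'[symmetric]) measurable
  also have "\<dots> = (\<integral>\<^sup>+y. b * indicator A y \<partial>lborel)"
  proof (rule nn_integral_cong)
    fix y
    have "norm (y - U x) = norm (- U y + x)" for x
    proof -
      have "norm (y - U x) = norm (U (y - U x))" by (simp add: iso)
      also have "\<dots> = norm (U y - x)" by (simp add: Uadd inv)
      finally show ?thesis by (simp add: norm_minus_commute)
    qed
    then have "(indicator (ball 0 1) (y - U x) :: ennreal) = indicator (ball 0 1) (- U y + x)" for x
      by (auto split: split_indicator)
    then have "(\<integral>\<^sup>+x. indicator (ball 0 1) (y - U x) \<partial>lborel) = (\<integral>\<^sup>+x. indicator (ball 0 1) (- U y + x) \<partial>lborel)"
      by simp
    also have "\<dots> = b"
      unfolding b_def by (subst nn_integral_lborel_shift) auto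
    finally show "(\<integral>\<^sup>+x. indicator (ball 0 1) (y - U x) * indicator A y \<partial>lborel) = b * indicator A y"
      by (simp add: nn_integral_multc)
  qed
  also have "\<dots> = emeasure lborel A * b"
    by (simp add: nn_integral_cmult mult.commute)
  finally have eq: "b * emeasure lborel (U -` A) = b * emeasure lborel A" by (simp add: mult.commute)
  have "b \<noteq> 0" unfolding b_def by (simp add: emeasure_ball unit_ball_vol_pos less_imp_neq[symmetric])
  moreover have "b \<noteq> top" using emeasure_lborel_ball_finite[of "0 :: 'a" 1] by (simp add: b_def less_top)
  ultimately show ?thesis using eq ennreal_mult_cancel_left by blast
qed

text \<open>
  The complex Householder reflection that exchanges \<open>e\<close> and \<open>f = c \<zeta>\<close>, where the phase \<open>c\<close> is
  chosen such that \<open>herm e f\<close> is real; otherwise the reflection along \<open>e - f\<close> would not map \<open>e\<close>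
  to \<open>f\<close>.
\<close>

lemma unitary_involution_exists:
  fixes e \<zeta> :: "complex ^ 'n"
  assumes "norm e = 1" "norm \<zeta> = 1"
  shows "\<exists>U. linear U \<and> (\<forall>x. U (U x) = x) \<and> (\<forall>x. norm (U x) = norm x) \<and> (\<forall>x. cmod (herm (U x) \<zeta>) = cmod (herm x e))"
proof -
  define c where "c = (if herm e \<zeta> = 0 then 1 else sgn (herm e \<zeta>))"
  have c: "cmod c = 1" by (simp add: c_def norm_sgn)
  define f where "f = c *s \<zeta>"
  have nf: "norm f = 1" using c assms by (simp add: f_def norm_vector_scale)
  have ef: "herm e f = of_real (cmod (herm e \<zeta>))"
  proof (cases "herm e \<zeta> = 0")
    case False
    have "cnj (sgn (herm e \<zeta>)) * herm e \<zeta> = (herm e \<zeta> * cnj (herm e \<zeta>)) / of_real (cmod (herm e \<zeta>))"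
      by (simp add: sgn_div_norm scaleR_conv_of_real divide_inverse mult_ac)
    also have "\<dots> = of_real (cmod (herm e \<zeta>))"
      using False by (simp add: complex_norm_square[symmetric] power2_eq_square)
    finally show ?thesis using False by (simp add: f_def c_def herm_scale_right)
  qed (simp add: f_def herm_scale_right)
  have f_herm: "cmod (herm x f) = cmod (herm x \<zeta>)" for x
    using c by (simp add: f_def herm_scale_right norm_mult)
  define u where "u = e - f"
  show ?thesis
  proof (cases "u = 0")
    case True
    then have "e = f" by (simp add: u_def)
    then show ?thesis using f_herm by (intro exI[of _ "\<lambda>x. x"]) (auto simp: linear_iff)
  next
    case False
    define N where "N = herm u u"
    have N: "N \<noteq> 0" "cnj N = N" using False by (auto simp: N_def herm_self)
    define U where "U x = x - (2 * herm x u / N) *s u" for x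
    have herm_U: "herm (U x) (U y) = herm x y" for x y
    proof -
      have "herm (U x) (U y) = herm x y - cnj (2 * herm y u / N) * herm x u
         - (2 * herm x u / N) * herm u y + (2 * herm x u / N) * cnj (2 * herm y u / N) * N"
        by (simp add: U_def herm_diff_left herm_diff_right herm_scale_left herm_scale_right N_def algebra_simps)
      also have "\<dots> = herm x y"
        using N by (simp add: herm_cnj field_simps)
      finally show ?thesis .
    qed
    have "norm (U x) = norm x" for x
      using herm_U[of x x] unfolding herm_self of_real_eq_iff by (simp add: power2_eq_iff_nonneg)
    moreover have "linear U"
    proof (rule linearI)
      show "U (x + y) = U x + U y" for x y
        by (simp add: U_def herm_add_left distrib_left add_divide_distrib vec_eq_iff algebra_simps)
      show "U (r *\<^sub>R x) = r *\<^sub>R U x" for r x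
        by (simp add: U_def herm_scaleR_left vec_eq_iff scaleR_conv_of_real[where 'a=complex] algebra_simps)
    qed
    moreover have "U (U x) = x" for x
    proof -
      have "herm (U x) u = - herm x u"
        using N(1) by (simp add: U_def herm_diff_left herm_scale_left N_def[symmetric])
      then show ?thesis unfolding U_def[of "U x"] by (simp add: U_def vec_eq_iff)
    qed
    moreover have "U e = f"
    proof -
      have "herm f e = herm e f" using herm_cnj[of e f] ef by simp
      moreover have "N = herm e u - herm f u" by (simp only: N_def u_def herm_diff_left)
      moreover have "herm e u = 1 - herm e f" "herm f u = herm f e - 1"
        by (simp_all add: u_def herm_diff_right herm_self assms nf)
      ultimately have "N = 2 * herm e u" by simp
      then have "2 * herm e u / N = 1" using N(1) by simp
      then show ?thesis by (simp add: U_def) (simp add: u_def)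
    qed
    then have "cmod (herm (U x) \<zeta>) = cmod (herm x e)" for x
      using f_herm[of "U x"] herm_U[of x e] by simp
    ultimately show ?thesis by blast
  qed
qed

section \<open>Surface measure of nonisotropic balls\<close>

text \<open>
  The model of a nonisotropic ball of radius \<open>r\<close> thickened by \<open>r\<close> in the radial direction: its
  extent is \<open>r\<close> in the complex direction of \<open>\<zeta>\<close> and \<open>sqrt r\<close> in the orthogonal directions.
\<close>

definition slab :: "complex ^ 'n \<Rightarrow> real \<Rightarrow> (complex ^ 'n) set" where
  "slab \<zeta> r = {v. cmod (herm v \<zeta>) < r \<and> (norm v)\<^sup>2 < r}"

lemma slab_open: "open (slab \<zeta> r)"
  unfolding slab_def by (intro open_Collect_conj open_Collect_less continuous_intros)

lemma slab_borel [measurable]: "slab \<zeta> r \<in> sets borel"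
  by (simp add: slab_open)

lemma herm_axis: "herm v (axis k 1) = v $ k"
proof -
  have "herm v (axis k 1) = (\<Sum>i\<in>UNIV. if i = k then v $ k else 0)"
    unfolding herm_def by (intro sum.cong) (auto simp: axis_def)
  then show ?thesis by simp
qed

lemma norm_axis_one: "norm (axis k 1 :: complex ^ 'n) = 1"
proof -
  have "(norm (axis k 1 :: complex ^ 'n))\<^sup>2 = 1"
    using herm_axis[of "axis k 1 :: complex ^ 'n" k] unfolding herm_self by (simp add: axis_def flip: of_real_power)
  then show ?thesis by (simp add: power2_eq_1_iff)
qed

definition aniso_box :: "'n \<Rightarrow> real \<Rightarrow> real \<Rightarrow> (complex ^ 'n) set" where
  "aniso_box k s r = {v. \<forall>i. \<bar>Re (v $ i)\<bar> < s * (if i = k then r else sqrt r) \<and> \<bar>Im (v $ i)\<bar> < s * (if i = k then r else sqrt r)}"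

text \<open>
  Two of the real coordinates have side \<open>2 s r\<close> and the other \<open>2 n - 2\<close> have side
  \<open>2 s sqrt r\<close>.
\<close>

lemma emeasure_aniso_box:
  assumes "0 \<le> s" "0 \<le> r"
  shows "emeasure lborel (aniso_box k s r :: (complex ^ 'n) set) = ennreal ((2 * s) ^ (2 * CARD('n)) * r ^ (CARD('n) + 1))"
proof -
  define side where "side i = s * (if i = k then r else sqrt r)" for i :: 'n
  have side: "0 \<le> side i" for i using assms by (simp add: side_def)
  define u where "u = (\<chi> i. Complex (side i) (side i))"
  have mem: "v \<in> aniso_box k s r \<longleftrightarrow> v \<in> box (- u) u" for v :: "complex ^ 'n"
  proof -
    have ab: "\<bar>x\<bar> < e \<longleftrightarrow> - e < x \<and> x < e" for x e :: real by auto
    have "v \<in> box (- u) u \<longleftrightarrow> (\<forall>i. (- side i < Re (v $ i) \<and> Re (v $ i) < side i) \<and> (- side i < Im (v $ i) \<and> Im (v $ i) < side i))"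
      by (auto simp: mem_box Basis_vec_def inner_axis u_def Basis_complex_def)
    then show ?thesis
      by (simp add: aniso_box_def side_def[symmetric] ab)
  qed
  then have "emeasure lborel (aniso_box k s r :: (complex ^ 'n) set) = emeasure lborel (box (- u) u)"
    by (intro arg_cong[where f="emeasure lborel"] set_eqI) simp
  also have "\<dots> = ennreal (\<Prod>b\<in>Basis. (u - - u) \<bullet> b)"
  proof (rule emeasure_lborel_box)
    show "- u \<bullet> b \<le> u \<bullet> b" if "b \<in> Basis" for b
      using that side by (auto simp: Basis_vec_def inner_axis u_def Basis_complex_def)
  qed
  also have "(\<Prod>b\<in>Basis. (u - - u) \<bullet> b) = (\<Prod>i\<in>UNIV. (2 * side i)\<^sup>2)"
  proof -
    have "(\<Prod>b\<in>(Basis :: (complex ^ 'n) set). (u - - u) \<bullet> b) = (\<Prod>(i, b)\<in>UNIV \<times> Basis. (u - - u) \<bullet> axis i b)"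
    proof -
      have "bij_betw (\<lambda>(i :: 'n, b :: complex). axis i b) (UNIV \<times> Basis) Basis"
        unfolding bij_betw_def
      proof
        show "inj_on (\<lambda>(i :: 'n, b :: complex). axis i b) (UNIV \<times> Basis)"
          by (auto simp: inj_on_def axis_eq_axis Basis_complex_def)
        show "(\<lambda>(i :: 'n, b :: complex). axis i b) ` (UNIV \<times> Basis) = Basis"
          by (auto simp: Basis_vec_def)
      qed
      from prod.reindex_bij_betw[OF this, of "\<lambda>b. (u - - u) \<bullet> b", symmetric]
      show ?thesis by (simp add: case_prod_beta)
    qed
    also have "\<dots> = (\<Prod>i\<in>UNIV. \<Prod>b\<in>Basis. (u - - u) \<bullet> axis i b)"
      by (rule prod.cartesian_product[symmetric])
    also have "\<dots> = (\<Prod>i\<in>UNIV. (2 * side i)\<^sup>2)"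
      by (intro prod.cong refl) (simp add: inner_axis u_def Basis_complex_def power2_eq_square)
    finally show ?thesis .
  qed
  also have "\<dots> = (2 * side k)\<^sup>2 * (\<Prod>i\<in>UNIV - {k}. (2 * side i)\<^sup>2)"
    by (subst prod.remove[of UNIV k]) auto
  also have "(\<Prod>i\<in>UNIV - {k}. (2 * side i)\<^sup>2) = (\<Prod>i\<in>UNIV - {k}. (2 * s)\<^sup>2 * r)"
    using assms by (intro prod.cong) (auto simp: side_def power_mult_distrib)
  also have "\<dots> = ((2 * s)\<^sup>2 * r) ^ (CARD('n) - 1)"
    by (simp add: card_Diff_singleton)
  also have "(2 * side k)\<^sup>2 * ((2 * s)\<^sup>2 * r) ^ (CARD('n) - 1) = ((2 * s)\<^sup>2 * r) ^ (CARD('n)) * r"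
  proof -
    have "(2 * side k)\<^sup>2 = ((2 * s)\<^sup>2 * r) * r" by (simp add: side_def power2_eq_square)
    moreover have "((2 * s)\<^sup>2 * r) ^ CARD('n) = ((2 * s)\<^sup>2 * r) * ((2 * s)\<^sup>2 * r) ^ (CARD('n) - 1)"
      by (metis One_nat_def card_gt_0_iff finite_class.finite_UNIV UNIV_not_empty power_eq_if less_numeral_extra(3))
    ultimately show ?thesis by simp
  qed
  also have "\<dots> = (2 * s) ^ (2 * CARD('n)) * r ^ (CARD('n) + 1)"
    by (simp add: power_mult_distrib power_mult)
  finally show ?thesis .
qed

text \<open>
  Reduces the volume of a slab to that of a slab along a coordinate axis, which can be
  compared with boxes.
\<close>

lemma emeasure_slab_indep:
  fixes e \<zeta> :: "complex ^ 'n"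
  assumes "norm e = 1" "norm \<zeta> = 1"
  shows "emeasure lborel (slab \<zeta> r) = emeasure lborel (slab e r)"
proof -
  obtain U where U: "linear U" "\<And>x. U (U x) = x" "\<And>x. norm (U x) = norm x" "\<And>x. cmod (herm (U x) \<zeta>) = cmod (herm x e)"
    using unitary_involution_exists[OF assms] by blast
  have "U -` slab \<zeta> r = slab e r" by (auto simp: slab_def U)
  then show ?thesis using emeasure_lborel_isometric_involution[OF U(1-3) slab_borel, of \<zeta> r] by simp
qed

lemma emeasure_slab_upper:
  fixes \<zeta> :: "complex ^ 'n"
  assumes "norm \<zeta> = 1" "0 \<le> r"
  shows "emeasure lborel (slab \<zeta> r) \<le> ennreal (4 ^ CARD('n) * r ^ (CARD('n) + 1))"
proof -
  obtain k :: 'n where True by blast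
  have "slab (axis k 1) r \<subseteq> aniso_box k 1 r"
  proof
    fix v :: "complex ^ 'n" assume v: "v \<in> slab (axis k 1) r"
    then have k: "cmod (v $ k) < r" and n: "(norm v)\<^sup>2 < r" by (auto simp: slab_def herm_axis)
    have "cmod (v $ i) < (if i = k then r else sqrt r)" for i
    proof -
      have "cmod (v $ i) \<le> norm v" by (rule Finite_Cartesian_Product.norm_nth_le)
      moreover have "norm v < sqrt r" using n by (rule real_less_rsqrt)
      ultimately show ?thesis using k by auto
    qed
    then have "\<bar>Re (v $ i)\<bar> < (if i = k then r else sqrt r)" "\<bar>Im (v $ i)\<bar> < (if i = k then r else sqrt r)" for i
      using abs_Re_le_cmod[of "v $ i"] abs_Im_le_cmod[of "v $ i"] le_less_trans by blast+
    then show "v \<in> aniso_box k 1 r" unfolding aniso_box_def by simp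
  qed
  then have "emeasure lborel (slab (axis k 1) r) \<le> emeasure lborel (aniso_box k 1 r)"
  proof (rule emeasure_mono)
    have "aniso_box k 1 r = (\<Inter>i. {v. \<bar>Re (v $ i)\<bar> < 1 * (if i = k then r else sqrt r) \<and> \<bar>Im (v $ i)\<bar> < 1 * (if i = k then r else sqrt r)})"
      unfolding aniso_box_def by (rule Collect_all_eq)
    moreover have "open \<dots>"
      by (intro open_INT finite ballI open_Collect_conj open_Collect_less continuous_intros)
    ultimately show "aniso_box k 1 r \<in> sets lborel" by simp
  qed
  also have "\<dots> = ennreal (4 ^ CARD('n) * r ^ (CARD('n) + 1))"
    using assms by (simp add: emeasure_aniso_box power_mult)
  finally show ?thesis
    using emeasure_slab_indep[of "axis k 1" \<zeta> r] assms by (simp add: norm_axis_one)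
qed

lemma emeasure_slab_lower:
  fixes \<zeta> :: "complex ^ 'n"
  assumes "norm \<zeta> = 1" "0 < r" "r \<le> 1"
  shows "ennreal ((1 / real CARD('n)) ^ (2 * CARD('n)) * r ^ (CARD('n) + 1)) \<le> emeasure lborel (slab \<zeta> r)"
proof -
  obtain k :: 'n where True by blast
  define n where "n = real CARD('n)"
  have n: "1 \<le> n" unfolding n_def by (simp add: Suc_leI)
  have rs: "r \<le> sqrt r" using assms by (simp add: real_le_rsqrt power2_eq_square mult_left_le_one_le)
  have "aniso_box k (1 / (2 * n)) r \<subseteq> slab (axis k 1) r"
  proof
    fix v :: "complex ^ 'n" assume v: "v \<in> aniso_box k (1 / (2 * n)) r"
    have comp: "\<bar>Re (v $ i)\<bar> < 1 / (2 * n) * sqrt r" "\<bar>Im (v $ i)\<bar> < 1 / (2 * n) * sqrt r" for i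
    proof -
      have "1 / (2 * n) * (if i = k then r else sqrt r) \<le> 1 / (2 * n) * sqrt r"
        using rs n by (intro mult_left_mono) auto
      then show "\<bar>Re (v $ i)\<bar> < 1 / (2 * n) * sqrt r" "\<bar>Im (v $ i)\<bar> < 1 / (2 * n) * sqrt r"
        using v unfolding aniso_box_def by (auto intro: less_le_trans)
    qed
    have "cmod (v $ k) \<le> \<bar>Re (v $ k)\<bar> + \<bar>Im (v $ k)\<bar>" by (rule cmod_le)
    also have "\<dots> < 1 / (2 * n) * r + 1 / (2 * n) * r"
      using v unfolding aniso_box_def by (intro add_strict_mono) (auto dest: spec[of _ k])
    also have "\<dots> = r / n" by (simp add: field_simps)
    also have "\<dots> \<le> r" using n assms by (simp add: divide_le_eq mult_left_le)
    finally have 1: "cmod (v $ k) < r" .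
    have "(norm v)\<^sup>2 = (\<Sum>i\<in>UNIV. (cmod (v $ i))\<^sup>2)"
      by (simp add: norm_vec_def L2_set_def sum_nonneg)
    also have "\<dots> \<le> (\<Sum>i\<in>(UNIV :: 'n set). r / (2 * n\<^sup>2))"
    proof (rule sum_mono)
      fix i
      have "0 \<le> 1 / (2 * n) * sqrt r" using n assms by simp
      then have "(Re (v $ i))\<^sup>2 \<le> (1 / (2 * n) * sqrt r)\<^sup>2" "(Im (v $ i))\<^sup>2 \<le> (1 / (2 * n) * sqrt r)\<^sup>2"
        using comp[of i] by (simp_all only: power2_le_iff_abs_le less_imp_le)
      then have "(cmod (v $ i))\<^sup>2 \<le> 2 * (1 / (2 * n) * sqrt r)\<^sup>2" by (simp add: cmod_power2)
      also have "\<dots> = r / (2 * n\<^sup>2)" using assms by (simp add: power_mult_distrib power_divide)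
      finally show "(cmod (v $ i))\<^sup>2 \<le> r / (2 * n\<^sup>2)" .
    qed
    also have "\<dots> = r / (2 * n)" using n by (simp add: n_def[symmetric] power2_eq_square)
    also have "\<dots> < r" using n assms by (simp add: divide_less_eq)
    finally show "v \<in> slab (axis k 1) r" using 1 by (simp add: slab_def herm_axis)
  qed
  then have "emeasure lborel (aniso_box k (1 / (2 * n)) r) \<le> emeasure lborel (slab (axis k 1) r)"
    by (rule emeasure_mono) simp
  moreover have "emeasure lborel (aniso_box k (1 / (2 * n)) r) = ennreal ((1 / n) ^ (2 * CARD('n)) * r ^ (CARD('n) + 1))"
    using assms n by (subst emeasure_aniso_box) auto
  ultimately show ?thesis
    using emeasure_slab_indep[of "axis k 1" \<zeta> r] assms by (simp add: norm_axis_one n_def)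
qed

definition sector :: "complex ^ 'n \<Rightarrow> real \<Rightarrow> (complex ^ 'n) set" where
  "sector \<zeta> r = {x \<in> ball 0 1. sgn x \<in> noniso_ball \<zeta> r}"

lemma noniso_ball_subset: "noniso_ball \<zeta> r \<subseteq> sphere 0 1"
  by (auto simp: noniso_ball_def)

lemma noniso_ball_borel [measurable]: "noniso_ball \<zeta> r \<in> sets borel"
proof -
  have "noniso_ball \<zeta> r = sphere 0 1 \<inter> {\<eta>. cmod (1 - herm \<zeta> \<eta>) < r}" by (auto simp: noniso_ball_def)
  moreover have "open {\<eta>. cmod (1 - herm \<zeta> \<eta>) < r}"
    by (intro open_Collect_less continuous_intros)
  ultimately show ?thesis by (simp add: borel_closed)
qed

lemma sgn_measurable_vec [measurable]: "(sgn :: complex ^ 'n \<Rightarrow> _) \<in> borel_measurable borel"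
  unfolding sgn_div_norm by measurable

lemma sector_borel [measurable]: "sector \<zeta> r \<in> sets borel"
proof -
  have "sector \<zeta> r = ball 0 1 \<inter> (sgn -` noniso_ball \<zeta> r)" by (auto simp: sector_def)
  moreover have "sgn -` noniso_ball \<zeta> r \<in> sets borel"
    using measurable_sets[OF sgn_measurable_vec noniso_ball_borel] by simp
  ultimately show ?thesis by simp
qed

lemma sector_finite: "emeasure lborel (sector \<zeta> r) < top" for \<zeta> :: "complex ^ 'n"
proof -
  have "emeasure lborel (sector \<zeta> r) \<le> emeasure lborel (ball (0 :: complex ^ 'n) 1)"
    by (intro emeasure_mono) (auto simp: sector_def)
  then show ?thesis using emeasure_lborel_ball_finite[of "0 :: complex ^ 'n" 1] by (simp add: less_top le_less_trans)
qed

definition outer_sector :: "complex ^ 'n \<Rightarrow> real \<Rightarrow> (complex ^ 'n) set" where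
  "outer_sector \<zeta> r = {x \<in> sector \<zeta> r. 1 - r \<le> norm x}"

lemma outer_sector_borel [measurable]: "outer_sector \<zeta> r \<in> sets borel"
proof -
  have "outer_sector \<zeta> r = sector \<zeta> r \<inter> {x. 1 - r \<le> norm x}" by (auto simp: outer_sector_def)
  moreover have "closed {x :: complex ^ 'n. 1 - r \<le> norm x}"
    by (intro closed_Collect_le continuous_intros)
  ultimately show ?thesis by (simp add: borel_closed)
qed

text \<open>
  The removed inner part is the whole sector scaled by \<open>1 - r\<close> in a space of real dimension
  \<open>2 n\<close>.
\<close>

lemma measure_outer_sector:
  fixes \<zeta> :: "complex ^ 'n"
  assumes "0 < r" "r \<le> 1"
  shows "measure lborel (outer_sector \<zeta> r) = (1 - (1 - r) ^ (2 * CARD('n))) * measure lborel (sector \<zeta> r)"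
proof (cases "r = 1")
  case True
  then have "outer_sector \<zeta> r = sector \<zeta> r" by (auto simp: outer_sector_def)
  then show ?thesis using True by simp
next
  case False
  define t where "t = 1 - r"
  have t: "0 < t" "t < 1" using assms False by (auto simp: t_def)
  have inner: "sector \<zeta> r - outer_sector \<zeta> r = (\<lambda>x. t *\<^sub>R x) ` sector \<zeta> r"
  proof (intro set_eqI iffI)
    fix x assume x: "x \<in> sector \<zeta> r - outer_sector \<zeta> r"
    then have "norm x < t" by (auto simp: outer_sector_def t_def)
    then have "(1 / t) *\<^sub>R x \<in> sector \<zeta> r"
      using x t by (auto simp: sector_def sgn_scaleR divide_less_eq)
    moreover have "x = t *\<^sub>R ((1 / t) *\<^sub>R x)" using t by simp
    ultimately show "x \<in> (\<lambda>x. t *\<^sub>R x) ` sector \<zeta> r" by blast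
  next
    fix x assume "x \<in> (\<lambda>x. t *\<^sub>R x) ` sector \<zeta> r"
    then obtain y where y: "y \<in> sector \<zeta> r" "x = t *\<^sub>R y" by auto
    then have "norm x < t" using t by (auto simp: sector_def)
    moreover have "x \<in> sector \<zeta> r"
    proof -
      have "norm x < 1" using \<open>norm x < t\<close> t by simp
      moreover have "sgn x = sgn y" using y t by (simp add: sgn_scaleR)
      ultimately show ?thesis using y(1) by (simp add: sector_def)
    qed
    ultimately show "x \<in> sector \<zeta> r - outer_sector \<zeta> r" by (auto simp: outer_sector_def t_def)
  qed
  have fin: "emeasure lborel (sector \<zeta> r) \<noteq> \<infinity>" using sector_finite[of \<zeta> r] by (simp add: less_top)
  have "measure lebesgue (sector \<zeta> r - outer_sector \<zeta> r) = t ^ DIM(complex ^ 'n) * measure lebesgue (sector \<zeta> r)"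
    unfolding inner using t measure_lebesgue_affine[of t 0 "sector \<zeta> r"] by simp
  moreover have "measure lebesgue (sector \<zeta> r - outer_sector \<zeta> r) = measure lborel (sector \<zeta> r - outer_sector \<zeta> r)"
    by (rule measure_completion) measurable
  moreover have "measure lebesgue (sector \<zeta> r) = measure lborel (sector \<zeta> r)"
    by (rule measure_completion) measurable
  moreover have "measure lborel (sector \<zeta> r - outer_sector \<zeta> r) = measure lborel (sector \<zeta> r) - measure lborel (outer_sector \<zeta> r)"
    using fin by (intro measure_Diff) (auto simp: outer_sector_def)
  ultimately show ?thesis by (simp add: t_def algebra_simps)
qed

text \<open>
  A point \<open>z\<close> of norm at least \<open>1 - r\<close> over the ball \<open>B(\<zeta>, r)\<close> satisfies
  \<open>|1 - herm z \<zeta>| < 2 r\<close>, and then \<open>|z - \<zeta>|\<^sup>2 < 4 r\<close>.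
\<close>

lemma outer_sector_subset:
  fixes \<zeta> :: "complex ^ 'n"
  assumes "norm \<zeta> = 1" "0 < r" "r \<le> 1"
  shows "outer_sector \<zeta> r \<subseteq> (\<lambda>v. \<zeta> + v) ` slab \<zeta> (4 * r)"
proof
  fix z assume z: "z \<in> outer_sector \<zeta> r"
  define x where "x = sgn z"
  have x: "norm x = 1" "cmod (1 - herm \<zeta> x) < r" and n: "norm z < 1" "1 - r \<le> norm z"
    using z by (auto simp: outer_sector_def sector_def noniso_ball_def x_def)
  have z0: "z \<noteq> 0" using x(1) by (auto simp: x_def)
  have zx: "z = norm z *\<^sub>R x" using z0 by (simp add: x_def sgn_div_norm)
  have d: "pdist z \<zeta> < 2 * r"
  proof -
    have "1 - herm z \<zeta> = of_real (1 - norm z) + of_real (norm z) * (1 - herm x \<zeta>)"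
      by (subst zx) (simp add: herm_scaleR_left algebra_simps)
    then have "pdist z \<zeta> \<le> cmod (of_real (1 - norm z)) + cmod (of_real (norm z) * (1 - herm x \<zeta>))"
      unfolding pdist_def by (metis norm_triangle_ineq)
    also have "\<dots> = (1 - norm z) + norm z * pdist x \<zeta>"
      using n unfolding norm_of_real norm_mult pdist_def by simp
    also have "\<dots> < r + 1 * r"
    proof -
      have "pdist x \<zeta> < r" using x(2) pdist_commute[of x \<zeta>] by (simp add: pdist_def)
      moreover have "norm z * pdist x \<zeta> \<le> 1 * pdist x \<zeta>"
        using n by (intro mult_right_mono) (auto simp: pdist_def)
      ultimately show ?thesis using n by linarith
    qed
    finally show ?thesis by simp
  qed
  have "cmod (herm (z - \<zeta>) \<zeta>) = pdist z \<zeta>"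
    using assms by (simp add: herm_diff_left herm_self pdist_def norm_minus_commute)
  moreover have "(norm (z - \<zeta>))\<^sup>2 \<le> 2 * pdist z \<zeta>"
    using n assms by (intro norm_diff_pdist) auto
  ultimately have "z - \<zeta> \<in> slab \<zeta> (4 * r)" using d assms by (simp add: slab_def)
  then show "z \<in> (\<lambda>v. \<zeta> + v) ` slab \<zeta> (4 * r)" by (intro image_eqI[of _ _ "z - \<zeta>"]) auto
qed

text \<open>
  The centre is moved to \<open>(1 - r / 4) \<zeta>\<close> because a slab around \<open>\<zeta>\<close> itself would leave the
  unit ball; the factor \<open>1 / 32\<close> is small enough to keep the slab inside the shell of
  thickness \<open>r\<close>.
\<close>

lemma slab_subset_outer_sector:
  fixes \<zeta> :: "complex ^ 'n"
  assumes \<zeta>: "norm \<zeta> = 1" and r: "0 < r" "r \<le> 1"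
  shows "(\<lambda>v. (1 - r / 4) *\<^sub>R \<zeta> + v) ` slab \<zeta> (r / 32) \<subseteq> outer_sector \<zeta> r"
proof safe
  fix v assume v: "v \<in> slab \<zeta> (r / 32)"
  define z where "z = (1 - r / 4) *\<^sub>R \<zeta> + v"
  have v1: "cmod (herm v \<zeta>) < r / 32" and v2: "(norm v)\<^sup>2 < r / 32" using v by (auto simp: slab_def)
  have hz: "herm z \<zeta> = of_real (1 - r / 4) + herm v \<zeta>"
    using \<zeta> by (simp add: z_def herm_add_left herm_scaleR_left herm_self)
  have "(norm z)\<^sup>2 = (1 - r / 4)\<^sup>2 + 2 * (1 - r / 4) * inner v \<zeta> + (norm v)\<^sup>2"
    using \<zeta> unfolding z_def power2_norm_eq_inner
    by (simp add: inner_add_left inner_add_right inner_commute power2_eq_square norm_eq_1 algebra_simps)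
  also have "\<dots> \<le> (1 - r / 4)\<^sup>2 + 2 * 1 * (r / 32) + r / 32"
  proof -
    have "inner v \<zeta> \<le> r / 32" using v1 complex_Re_le_cmod[of "herm v \<zeta>"] by (simp add: Re_herm)
    then have "(1 - r / 4) * inner v \<zeta> \<le> (1 - r / 4) * (r / 32)" using r by (intro mult_left_mono) auto
    also have "\<dots> \<le> 1 * (r / 32)" using r by (intro mult_right_mono) auto
    finally show ?thesis using v2 by linarith
  qed
  also have "\<dots> < 1"
  proof -
    have "r * r \<le> 1 * r" using r by (intro mult_right_mono) auto
    then show ?thesis using r by (simp add: power2_eq_square algebra_simps)
  qed
  finally have nz: "norm z < 1" by (simp add: power_less_one_iff abs_square_less_1)
  have d: "cmod (1 - herm z \<zeta>) < 9 * r / 32"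
  proof -
    have "1 - herm z \<zeta> = of_real (r / 4) - herm v \<zeta>" by (simp add: hz)
    then have "cmod (1 - herm z \<zeta>) \<le> cmod (of_real (r / 4)) + cmod (herm v \<zeta>)"
      by (metis norm_triangle_ineq4)
    then show ?thesis using v1 r unfolding norm_of_real by simp
  qed
  have hle: "cmod (herm z \<zeta>) \<le> norm z" using herm_Cauchy_Schwarz[of z \<zeta>] \<zeta> by simp
  have ge: "1 - 9 * r / 32 < norm z"
    using d hle norm_triangle_ineq2[of 1 "1 - herm z \<zeta>"] by simp
  then have z0: "0 < norm z" using r by linarith
  have "cmod (1 - herm \<zeta> (sgn z)) < r"
  proof -
    have "cmod (1 - herm \<zeta> (sgn z)) = pdist (sgn z) \<zeta>"
      using pdist_commute[of \<zeta> "sgn z"] by (simp add: pdist_def)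
    also have "\<dots> = cmod ((1 - herm z \<zeta>) + herm z \<zeta> * of_real (1 - 1 / norm z))"
      using z0 by (simp add: pdist_def sgn_div_norm herm_scaleR_left algebra_simps divide_inverse)
    also have "\<dots> \<le> cmod (1 - herm z \<zeta>) + cmod (herm z \<zeta>) * \<bar>1 - 1 / norm z\<bar>"
      by (metis norm_triangle_ineq norm_mult norm_of_real)
    also have "\<dots> \<le> cmod (1 - herm z \<zeta>) + norm z * \<bar>1 - 1 / norm z\<bar>"
      using hle by (intro add_left_mono mult_right_mono) auto
    also have "norm z * \<bar>1 - 1 / norm z\<bar> = 1 - norm z"
      using z0 nz by (simp add: abs_if field_simps)
    also have "cmod (1 - herm z \<zeta>) + (1 - norm z) < r" using d ge r by linarith
    finally show ?thesis .
  qed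
  then show "(1 - r / 4) *\<^sub>R \<zeta> + v \<in> outer_sector \<zeta> r"
    using nz ge z0 r by (auto simp: outer_sector_def sector_def noniso_ball_def norm_sgn z_def[symmetric])
qed

lemma emeasure_translate:
  fixes S :: "'a::euclidean_space set"
  assumes "S \<in> sets borel"
  shows "emeasure lborel ((\<lambda>v. a + v) ` S) = emeasure lborel S" "(\<lambda>v. a + v) ` S \<in> sets borel"
proof -
  have eq: "(\<lambda>v. a + v) ` S = (+) (- a) -` S"
    by (auto simp: image_iff intro!: bexI[of _ "_ - a"])
  show m: "(\<lambda>v. a + v) ` S \<in> sets borel"
    unfolding eq using measurable_sets[of "(+) (- a)" borel borel S] assms by simp
  have "emeasure lborel S = emeasure (distr lborel borel ((+) (- a))) S" by (simp add: lborel_distr_plus)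
  also have "\<dots> = emeasure lborel ((\<lambda>v. a + v) ` S)"
    using assms by (subst emeasure_distr) (auto simp: eq)
  finally show "emeasure lborel ((\<lambda>v. a + v) ` S) = emeasure lborel S" by simp
qed

lemma measure_sphere_measure_ball:
  "measure sphere_measure (noniso_ball \<zeta> r) = measure lborel (sector \<zeta> r) / measure lborel (ball (0 :: complex ^ 'n) 1)"
  for \<zeta> :: "complex ^ 'n"
proof -
  have "emeasure sphere_measure (noniso_ball \<zeta> r) = emeasure lborel (sector \<zeta> r) / emeasure lborel (ball (0 :: complex ^ 'n) 1)"
    unfolding sector_def by (rule emeasure_sphere_measure[OF noniso_ball_borel noniso_ball_subset])
  moreover have "emeasure lborel (sector \<zeta> r) = ennreal (measure lborel (sector \<zeta> r))"
    using sector_finite[of \<zeta> r] by (intro emeasure_eq_ennreal_measure) auto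
  moreover have "emeasure lborel (ball (0 :: complex ^ 'n) 1) = ennreal (measure lborel (ball (0 :: complex ^ 'n) 1))"
    using emeasure_lborel_ball_finite[of "0 :: complex ^ 'n" 1] by (intro emeasure_eq_ennreal_measure) auto
  moreover have "0 < measure lborel (ball (0 :: complex ^ 'n) 1)" by (simp add: content_ball_pos)
  ultimately have "emeasure sphere_measure (noniso_ball \<zeta> r) = ennreal (measure lborel (sector \<zeta> r) / measure lborel (ball (0 :: complex ^ 'n) 1))"
    by (simp only: divide_ennreal measure_nonneg)
  then show ?thesis by (intro measure_eq_emeasure_eq_ennreal) auto
qed

text \<open>
  The outer sector has volume comparable to \<open>r^{n+1}\<close> by comparison with slabs, and it makes up
  a proportion between \<open>r\<close> and \<open>2 n r\<close> of the full sector.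
\<close>

lemma measure_noniso_ball_small:
  fixes \<zeta> :: "complex ^ 'n" and b :: real
  assumes \<zeta>: "norm \<zeta> = 1" and r: "0 < r" "r \<le> 1"
  defines "b \<equiv> measure lborel (ball (0 :: complex ^ 'n) 1)"
  shows "measure sphere_measure (noniso_ball \<zeta> r) \<le> (16 ^ (CARD('n) + 1) / b) * r ^ CARD('n)"
    and "(1 / real CARD('n)) ^ (2 * CARD('n)) / 32 ^ (CARD('n) + 1) / (2 * CARD('n) * b) * r ^ CARD('n)
      \<le> measure sphere_measure (noniso_ball \<zeta> r)"
proof -
  let ?n = "CARD('n)"
  have b: "0 < b" unfolding b_def by (simp add: content_ball_pos)
  define c where "c = measure lborel (sector \<zeta> r)"
  define v where "v = measure lborel (outer_sector \<zeta> r)"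
  have eq: "v = (1 - (1 - r) ^ (2 * ?n)) * c" unfolding v_def c_def using r by (rule measure_outer_sector)
  have c0: "0 \<le> c" by (simp add: c_def)
  have fin: "emeasure lborel (outer_sector \<zeta> r) = ennreal v"
  proof -
    have "emeasure lborel (outer_sector \<zeta> r) \<le> emeasure lborel (sector \<zeta> r)"
      by (intro emeasure_mono) (auto simp: outer_sector_def)
    then have "emeasure lborel (outer_sector \<zeta> r) \<noteq> top" using sector_finite[of \<zeta> r] by (auto simp: top_unique)
    then show ?thesis unfolding v_def by (simp add: emeasure_eq_ennreal_measure)
  qed
  have n1: "1 \<le> ?n" by (simp add: Suc_leI)
  have "ennreal v \<le> emeasure lborel ((\<lambda>v. \<zeta> + v) ` slab \<zeta> (4 * r))"
    unfolding fin[symmetric] by (intro emeasure_mono outer_sector_subset \<zeta> r) (simp add: emeasure_translate)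
  also have "\<dots> \<le> ennreal (4 ^ ?n * (4 * r) ^ (?n + 1))"
    using \<zeta> r by (simp only: emeasure_translate[OF slab_borel]) (rule emeasure_slab_upper, auto)
  finally have v_le: "v \<le> 4 ^ ?n * (4 * r) ^ (?n + 1)" using r by (simp add: ennreal_le_iff)
  have "ennreal ((1 / real ?n) ^ (2 * ?n) * (r / 32) ^ (?n + 1)) \<le> emeasure lborel ((\<lambda>v. (1 - r / 4) *\<^sub>R \<zeta> + v) ` slab \<zeta> (r / 32))"
    using \<zeta> r emeasure_slab_lower[of \<zeta> "r / 32"] by (simp add: emeasure_translate)
  also have "\<dots> \<le> ennreal v"
    unfolding fin[symmetric] by (intro emeasure_mono slab_subset_outer_sector \<zeta> r) simp
  finally have v_ge: "(1 / real ?n) ^ (2 * ?n) * (r / 32) ^ (?n + 1) \<le> v"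
    by (simp add: ennreal_le_iff v_def)
  have "(1 - r) ^ (2 * ?n) \<le> (1 - r) ^ 1" using r n1 by (intro power_decreasing) auto
  then have "r * c \<le> v" unfolding eq using c0 by (intro mult_right_mono) auto
  with v_le have "r * c \<le> r * (4 ^ ?n * 4 ^ (?n + 1) * r ^ ?n)" by (simp add: power_mult_distrib mult_ac)
  then have "c \<le> 4 ^ ?n * 4 ^ (?n + 1) * r ^ ?n" using r by simp
  also have "\<dots> \<le> 16 ^ (?n + 1) * r ^ ?n"
  proof -
    have "(4 :: real) ^ ?n * 4 ^ (?n + 1) \<le> 4 ^ (?n + 1) * 4 ^ (?n + 1)" by simp
    also have "\<dots> = 16 ^ (?n + 1)" by (simp add: power_mult_distrib[symmetric] del: power_Suc)
    finally show ?thesis using r by (intro mult_right_mono) auto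
  qed
  finally have "c / b \<le> (16 ^ (?n + 1) * r ^ ?n) / b" using b by (intro divide_right_mono) auto
  then show "measure sphere_measure (noniso_ball \<zeta> r) \<le> (16 ^ (?n + 1) / b) * r ^ ?n"
    by (simp add: measure_sphere_measure_ball c_def b_def)
  have "1 + real (2 * ?n) * (- r) \<le> (1 + (- r)) ^ (2 * ?n)" using r by (intro Bernoulli_inequality) auto
  then have "v \<le> (real (2 * ?n) * r) * c" unfolding eq using c0 by (intro mult_right_mono) auto
  with v_ge have "(1 / real ?n) ^ (2 * ?n) / 32 ^ (?n + 1) * r ^ ?n * r \<le> (real (2 * ?n) * c) * r"
    by (simp add: power_divide mult_ac)
  then have "(1 / real ?n) ^ (2 * ?n) / 32 ^ (?n + 1) * r ^ ?n \<le> real (2 * ?n) * c"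
    using r by (simp only: mult_le_cancel_right_pos)
  then have "(1 / real ?n) ^ (2 * ?n) / 32 ^ (?n + 1) * r ^ ?n / (real (2 * ?n) * b) \<le> (real (2 * ?n) * c) / (real (2 * ?n) * b)"
    using b by (intro divide_right_mono) auto
  also have "\<dots> = c / b" using n1 by simp
  finally show "(1 / real ?n) ^ (2 * ?n) / 32 ^ (?n + 1) / (2 * ?n * b) * r ^ ?n \<le> measure sphere_measure (noniso_ball \<zeta> r)"
    by (simp add: measure_sphere_measure_ball c_def b_def)
qed

lemma space_sphere_measure [simp]: "space sphere_measure = sphere 0 1"
  by (simp add: sphere_measure_def space_restrict_space)

lemma finite_sphere_measure: "finite_measure (sphere_measure :: (complex ^ 'n) measure)"
  by (rule finite_measureI) (simp add: emeasure_sphere_measure_UNIV)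

lemma sets_sphere_measureI:
  assumes "A \<in> sets borel" "A \<subseteq> sphere 0 1"
  shows "A \<in> sets sphere_measure"
proof -
  have "A \<in> sets (restrict_space (distr (uniform_measure lborel (ball 0 1)) borel sgn) (sphere 0 1))"
    using assms by (auto simp: sets_restrict_space_iff borel_closed)
  then show ?thesis unfolding sphere_measure_def by simp
qed

lemma noniso_ball_sets [measurable]: "noniso_ball \<zeta> r \<in> sets sphere_measure"
  by (rule sets_sphere_measureI[OF noniso_ball_borel noniso_ball_subset])

lemma measure_noniso_ball:
  "\<exists>k1>0. \<exists>k2>0. \<forall>\<zeta>\<in>sphere 0 1. \<forall>r>0.
     k1 * min r 1 ^ CARD('n) \<le> measure sphere_measure (noniso_ball (\<zeta> :: complex ^ 'n) r) \<and>
     measure sphere_measure (noniso_ball \<zeta> r) \<le> k2 * min r 1 ^ CARD('n)"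
proof -
  interpret finite_measure "sphere_measure :: (complex ^ 'n) measure" by (rule finite_sphere_measure)
  define b where "b = measure lborel (ball (0 :: complex ^ 'n) 1)"
  have b: "0 < b" unfolding b_def by (simp add: content_ball_pos)
  define k1 where "k1 = (1 / real CARD('n)) ^ (2 * CARD('n)) / 32 ^ (CARD('n) + 1) / (2 * CARD('n) * b)"
  define k2 where "k2 = max 1 (16 ^ (CARD('n) + 1) / b)"
  have k1: "0 < k1" using b by (simp add: k1_def)
  have small: "k1 * r ^ CARD('n) \<le> measure sphere_measure (noniso_ball \<zeta> r)"
    "measure sphere_measure (noniso_ball \<zeta> r) \<le> k2 * r ^ CARD('n)"
    if "norm \<zeta> = 1" "0 < r" "r \<le> 1" for \<zeta> :: "complex ^ 'n" and r
  proof -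
    show "k1 * r ^ CARD('n) \<le> measure sphere_measure (noniso_ball \<zeta> r)"
      unfolding k1_def b_def by (rule measure_noniso_ball_small(2)[OF that])
    have "measure sphere_measure (noniso_ball \<zeta> r) \<le> (16 ^ (CARD('n) + 1) / b) * r ^ CARD('n)"
      unfolding b_def by (rule measure_noniso_ball_small(1)[OF that])
    also have "\<dots> \<le> k2 * r ^ CARD('n)"
      using that by (intro mult_right_mono) (auto simp: k2_def)
    finally show "measure sphere_measure (noniso_ball \<zeta> r) \<le> k2 * r ^ CARD('n)" .
  qed
  show ?thesis
  proof (rule exI[of _ k1], intro conjI k1, rule exI[of _ k2], intro conjI ballI allI impI)
    show "0 < k2" by (simp add: k2_def)
  next
    fix \<zeta> :: "complex ^ 'n" and r :: real assume \<zeta>: "\<zeta> \<in> sphere 0 1" and r: "0 < r"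
    show "k1 * min r 1 ^ CARD('n) \<le> measure sphere_measure (noniso_ball \<zeta> r)"
    proof (cases "r \<le> 1")
      case True
      then show ?thesis using small(1)[of \<zeta> r] \<zeta> r by simp
    next
      case False
      have "measure sphere_measure (noniso_ball \<zeta> 1) \<le> measure sphere_measure (noniso_ball \<zeta> r)"
        using False by (intro finite_measure_mono[OF _ noniso_ball_sets]) (auto simp: noniso_ball_def)
      then show ?thesis using small(1)[of \<zeta> 1] \<zeta> False by simp
    qed
    show "measure sphere_measure (noniso_ball \<zeta> r) \<le> k2 * min r 1 ^ CARD('n)"
    proof (cases "r \<le> 1")
      case True
      then show ?thesis using small(2)[of \<zeta> r] \<zeta> r by simp
    next
      case False
      have "measure sphere_measure (noniso_ball \<zeta> r) \<le> measure sphere_measure (space (sphere_measure :: (complex ^ 'n) measure))"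
        by (rule bounded_measure)
      also have "\<dots> = 1" by (simp add: measure_def emeasure_sphere_measure_UNIV)
      also have "1 \<le> k2" by (simp add: k2_def)
      finally show ?thesis using False by simp
    qed
  qed
qed

section \<open>Muckenhoupt weights and shadows on the sphere\<close>

locale Ap_sphere =
  fixes p :: real and w :: "complex ^ 'n \<Rightarrow> real"
  assumes p: "1 < p" and Ap: "Ap_weight p w"
begin

abbreviation \<sigma> :: "(complex ^ 'n) measure" where "\<sigma> \<equiv> sphere_measure"

sublocale \<sigma>: finite_measure \<sigma> by (rule finite_sphere_measure)

definition \<mu> :: "(complex ^ 'n) measure" where "\<mu> = density \<sigma> (\<lambda>\<eta>. ennreal (w \<eta>))"

lemma w_measurable [measurable]: "w \<in> borel_measurable \<sigma>"
  and w_nonneg: "\<zeta> \<in> sphere 0 1 \<Longrightarrow> 0 \<le> w \<zeta>"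
  and w_pos: "AE \<zeta> in \<sigma>. 0 < w \<zeta>"
  using Ap by (auto simp: Ap_weight_def)

lemma sets_\<mu> [measurable_cong, simp]: "sets \<mu> = sets \<sigma>" and space_\<mu> [simp]: "space \<mu> = sphere 0 1"
  by (simp_all add: \<mu>_def)

lemma emeasure_\<mu>: "X \<in> sets \<sigma> \<Longrightarrow> emeasure \<mu> X = (\<integral>\<^sup>+\<eta>\<in>X. ennreal (w \<eta>) \<partial>\<sigma>)"
  unfolding \<mu>_def by (rule emeasure_density) measurable

definition dual_mass :: "(complex ^ 'n) set \<Rightarrow> ennreal" where
  "dual_mass X = (\<integral>\<^sup>+\<eta>\<in>X. ennreal (w \<eta> powr (- 1 / (p - 1))) \<partial>\<sigma>)"

text \<open>
  Hoelder's inequality for \<open>1 = w^{1/p} w^{-1/p}\<close>, which holds almost everywhere because \<open>w\<close> is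
  positive almost everywhere.
\<close>

lemma sigma_le_Hoelder:
  assumes [measurable]: "X \<in> sets \<sigma>"
  shows "enn_powr (emeasure \<sigma> X) p \<le> emeasure \<mu> X * enn_powr (dual_mass X) (p - 1)"
proof -
  define q where "q = p / (p - 1)"
  have pq: "1 < p" "1 < q" "1 / p + 1 / q = 1" using p by (auto simp: q_def field_simps)
  have "emeasure \<sigma> X = (\<integral>\<^sup>+\<eta>. indicator X \<eta> \<partial>\<sigma>)" by simp
  also have "\<dots> = (\<integral>\<^sup>+\<eta>. (ennreal (w \<eta> powr (1 / p)) * indicator X \<eta>) * (ennreal (w \<eta> powr (- 1 / p)) * indicator X \<eta>) \<partial>\<sigma>)"
  proof (rule nn_integral_cong_AE)
    show "AE \<eta> in \<sigma>. indicator X \<eta> = (ennreal (w \<eta> powr (1 / p)) * indicator X \<eta>) * (ennreal (w \<eta> powr (- 1 / p)) * indicator X \<eta>)"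
      using w_pos
    proof eventually_elim
      case (elim \<eta>)
      then have "w \<eta> powr (1 / p) * w \<eta> powr (- 1 / p) = 1" by (simp add: powr_add[symmetric])
      then have "ennreal (w \<eta> powr (1 / p)) * ennreal (w \<eta> powr (- 1 / p)) = 1" by (simp add: ennreal_mult[symmetric])
      then show ?case by (simp split: split_indicator)
    qed
  qed
  also have "\<dots> \<le> enn_powr (\<integral>\<^sup>+\<eta>. enn_powr (ennreal (w \<eta> powr (1 / p)) * indicator X \<eta>) p \<partial>\<sigma>) (1 / p)
     * enn_powr (\<integral>\<^sup>+\<eta>. enn_powr (ennreal (w \<eta> powr (- 1 / p)) * indicator X \<eta>) q \<partial>\<sigma>) (1 / q)"
    by (intro nn_integral_Hoelder pq) measurable
  also have "(\<integral>\<^sup>+\<eta>. enn_powr (ennreal (w \<eta> powr (1 / p)) * indicator X \<eta>) p \<partial>\<sigma>) = emeasure \<mu> X"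
    unfolding emeasure_\<mu>[OF assms]
  proof (rule nn_integral_cong)
    fix \<eta> :: "complex ^ 'n" assume "\<eta> \<in> space \<sigma>"
    then show "enn_powr (ennreal (w \<eta> powr (1 / p)) * indicator X \<eta>) p = ennreal (w \<eta>) * indicator X \<eta>"
      using w_nonneg[of \<eta>] p by (auto simp: powr_powr split: split_indicator)
  qed
  also have "(\<integral>\<^sup>+\<eta>. enn_powr (ennreal (w \<eta> powr (- 1 / p)) * indicator X \<eta>) q \<partial>\<sigma>) = dual_mass X"
    unfolding dual_mass_def
  proof (rule nn_integral_cong)
    fix \<eta> :: "complex ^ 'n"
    have "- 1 / p * q = - 1 / (p - 1)" using p by (simp add: q_def)
    then show "enn_powr (ennreal (w \<eta> powr (- 1 / p)) * indicator X \<eta>) q = ennreal (w \<eta> powr (- 1 / (p - 1))) * indicator X \<eta>"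
      by (auto simp: powr_powr split: split_indicator)
  qed
  finally have "enn_powr (emeasure \<sigma> X) p \<le> enn_powr (enn_powr (emeasure \<mu> X) (1 / p) * enn_powr (dual_mass X) (1 / q)) p"
    using p by (intro enn_powr_mono) auto
  also have "\<dots> = emeasure \<mu> X * enn_powr (dual_mass X) (p - 1)"
  proof -
    have "1 / q * p = p - 1" using p by (simp add: q_def)
    then show ?thesis using p by (simp add: enn_powr_mult enn_powr_powr)
  qed
  finally show ?thesis .
qed

lemma sphere_compare:
  obtains c where "0 < c" "\<And>\<zeta> \<zeta>' r R t. \<zeta> \<in> sphere 0 1 \<Longrightarrow> \<zeta>' \<in> sphere 0 1 \<Longrightarrow> 0 < r \<Longrightarrow> 0 < R \<Longrightarrow> 1 \<le> t \<Longrightarrow> R \<le> t * r \<Longrightarrow>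
    measure \<sigma> (noniso_ball \<zeta>' R) \<le> c * t ^ CARD('n) * measure \<sigma> (noniso_ball \<zeta> r)"
proof -
  obtain k1 k2 where k: "0 < k1" "0 < k2" and b: "\<And>(\<zeta> :: complex ^ 'n) r. \<zeta> \<in> sphere 0 1 \<Longrightarrow> 0 < r \<Longrightarrow> k1 * min r 1 ^ CARD('n) \<le> measure \<sigma> (noniso_ball \<zeta> r) \<and>
     measure \<sigma> (noniso_ball \<zeta> r) \<le> k2 * min r 1 ^ CARD('n)"
    using measure_noniso_ball by (elim exE conjE) blast
  show ?thesis
  proof (rule that[of "k2 / k1"])
    fix \<zeta> \<zeta>' :: "complex ^ 'n" and r R t :: real
    assume h: "\<zeta> \<in> sphere 0 1" "\<zeta>' \<in> sphere 0 1" "0 < r" "0 < R" "1 \<le> t" "R \<le> t * r"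
    have "min R 1 \<le> t * min r 1" using h by (auto simp: min_def mult_left_mono)
    then have "min R 1 ^ CARD('n) \<le> (t * min r 1) ^ CARD('n)" using h by (intro power_mono) auto
    then have "measure \<sigma> (noniso_ball \<zeta>' R) \<le> k2 * (t ^ CARD('n) * min r 1 ^ CARD('n))"
      using b[of \<zeta>' R] h k by (simp add: power_mult_distrib) (meson mult_le_cancel_left_pos order_trans)
    also have "\<dots> = (k2 / k1 * t ^ CARD('n)) * (k1 * min r 1 ^ CARD('n))" using k by simp
    also have "\<dots> \<le> (k2 / k1 * t ^ CARD('n)) * measure \<sigma> (noniso_ball \<zeta> r)"
      using b[of \<zeta> r] h k by (intro mult_left_mono) auto
    finally show "measure \<sigma> (noniso_ball \<zeta>' R) \<le> k2 / k1 * t ^ CARD('n) * measure \<sigma> (noniso_ball \<zeta> r)" .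
  qed (use k in simp)
qed

lemma sphere_ball_pos: "\<zeta> \<in> sphere 0 1 \<Longrightarrow> 0 < r \<Longrightarrow> 0 < measure \<sigma> (noniso_ball \<zeta> r)" for \<zeta> :: "complex ^ 'n"
proof -
  assume h: "\<zeta> \<in> sphere 0 1" "0 < r"
  obtain k1 k2 where k: "0 < k1" "0 < k2" and b: "\<And>(\<zeta> :: complex ^ 'n) r. \<zeta> \<in> sphere 0 1 \<Longrightarrow> 0 < r \<Longrightarrow> k1 * min r 1 ^ CARD('n) \<le> measure \<sigma> (noniso_ball \<zeta> r) \<and>
     measure \<sigma> (noniso_ball \<zeta> r) \<le> k2 * min r 1 ^ CARD('n)"
    using measure_noniso_ball by (elim exE conjE) blast
  have "0 < k1 * min r 1 ^ CARD('n)" using k h by simp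
  then show ?thesis using b[OF h] by linarith
qed

lemma Ap_bound:
  obtains C where "0 < C" "\<And>\<zeta> r. \<zeta> \<in> sphere 0 1 \<Longrightarrow> 0 < r \<Longrightarrow>
    emeasure \<mu> (noniso_ball \<zeta> r) * enn_powr (dual_mass (noniso_ball \<zeta> r)) (p - 1)
      \<le> ennreal (C * measure \<sigma> (noniso_ball \<zeta> r) powr p)"
proof -
  obtain C where C: "0 < C" and le: "\<And>\<zeta> r. \<zeta> \<in> sphere 0 1 \<Longrightarrow> 0 < r \<Longrightarrow>
     (emeasure \<mu> (noniso_ball \<zeta> r) / emeasure \<sigma> (noniso_ball \<zeta> r)) *
     enn_powr (dual_mass (noniso_ball \<zeta> r) / emeasure \<sigma> (noniso_ball \<zeta> r)) (p - 1) \<le> ennreal C"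
    using Ap unfolding Ap_weight_def Let_def dual_mass_def by (auto simp: emeasure_\<mu>)
  show ?thesis
  proof (rule that[OF C])
    fix \<zeta> :: "complex ^ 'n" and r :: real assume h: "\<zeta> \<in> sphere 0 1" "0 < r"
    define B where "B = noniso_ball \<zeta> r"
    define s where "s = measure \<sigma> B"
    have s: "0 < s" unfolding s_def B_def using h by (rule sphere_ball_pos)
    have em: "emeasure \<sigma> B = ennreal s" unfolding s_def by (rule \<sigma>.emeasure_eq_measure)
    have "emeasure \<mu> B * enn_powr (dual_mass B) (p - 1)
       = ((emeasure \<mu> B / ennreal s) * enn_powr (dual_mass B / ennreal s) (p - 1)) * (ennreal s * ennreal (s powr (p - 1)))"
    proof -
      have 1: "emeasure \<mu> B = emeasure \<mu> B / ennreal s * ennreal s"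
        using s by (simp add: ennreal_divide_times ennreal_divide_self)
      have 2: "dual_mass B = dual_mass B / ennreal s * ennreal s"
        using s by (simp add: ennreal_divide_times ennreal_divide_self)
      have 3: "enn_powr (dual_mass B) (p - 1) = enn_powr (dual_mass B / ennreal s) (p - 1) * ennreal (s powr (p - 1))"
        by (subst 2, subst enn_powr_mult) (use s in simp)
      show ?thesis by (subst 1, subst 3) (simp add: mult_ac)
    qed
    also have "\<dots> \<le> ennreal C * (ennreal s * ennreal (s powr (p - 1)))"
      using le[OF h] unfolding B_def[symmetric] em by (intro mult_right_mono) auto
    also have "\<dots> = ennreal (C * s powr p)"
    proof -
      have "s * s powr (p - 1) = s powr p" using s powr_add[of s 1 "p - 1"] by simp
      then show ?thesis using s C by (simp add: ennreal_mult[symmetric])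
    qed
    finally show "emeasure \<mu> (noniso_ball \<zeta> r) * enn_powr (dual_mass (noniso_ball \<zeta> r)) (p - 1)
      \<le> ennreal (C * measure \<sigma> (noniso_ball \<zeta> r) powr p)" by (simp add: B_def s_def)
  qed
qed

lemma noniso_ball_3: "\<zeta> \<in> sphere 0 1 \<Longrightarrow> noniso_ball \<zeta> 3 = sphere 0 1" for \<zeta> :: "complex ^ 'n"
proof -
  assume \<zeta>: "\<zeta> \<in> sphere 0 1"
  have "cmod (1 - herm \<zeta> \<eta>) < 3" if "norm \<eta> = 1" for \<eta>
  proof -
    have "cmod (1 - herm \<zeta> \<eta>) \<le> cmod 1 + cmod (herm \<zeta> \<eta>)" by (rule norm_triangle_ineq4)
    also have "cmod (herm \<zeta> \<eta>) \<le> 1" using herm_Cauchy_Schwarz[of \<zeta> \<eta>] \<zeta> that by simp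
    finally show ?thesis by simp
  qed
  then show ?thesis by (auto simp: noniso_ball_def)
qed

lemma dual_mass_pos:
  assumes [measurable]: "X \<in> sets \<sigma>" and "0 < emeasure \<sigma> X"
  shows "dual_mass X \<noteq> 0"
proof
  assume "dual_mass X = 0"
  then have "AE \<eta> in \<sigma>. ennreal (w \<eta> powr (- 1 / (p - 1))) * indicator X \<eta> = 0"
    unfolding dual_mass_def by (subst (asm) nn_integral_0_iff_AE) auto
  with w_pos have "AE \<eta> in \<sigma>. \<eta> \<notin> X"
    by eventually_elim (auto split: split_indicator_asm)
  then have "emeasure \<sigma> {\<eta> \<in> space \<sigma>. \<eta> \<in> X} = 0" by (rule emeasure_eq_0_AE)
  moreover have "{\<eta> \<in> space \<sigma>. \<eta> \<in> X} = X" using sets.sets_into_space[OF assms(1)] by auto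
  ultimately have "emeasure \<sigma> X = 0" by simp
  then show False using assms by simp
qed

lemma exists_sphere: "\<exists>\<zeta> :: complex ^ 'n. \<zeta> \<in> sphere 0 1"
  using norm_axis_one by (metis mem_sphere_0)

text \<open>
  The ball of radius 3 is the whole sphere; there the second factor of the \<open>A_p\<close> condition is
  positive, so the first one is finite.
\<close>

lemma \<mu>_finite: "emeasure \<mu> (sphere 0 1) < top"
proof -
  obtain \<zeta> :: "complex ^ 'n" where \<zeta>: "\<zeta> \<in> sphere 0 1" using exists_sphere by blast
  obtain C where "emeasure \<mu> (noniso_ball \<zeta> 3) * enn_powr (dual_mass (noniso_ball \<zeta> 3)) (p - 1)
      \<le> ennreal (C * measure \<sigma> (noniso_ball \<zeta> 3) powr p)"
    using Ap_bound \<zeta> by (metis zero_less_numeral)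
  then have "emeasure \<mu> (sphere 0 1) * enn_powr (dual_mass (sphere 0 1)) (p - 1) < top"
    unfolding noniso_ball_3[OF \<zeta>] using ennreal_less_top le_less_trans by blast
  moreover have "dual_mass (sphere 0 1) \<noteq> 0"
    using dual_mass_pos[of "sphere 0 1"] sets.top[of \<sigma>] by (simp add: emeasure_sphere_measure_UNIV)
  ultimately show ?thesis by (auto simp: less_top[symmetric] ennreal_mult_eq_top_iff)
qed

sublocale \<mu>: finite_measure \<mu>
  by (rule finite_measureI) (use \<mu>_finite in \<open>simp add: less_top\<close>)

lemma \<mu>_ball_pos:
  assumes h: "\<zeta> \<in> sphere 0 1" "0 < r"
  shows "0 < emeasure \<mu> (noniso_ball \<zeta> r)"
proof (rule ccontr)
  assume "\<not> 0 < emeasure \<mu> (noniso_ball \<zeta> r)"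
  then have "emeasure \<mu> (noniso_ball \<zeta> r) = 0" by simp
  then have "enn_powr (emeasure \<sigma> (noniso_ball \<zeta> r)) p \<le> 0"
    using sigma_le_Hoelder[OF noniso_ball_sets, of \<zeta> r] by simp
  then have "emeasure \<sigma> (noniso_ball \<zeta> r) = 0" by simp
  then show False using sphere_ball_pos[OF h] by (simp add: measure_def)
qed

text \<open>
  The \<open>A_p\<close> condition on the larger ball \<open>B\<close> bounds \<open>\<mu> B\<close> times the \<open>(p-1)\<close>-st power of the dual mass
  of \<open>B\<close> by \<open>C (\<sigma> B)^p\<close>. Multiplying the inequality \<open>sigma_le_Hoelder\<close> for the smaller ball \<open>E\<close> by
  \<open>\<mu> B\<close> gives \<open>(\<sigma> E)^p \<mu> B \<le> C (\<sigma> B)^p \<mu> E\<close>, and \<open>\<sigma> B\<close> is at most a multiple of \<open>\<sigma> E\<close>.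
\<close>

lemma \<mu>_compare:
  obtains c where "\<And>t. 1 \<le> t \<Longrightarrow> 0 < c t" "\<And>\<zeta> \<zeta>' r R t. \<zeta> \<in> sphere 0 1 \<Longrightarrow> \<zeta>' \<in> sphere 0 1 \<Longrightarrow> 0 < r \<Longrightarrow> 0 < R \<Longrightarrow> 1 \<le> t \<Longrightarrow> R \<le> t * r \<Longrightarrow>
    noniso_ball \<zeta> r \<subseteq> noniso_ball \<zeta>' R \<Longrightarrow>
    emeasure \<mu> (noniso_ball \<zeta>' R) \<le> ennreal (c t) * emeasure \<mu> (noniso_ball \<zeta> r)"
proof -
  obtain a where a: "0 < a" and comp: "\<And>\<zeta> \<zeta>' r R t. \<zeta> \<in> sphere 0 1 \<Longrightarrow> \<zeta>' \<in> sphere 0 1 \<Longrightarrow> 0 < r \<Longrightarrow> 0 < R \<Longrightarrow> 1 \<le> t \<Longrightarrow> R \<le> t * r \<Longrightarrow>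
    measure \<sigma> (noniso_ball \<zeta>' R) \<le> a * t ^ CARD('n) * measure \<sigma> (noniso_ball \<zeta> r)"
    using sphere_compare by blast
  obtain C where C: "0 < C" and Apb: "\<And>\<zeta> r. \<zeta> \<in> sphere 0 1 \<Longrightarrow> 0 < r \<Longrightarrow>
    emeasure \<mu> (noniso_ball \<zeta> r) * enn_powr (dual_mass (noniso_ball \<zeta> r)) (p - 1)
      \<le> ennreal (C * measure \<sigma> (noniso_ball \<zeta> r) powr p)"
    using Ap_bound by blast
  show ?thesis
  proof (rule that[of "\<lambda>t. C * (a * t ^ CARD('n)) powr p"])
    show "0 < C * (a * t ^ CARD('n)) powr p" if "1 \<le> t" for t using C a that by simp
  next
    fix \<zeta> \<zeta>' :: "complex ^ 'n" and r R t :: real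
    assume h: "\<zeta> \<in> sphere 0 1" "\<zeta>' \<in> sphere 0 1" "0 < r" "0 < R" "1 \<le> t" "R \<le> t * r"
      and sub: "noniso_ball \<zeta> r \<subseteq> noniso_ball \<zeta>' R"
    define E where "E = noniso_ball \<zeta> r"
    define B where "B = noniso_ball \<zeta>' R"
    have [measurable]: "E \<in> sets \<sigma>" "B \<in> sets \<sigma>" by (auto simp: E_def B_def)
    define s where "s = measure \<sigma> E"
    have s: "0 < s" unfolding s_def E_def using h by (intro sphere_ball_pos)
    have dm: "dual_mass E \<le> dual_mass B"
      unfolding dual_mass_def using sub by (intro nn_integral_mono) (auto simp: E_def B_def split: split_indicator)
    have "ennreal (s powr p) * emeasure \<mu> B \<le> (emeasure \<mu> E * enn_powr (dual_mass B) (p - 1)) * emeasure \<mu> B"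
    proof (intro mult_right_mono)
      have "ennreal (s powr p) = enn_powr (emeasure \<sigma> E) p"
        by (simp add: \<sigma>.emeasure_eq_measure s_def)
      also have "\<dots> \<le> emeasure \<mu> E * enn_powr (dual_mass E) (p - 1)" by (rule sigma_le_Hoelder) measurable
      also have "\<dots> \<le> emeasure \<mu> E * enn_powr (dual_mass B) (p - 1)"
        using p dm by (intro mult_left_mono enn_powr_mono) auto
      finally show "ennreal (s powr p) \<le> emeasure \<mu> E * enn_powr (dual_mass B) (p - 1)" .
    qed simp
    also have "\<dots> = emeasure \<mu> E * (emeasure \<mu> B * enn_powr (dual_mass B) (p - 1))" by (simp add: mult_ac)
    also have "\<dots> \<le> emeasure \<mu> E * ennreal (C * measure \<sigma> B powr p)"
      unfolding B_def using h by (intro mult_left_mono Apb) auto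
    also have "\<dots> \<le> emeasure \<mu> E * ennreal (C * ((a * t ^ CARD('n)) * s) powr p)"
    proof (intro mult_left_mono ennreal_leI powr_mono2)
      show "measure \<sigma> B \<le> (a * t ^ CARD('n)) * s" unfolding B_def s_def E_def using h by (intro comp)
    qed (use C p in auto)
    also have "\<dots> = ennreal (s powr p) * (ennreal (C * (a * t ^ CARD('n)) powr p) * emeasure \<mu> E)"
      using C a s h by (simp add: powr_mult ennreal_mult mult_ac)
    finally have le: "ennreal (s powr p) * emeasure \<mu> B \<le> ennreal (s powr p) * (ennreal (C * (a * t ^ CARD('n)) powr p) * emeasure \<mu> E)" .
    have cancel: "ennreal (1 / s powr p) * (ennreal (s powr p) * x) = x" for x
      using s by (simp add: mult.assoc[symmetric] ennreal_mult[symmetric])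
    have "ennreal (1 / s powr p) * (ennreal (s powr p) * emeasure \<mu> B)
      \<le> ennreal (1 / s powr p) * (ennreal (s powr p) * (ennreal (C * (a * t ^ CARD('n)) powr p) * emeasure \<mu> E))"
      by (intro mult_left_mono le) simp
    then have "emeasure \<mu> B \<le> ennreal (C * (a * t ^ CARD('n)) powr p) * emeasure \<mu> E"
      unfolding cancel .
    then show "emeasure \<mu> (noniso_ball \<zeta>' R) \<le> ennreal (C * (a * t ^ CARD('n)) powr p) * emeasure \<mu> (noniso_ball \<zeta> r)"
      by (simp only: E_def B_def)
  qed
qed

lemma pdist_lt_noniso: "\<eta> \<in> noniso_ball \<zeta> r \<longleftrightarrow> norm \<eta> = 1 \<and> pdist \<zeta> \<eta> < r"
  by (simp add: noniso_ball_def pdist_def)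

lemma pdist_le_norm:
  assumes "norm \<zeta> = 1"
  shows "pdist \<zeta> \<eta> \<le> norm (\<zeta> - \<eta>)"
proof -
  have "1 - herm \<zeta> \<eta> = herm \<zeta> (\<zeta> - \<eta>)" using assms by (simp add: herm_diff_right herm_self)
  then show ?thesis using herm_Cauchy_Schwarz[of \<zeta> "\<zeta> - \<eta>"] assms by (simp add: pdist_def)
qed

text \<open>
  Two applications of the quasi-triangle inequality with constant 2 give the factor 10: the
  first bounds the distance from a common point to a point of the smaller ball by
  \<open>2 (r' + r') = 4 r'\<close>, the second the distance from \<open>c'\<close> to that point by
  \<open>2 (r' + 4 r')\<close>.
\<close>

lemma noniso_engulf:
  assumes c: "norm c = 1" "norm c' = 1" and meet: "noniso_ball c r \<inter> noniso_ball c' r' \<noteq> {}" and "r \<le> r'"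
  shows "noniso_ball c r \<subseteq> noniso_ball c' (10 * r')"
proof
  obtain \<eta> where \<eta>: "norm \<eta> = 1" "pdist c \<eta> < r" "pdist c' \<eta> < r'"
    using meet by (auto simp: pdist_lt_noniso)
  fix x assume "x \<in> noniso_ball c r"
  then have x: "norm x = 1" "pdist c x < r" by (auto simp: pdist_lt_noniso)
  have "pdist c' x \<le> 2 * (pdist c' \<eta> + pdist \<eta> x)" using c \<eta> x by (intro pdist_triangle)
  moreover have "pdist \<eta> x \<le> 2 * (pdist \<eta> c + pdist c x)" using c \<eta> x by (intro pdist_triangle)
  ultimately have "pdist c' x < 10 * r'" using \<eta> x \<open>r \<le> r'\<close> by (simp add: pdist_commute)
  then show "x \<in> noniso_ball c' (10 * r')" using x by (simp add: pdist_lt_noniso)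
qed

text \<open>
  Balls with centres in a countable dense subset of the sphere and rational radii. They
  approximate all balls up to constants.
\<close>

lemma countable_family:
  obtains c :: "nat \<times> rat \<Rightarrow> complex ^ 'n" and r :: "nat \<times> rat \<Rightarrow> real" and K where
    "doubling_family \<mu> (\<lambda>i. noniso_ball (c i) (r i)) (\<lambda>i. noniso_ball (c i) (10 * r i)) r K"
    "\<And>i. c i \<in> sphere 0 1" "\<And>i. 0 < r i"
    "\<And>\<zeta> x y. \<zeta> \<in> sphere 0 1 \<Longrightarrow> 0 < x \<Longrightarrow> 0 < y \<Longrightarrow> \<exists>i. pdist \<zeta> (c i) < x \<and> y < r i \<and> r i < 2 * y"
proof -
  obtain D :: "(complex ^ 'n) set" where D: "countable D" "D \<subseteq> sphere 0 1" "sphere 0 1 \<subseteq> closure D"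
    using separable by blast
  have D0: "D \<noteq> {}" using D(3) exists_sphere by auto
  define c where "c i = from_nat_into D (fst i)" for i :: "nat \<times> rat"
  define r where "r i = (if 0 < snd i then of_rat (snd i) else 1 :: real)" for i :: "nat \<times> rat"
  have c: "c i \<in> sphere 0 1" for i
  proof -
    have "c i \<in> D" by (simp add: c_def from_nat_into[OF D0])
    then show ?thesis using D(2) by blast
  qed
  then have nc: "norm (c i) = 1" for i by simp
  have r: "0 < r i" for i by (simp add: r_def)
  obtain b where b: "\<And>t. 1 \<le> t \<Longrightarrow> 0 < b t" "\<And>\<zeta> \<zeta>' r R t. \<zeta> \<in> sphere 0 1 \<Longrightarrow> \<zeta>' \<in> sphere 0 1 \<Longrightarrow> 0 < r \<Longrightarrow> 0 < R \<Longrightarrow> 1 \<le> t \<Longrightarrow> R \<le> t * r \<Longrightarrow>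
    noniso_ball \<zeta> r \<subseteq> noniso_ball \<zeta>' R \<Longrightarrow>
    emeasure \<mu> (noniso_ball \<zeta>' R) \<le> ennreal (b t) * emeasure \<mu> (noniso_ball \<zeta> r)"
    using \<mu>_compare by blast
  show ?thesis
  proof (rule that[of c r "b 10"])
    show "doubling_family \<mu> (\<lambda>i. noniso_ball (c i) (r i)) (\<lambda>i. noniso_ball (c i) (10 * r i)) r (b 10)"
    proof
      show "noniso_ball (c i) (r i) \<in> sets \<mu>" "noniso_ball (c i) (10 * r i) \<in> sets \<mu>" for i by simp_all
      show "0 < emeasure \<mu> (noniso_ball (c i) (r i))" for i by (rule \<mu>_ball_pos[OF c r])
      show "noniso_ball (c i) (r i) \<subseteq> noniso_ball (c j) (10 * r j)"
        if "noniso_ball (c i) (r i) \<inter> noniso_ball (c j) (r j) \<noteq> {}" "r i \<le> r j" for i j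
        by (rule noniso_engulf[OF nc nc that])
      show "emeasure \<mu> (noniso_ball (c i) (10 * r i)) \<le> ennreal (b 10) * emeasure \<mu> (noniso_ball (c i) (r i))" for i
        using r[of i] by (intro b(2) c) (auto simp: noniso_ball_def)
      show "0 < b 10" by (rule b(1)) simp
    qed
    show "\<exists>i. pdist \<zeta> (c i) < x \<and> y < r i \<and> r i < 2 * y" if h: "\<zeta> \<in> sphere 0 1" "0 < x" "0 < y" for \<zeta> x y
    proof -
      have "\<zeta> \<in> closure D" using D(3) h by blast
      then obtain a where a: "a \<in> D" "dist a \<zeta> < x" using h(2) by (auto simp: closure_approachable)
      obtain k where k: "from_nat_into D k = a" using from_nat_into_surj[OF D(1) a(1)] by blast
      obtain q :: rat where q: "y < of_rat q" "of_rat q < 2 * y" using of_rat_dense[of y "2 * y"] h(3) by auto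
      have "0 < (of_rat q :: real)" using q h by linarith
      then have q0: "0 < q" by simp
      have "pdist \<zeta> (c (k, q)) < x"
        using pdist_le_norm[of \<zeta> a] a h k by (simp add: c_def dist_norm norm_minus_commute)
      moreover have "r (k, q) = of_rat q" using q0 by (simp add: r_def)
      ultimately show ?thesis using q by (intro exI[of _ "(k, q)"]) simp
    qed
  qed (use c r in auto)
qed

end

locale Ap_tent = Ap_sphere p w for p :: real and w :: "complex ^ 'n \<Rightarrow> real" +
  fixes \<alpha> :: real
  assumes \<alpha>: "1 < \<alpha>"
begin

definition shadow :: "complex ^ 'n \<Rightarrow> (complex ^ 'n) set" where
  "shadow z = {\<zeta> \<in> sphere 0 1. z \<in> admissible \<alpha> \<zeta>}"

lemma herm_measurable [measurable (raw)]:
  fixes f g :: "'l \<Rightarrow> complex ^ 'n"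
  assumes [measurable]: "f \<in> borel_measurable L" "g \<in> borel_measurable L"
  shows "(\<lambda>x. herm (f x) (g x)) \<in> borel_measurable L"
proof -
  have [measurable]: "(\<lambda>v :: complex ^ 'n. v $ i) \<in> borel_measurable borel" for i
    by (intro borel_measurable_continuous_onI continuous_intros)
  show ?thesis unfolding herm_def by measurable
qed

lemma sphere_id_measurable: "(\<lambda>\<zeta>. \<zeta>) \<in> \<sigma> \<rightarrow>\<^sub>M borel"
proof (rule measurableI)
  fix X :: "(complex ^ 'n) set" assume "X \<in> sets borel"
  then show "(\<lambda>\<zeta>. \<zeta>) -` X \<inter> space \<sigma> \<in> sets \<sigma>"
    by (intro sets_sphere_measureI) (auto intro: borel_closed)
qed simp

lemma ball_id_measurable: "(\<lambda>z. z) \<in> lebesgue_on (ball 0 1) \<rightarrow>\<^sub>M (borel :: (complex ^ 'n) measure)"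
  using id_borel_measurable_lebesgue_on by (simp add: id_def)

lemma admissible_pred [measurable (raw)]:
  assumes f: "f \<in> L \<rightarrow>\<^sub>M \<sigma>" and g: "g \<in> L \<rightarrow>\<^sub>M lebesgue_on (ball 0 1)"
  shows "Measurable.pred L (\<lambda>x. g x \<in> admissible \<alpha> (f x))"
proof -
  have [measurable]: "f \<in> borel_measurable L" "g \<in> borel_measurable L"
    using measurable_compose[OF f sphere_id_measurable] measurable_compose[OF g ball_id_measurable] by auto
  have "Measurable.pred L (\<lambda>x. cmod (1 - herm (g x) (f x)) < \<alpha> * (1 - norm (g x)))" by measurable
  moreover have "g x \<in> admissible \<alpha> (f x) \<longleftrightarrow> cmod (1 - herm (g x) (f x)) < \<alpha> * (1 - norm (g x))" if "x \<in> space L" for x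
    using measurable_space[OF g that] by (auto simp: admissible_def)
  ultimately show ?thesis by (simp cong: measurable_cong)
qed

lemma shadow_sets [measurable]:
  assumes "z \<in> ball 0 1"
  shows "shadow z \<in> sets \<sigma>"
proof -
  have [measurable]: "z \<in> space (lebesgue_on (ball 0 1))" using assms by simp
  have "{\<zeta> \<in> space \<sigma>. z \<in> admissible \<alpha> \<zeta>} \<in> sets \<sigma>" by measurable
  then show ?thesis by (simp add: shadow_def)
qed

text \<open>
  For \<open>z = |z| z0\<close> the numbers \<open>1 - herm z \<zeta>\<close> and \<open>1 - herm z0 \<zeta>\<close> differ by at most
  \<open>1 - |z|\<close>. The inner radius is positive because \<open>\<alpha> > 1\<close>.
\<close>

lemma shadow_between:
  assumes z: "norm z < 1"
  obtains z0 where "z0 \<in> sphere 0 1" "noniso_ball z0 ((\<alpha> - 1) * (1 - norm z)) \<subseteq> shadow z"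
    "shadow z \<subseteq> noniso_ball z0 ((\<alpha> + 1) * (1 - norm z))"
proof -
  obtain z0 where z0: "z0 \<in> sphere 0 1" "z = norm z *\<^sub>R z0"
  proof (cases "z = 0")
    case True
    obtain \<zeta> :: "complex ^ 'n" where "\<zeta> \<in> sphere 0 1" using exists_sphere by blast
    then show ?thesis using True by (intro that[of \<zeta>]) auto
  next
    case False
    then show ?thesis by (intro that[of "sgn z"]) (auto simp: norm_sgn sgn_div_norm)
  qed
  define t where "t = norm z"
  have t: "0 \<le> t" "t < 1" using z by (auto simp: t_def)
  have e: "herm z \<zeta> = of_real t * herm z0 \<zeta>" for \<zeta>
    using herm_scaleR_left[of t z0 \<zeta>] z0(2) by (simp add: t_def[symmetric])
  have "noniso_ball z0 ((\<alpha> - 1) * (1 - t)) \<subseteq> shadow z"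
  proof
    fix \<zeta> assume "\<zeta> \<in> noniso_ball z0 ((\<alpha> - 1) * (1 - t))"
    then have \<zeta>: "norm \<zeta> = 1" "pdist z0 \<zeta> < (\<alpha> - 1) * (1 - t)" by (auto simp: pdist_lt_noniso)
    have "1 - herm z \<zeta> = of_real (1 - t) + of_real t * (1 - herm z0 \<zeta>)" by (simp add: e algebra_simps)
    then have "cmod (1 - herm z \<zeta>) \<le> cmod (of_real (1 - t)) + cmod (of_real t * (1 - herm z0 \<zeta>))"
      by (metis norm_triangle_ineq)
    also have "\<dots> = (1 - t) + t * pdist z0 \<zeta>"
      using t unfolding norm_of_real norm_mult pdist_def by simp
    also have "\<dots> \<le> (1 - t) + pdist z0 \<zeta>"
      using t by (simp add: pdist_def mult_left_le_one_le)
    also have "\<dots> < \<alpha> * (1 - t)" using \<zeta>(2) by (simp add: algebra_simps)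
    finally show "\<zeta> \<in> shadow z" using \<zeta> z by (simp add: shadow_def admissible_def t_def)
  qed
  moreover have "shadow z \<subseteq> noniso_ball z0 ((\<alpha> + 1) * (1 - t))"
  proof
    fix \<zeta> assume "\<zeta> \<in> shadow z"
    then have \<zeta>: "norm \<zeta> = 1" "cmod (1 - herm z \<zeta>) < \<alpha> * (1 - t)" by (auto simp: shadow_def admissible_def t_def)
    have "1 - herm z0 \<zeta> = (1 - herm z \<zeta>) - of_real (1 - t) * herm z0 \<zeta>" by (simp add: e algebra_simps)
    then have "pdist z0 \<zeta> \<le> cmod (1 - herm z \<zeta>) + cmod (of_real (1 - t) * herm z0 \<zeta>)"
      unfolding pdist_def by (metis norm_triangle_ineq4)
    also have "cmod (of_real (1 - t) * herm z0 \<zeta>) \<le> (1 - t) * 1"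
      using t herm_Cauchy_Schwarz[of z0 \<zeta>] z0(1) \<zeta>(1) unfolding norm_of_real norm_mult
      by (intro mult_mono) auto
    also have "cmod (1 - herm z \<zeta>) + (1 - t) * 1 < (\<alpha> + 1) * (1 - t)" using \<zeta>(2) by (simp add: algebra_simps)
    finally show "\<zeta> \<in> noniso_ball z0 ((\<alpha> + 1) * (1 - t))" using \<zeta> by (simp add: pdist_lt_noniso)
  qed
  ultimately show ?thesis using that[OF z0(1)] by (simp add: t_def)
qed

lemma shadow_measure_bounds:
  obtains a b where "0 < a" "0 < b" "\<And>z. norm z < 1 \<Longrightarrow> a * (1 - norm z) ^ CARD('n) \<le> measure \<sigma> (shadow z)"
    "\<And>z. norm z < 1 \<Longrightarrow> measure \<sigma> (shadow z) \<le> b * (1 - norm z) ^ CARD('n)"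
proof -
  obtain k1 k2 where k: "0 < k1" "0 < k2" and b: "\<And>(\<zeta> :: complex ^ 'n) r. \<zeta> \<in> sphere 0 1 \<Longrightarrow> 0 < r \<Longrightarrow> k1 * min r 1 ^ CARD('n) \<le> measure \<sigma> (noniso_ball \<zeta> r) \<and>
     measure \<sigma> (noniso_ball \<zeta> r) \<le> k2 * min r 1 ^ CARD('n)"
    using measure_noniso_ball by (elim exE conjE) blast
  show ?thesis
  proof (rule that[of "k1 * min (\<alpha> - 1) 1 ^ CARD('n)" "k2 * (\<alpha> + 1) ^ CARD('n)"])
    show "0 < k1 * min (\<alpha> - 1) 1 ^ CARD('n)" "0 < k2 * (\<alpha> + 1) ^ CARD('n)" using k \<alpha> by auto
    fix z :: "complex ^ 'n" assume z: "norm z < 1"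
    obtain z0 where z0: "z0 \<in> sphere 0 1" "noniso_ball z0 ((\<alpha> - 1) * (1 - norm z)) \<subseteq> shadow z"
      "shadow z \<subseteq> noniso_ball z0 ((\<alpha> + 1) * (1 - norm z))" using shadow_between[OF z] .
    have pos: "0 < (\<alpha> - 1) * (1 - norm z)" "0 < (\<alpha> + 1) * (1 - norm z)" using \<alpha> z by auto
    have "min (\<alpha> - 1) 1 * (1 - norm z) \<le> min ((\<alpha> - 1) * (1 - norm z)) 1"
    proof (rule min.boundedI)
      show "min (\<alpha> - 1) 1 * (1 - norm z) \<le> (\<alpha> - 1) * (1 - norm z)" using z by (intro mult_right_mono) auto
      have "min (\<alpha> - 1) 1 * (1 - norm z) \<le> 1 * 1" using z \<alpha> by (intro mult_mono) auto
      then show "min (\<alpha> - 1) 1 * (1 - norm z) \<le> 1" by simp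
    qed
    then have "(min (\<alpha> - 1) 1 * (1 - norm z)) ^ CARD('n) \<le> min ((\<alpha> - 1) * (1 - norm z)) 1 ^ CARD('n)"
      using z \<alpha> by (intro power_mono) auto
    then have "k1 * min (\<alpha> - 1) 1 ^ CARD('n) * (1 - norm z) ^ CARD('n) \<le> k1 * min ((\<alpha> - 1) * (1 - norm z)) 1 ^ CARD('n)"
      using k by (simp add: power_mult_distrib mult.assoc)
    also have "\<dots> \<le> measure \<sigma> (noniso_ball z0 ((\<alpha> - 1) * (1 - norm z)))" using b[OF z0(1) pos(1)] by simp
    also have "\<dots> \<le> measure \<sigma> (shadow z)"
      using z0(2) z by (intro \<sigma>.finite_measure_mono shadow_sets) auto
    finally show "k1 * min (\<alpha> - 1) 1 ^ CARD('n) * (1 - norm z) ^ CARD('n) \<le> measure \<sigma> (shadow z)" .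
    have "measure \<sigma> (shadow z) \<le> measure \<sigma> (noniso_ball z0 ((\<alpha> + 1) * (1 - norm z)))"
      using z0(3) by (intro \<sigma>.finite_measure_mono noniso_ball_sets)
    also have "\<dots> \<le> k2 * min ((\<alpha> + 1) * (1 - norm z)) 1 ^ CARD('n)" using b[OF z0(1) pos(2)] by simp
    also have "\<dots> \<le> k2 * ((\<alpha> + 1) * (1 - norm z)) ^ CARD('n)"
      using k pos by (intro mult_left_mono power_mono) auto
    finally show "measure \<sigma> (shadow z) \<le> k2 * (\<alpha> + 1) ^ CARD('n) * (1 - norm z) ^ CARD('n)"
      by (simp add: power_mult_distrib mult.assoc)
  qed
qed

lemma E_fun_eq: "norm z < 1 \<Longrightarrow> E_fun \<alpha> z = inverse (measure \<sigma> (shadow z))"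
proof -
  assume z: "norm z < 1"
  have "(LINT \<zeta>|\<sigma>. indicator (admissible \<alpha> \<zeta>) z) = (LINT \<zeta>|\<sigma>. indicator (shadow z) \<zeta> :: real)"
    by (intro Bochner_Integration.integral_cong) (auto simp: shadow_def split: split_indicator)
  also have "\<dots> = measure \<sigma> (shadow z)"
    using sets.sets_into_space[OF shadow_sets, of z] z by (simp add: Int_absorb2)
  finally show ?thesis by (simp add: E_fun_def)
qed

definition ball_measure :: "(complex ^ 'n) measure" where
  "ball_measure = density (lebesgue_on (ball 0 1)) (\<lambda>z. ennreal (E_fun \<alpha> z / (1 - (norm z)\<^sup>2)))"

lemma one_minus_norm_sq: "norm z < 1 \<Longrightarrow> 0 < 1 - (norm z)\<^sup>2" for z :: "complex ^ 'n"
  by (simp add: power_less_one_iff abs_square_less_1)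

lemma shadow_pos: "norm z < 1 \<Longrightarrow> 0 < measure \<sigma> (shadow z)"
proof -
  assume z: "norm z < 1"
  obtain a b where "0 < a" "a * (1 - norm z) ^ CARD('n) \<le> measure \<sigma> (shadow z)"
    using shadow_measure_bounds z by metis
  moreover have "0 < a * (1 - norm z) ^ CARD('n)" using z \<open>0 < a\<close> by simp
  ultimately show ?thesis by linarith
qed

lemma density_pos: "norm z < 1 \<Longrightarrow> 0 < E_fun \<alpha> z / (1 - (norm z)\<^sup>2)" for z :: "complex ^ 'n"
  using shadow_pos[of z] one_minus_norm_sq[of z] by (simp add: E_fun_eq)

lemma norm_measurable_ball [measurable]: "norm \<in> borel_measurable (lebesgue_on (ball 0 1 :: (complex ^ 'n) set))"
proof -
  have "(norm :: complex ^ 'n \<Rightarrow> real) \<in> borel_measurable borel" by measurable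
  from measurable_compose[OF ball_id_measurable this] show ?thesis .
qed

lemma E_fun_measurable [measurable]: "E_fun \<alpha> \<in> borel_measurable (lebesgue_on (ball 0 1 :: (complex ^ 'n) set))"
  unfolding E_fun_def by measurable

lemma sets_ball_measure [measurable_cong, simp]: "sets ball_measure = sets (lebesgue_on (ball 0 1))"
  and space_ball_measure [simp]: "space ball_measure = ball 0 1"
  by (simp_all add: ball_measure_def)

lemma lebesgue_ball_finite: "finite_measure (lebesgue_on (ball 0 1 :: (complex ^ 'n) set))"
  by (rule finite_measure_lebesgue_on) simp

lemma ball_measure_sigma_finite: "sigma_finite_measure ball_measure"
proof -
  interpret L: finite_measure "lebesgue_on (ball 0 1 :: (complex ^ 'n) set)" by (rule lebesgue_ball_finite)
  show ?thesis unfolding ball_measure_def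
    by (subst L.sigma_finite_iff_density_finite) auto
qed

lemma tent_mass_eq: "norm z < 1 \<Longrightarrow> tent_mass \<mu> (admissible \<alpha>) z = emeasure \<mu> (shadow z)"
proof -
  assume z: "norm z < 1"
  have "tent_mass \<mu> (admissible \<alpha>) z = (\<integral>\<^sup>+\<zeta>. indicator (shadow z) \<zeta> \<partial>\<mu>)"
    unfolding tent_mass_def by (intro nn_integral_cong) (auto simp: shadow_def split: split_indicator)
  also have "\<dots> = emeasure \<mu> (shadow z)" using z by (intro nn_integral_indicator) auto
  finally show ?thesis .
qed

lemma tent_mass_pos: "norm z < 1 \<Longrightarrow> 0 < tent_mass \<mu> (admissible \<alpha>) z"
proof -
  assume z: "norm z < 1"
  obtain z0 where z0: "z0 \<in> sphere 0 1" "noniso_ball z0 ((\<alpha> - 1) * (1 - norm z)) \<subseteq> shadow z"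
    using shadow_between[OF z] by metis
  have "0 < emeasure \<mu> (noniso_ball z0 ((\<alpha> - 1) * (1 - norm z)))"
    using z \<alpha> by (intro \<mu>_ball_pos z0) auto
  also have "\<dots> \<le> emeasure \<mu> (shadow z)" using z0 z by (intro emeasure_mono) auto
  finally show ?thesis using z by (simp add: tent_mass_eq)
qed

text \<open>
  The shadow of \<open>z\<close> lies between two balls with common centre and radii comparable to \<open>1 - |z|\<close>,
  so enlarging it to a ball of the family multiplies its measure by at most a constant.
  Averages over shadows are thereby bounded by averages over the countably many balls.
\<close>

lemma shadow_in_family:
  obtains c r K L where "doubling_family \<mu> (\<lambda>i :: nat \<times> rat. noniso_ball (c i) (r i)) (\<lambda>i. noniso_ball (c i) (10 * r i)) r K"
    "0 < L" "\<And>z. norm z < 1 \<Longrightarrow> \<exists>i. shadow z \<subseteq> noniso_ball (c i) (r i) \<and> emeasure \<mu> (noniso_ball (c i) (r i)) \<le> ennreal L * emeasure \<mu> (shadow z)"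
proof -
  obtain c :: "nat \<times> rat \<Rightarrow> complex ^ 'n" and r K where
    fam: "doubling_family \<mu> (\<lambda>i. noniso_ball (c i) (r i)) (\<lambda>i. noniso_ball (c i) (10 * r i)) r K"
    and c: "\<And>i. c i \<in> sphere 0 1" and r: "\<And>i. 0 < r i"
    and dense: "\<And>\<zeta> x y. \<zeta> \<in> sphere 0 1 \<Longrightarrow> 0 < x \<Longrightarrow> 0 < y \<Longrightarrow> \<exists>i. pdist \<zeta> (c i) < x \<and> y < r i \<and> r i < 2 * y"
    using countable_family by blast
  obtain b where b: "\<And>t. 1 \<le> t \<Longrightarrow> 0 < b t" and comp: "\<And>\<zeta> \<zeta>' r R t. \<zeta> \<in> sphere 0 1 \<Longrightarrow> \<zeta>' \<in> sphere 0 1 \<Longrightarrow> 0 < r \<Longrightarrow> 0 < R \<Longrightarrow> 1 \<le> t \<Longrightarrow> R \<le> t * r \<Longrightarrow>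
    noniso_ball \<zeta> r \<subseteq> noniso_ball \<zeta>' R \<Longrightarrow>
    emeasure \<mu> (noniso_ball \<zeta>' R) \<le> ennreal (b t) * emeasure \<mu> (noniso_ball \<zeta> r)"
    using \<mu>_compare by blast
  \<comment> \<open>The radius \<open>r i\<close> chosen below is at most \<open>4 (\<alpha> + 2) (1 - |z|)\<close>, and the shadow contains a ball of radius \<open>(\<alpha> - 1) (1 - |z|)\<close>.\<close>
  define t where "t = 4 * (\<alpha> + 2) / (\<alpha> - 1)"
  have t: "1 \<le> t" using \<alpha> by (simp add: t_def le_divide_eq)
  show ?thesis
  proof (rule that[OF fam b[OF t]])
    fix z :: "complex ^ 'n" assume z: "norm z < 1"
    define \<rho> where "\<rho> = 1 - norm z"
    have \<rho>: "0 < \<rho>" using z by (simp add: \<rho>_def)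
    obtain z0 where z0: "z0 \<in> sphere 0 1" "noniso_ball z0 ((\<alpha> - 1) * \<rho>) \<subseteq> shadow z" "shadow z \<subseteq> noniso_ball z0 ((\<alpha> + 1) * \<rho>)"
      using shadow_between[OF z] unfolding \<rho>_def by blast
    have "0 < 2 * (\<alpha> + 2) * \<rho>" using \<alpha> \<rho> by simp
    from dense[OF z0(1) \<rho> this]
    obtain i where i: "pdist z0 (c i) < \<rho>" "2 * (\<alpha> + 2) * \<rho> < r i" "r i < 2 * (2 * (\<alpha> + 2) * \<rho>)" by blast
    have sub: "noniso_ball z0 ((\<alpha> + 1) * \<rho>) \<subseteq> noniso_ball (c i) (r i)"
    proof
      fix \<zeta> assume "\<zeta> \<in> noniso_ball z0 ((\<alpha> + 1) * \<rho>)"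
      then have \<zeta>: "norm \<zeta> = 1" "pdist z0 \<zeta> < (\<alpha> + 1) * \<rho>" by (auto simp: pdist_lt_noniso)
      have "pdist (c i) \<zeta> \<le> 2 * (pdist (c i) z0 + pdist z0 \<zeta>)"
        using c[of i] z0(1) \<zeta> by (intro pdist_triangle) auto
      then have "pdist (c i) \<zeta> < 2 * (\<rho> + (\<alpha> + 1) * \<rho>)" using i(1) \<zeta>(2) by (simp add: pdist_commute)
      also have "\<dots> = 2 * (\<alpha> + 2) * \<rho>" by (simp add: algebra_simps)
      finally show "\<zeta> \<in> noniso_ball (c i) (r i)" using i(2) \<zeta>(1) by (simp add: pdist_lt_noniso)
    qed
    have "emeasure \<mu> (noniso_ball (c i) (r i)) \<le> ennreal (b t) * emeasure \<mu> (noniso_ball z0 ((\<alpha> - 1) * \<rho>))"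
    proof (rule comp[OF z0(1) c _ r t])
      show "0 < (\<alpha> - 1) * \<rho>" using \<alpha> \<rho> by simp
      have "t * ((\<alpha> - 1) * \<rho>) = 2 * (2 * (\<alpha> + 2) * \<rho>)" using \<alpha> by (simp add: t_def)
      then show "r i \<le> t * ((\<alpha> - 1) * \<rho>)" using i(3) by linarith
      show "noniso_ball z0 ((\<alpha> - 1) * \<rho>) \<subseteq> noniso_ball (c i) (r i)" using z0(2,3) sub by blast
    qed
    also have "\<dots> \<le> ennreal (b t) * emeasure \<mu> (shadow z)"
      using z0(2) z by (intro mult_left_mono emeasure_mono) auto
    finally show "\<exists>i. shadow z \<subseteq> noniso_ball (c i) (r i) \<and> emeasure \<mu> (noniso_ball (c i) (r i)) \<le> ennreal (b t) * emeasure \<mu> (shadow z)"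
      using z0(3) sub by blast
  qed
qed

lemma tent_maximal:
  assumes s: "1 < s"
  shows "\<exists>C>0. \<forall>\<phi>\<in>borel_measurable \<mu>. \<exists>\<Phi>\<in>borel_measurable \<mu>.
      (\<forall>\<zeta>\<in>space \<mu>. \<forall>z\<in>space ball_measure. z \<in> admissible \<alpha> \<zeta> \<longrightarrow> tent_avg \<mu> (admissible \<alpha>) \<phi> z \<le> \<Phi> \<zeta>) \<and>
      (\<integral>\<^sup>+\<zeta>. enn_powr (\<Phi> \<zeta>) s \<partial>\<mu>) \<le> ennreal C * (\<integral>\<^sup>+\<zeta>. enn_powr (\<phi> \<zeta>) s \<partial>\<mu>)"
proof -
  obtain c r K L where fam: "doubling_family \<mu> (\<lambda>i :: nat \<times> rat. noniso_ball (c i) (r i)) (\<lambda>i. noniso_ball (c i) (10 * r i)) r K"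
    and L: "0 < L" and sh: "\<And>z. norm z < 1 \<Longrightarrow> \<exists>i. shadow z \<subseteq> noniso_ball (c i) (r i) \<and> emeasure \<mu> (noniso_ball (c i) (r i)) \<le> ennreal L * emeasure \<mu> (shadow z)"
    using shadow_in_family by blast
  interpret F: doubling_family \<mu> "\<lambda>i. noniso_ball (c i) (r i)" "\<lambda>i. noniso_ball (c i) (10 * r i)" r K by (rule fam)
  define C where "C = 2 * K * s / (s - 1) * 2 powr (s - 1)"
  have C: "0 < C" using F.K_pos s by (simp add: C_def)
  show ?thesis
  proof (intro exI[of _ "L powr s * C"] conjI ballI)
    show "0 < L powr s * C" using C L by simp
    fix \<phi> :: "complex ^ 'n \<Rightarrow> ennreal" assume \<phi> [measurable]: "\<phi> \<in> borel_measurable \<mu>"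
    show "\<exists>\<Phi>\<in>borel_measurable \<mu>.
      (\<forall>\<zeta>\<in>space \<mu>. \<forall>z\<in>space ball_measure. z \<in> admissible \<alpha> \<zeta> \<longrightarrow> tent_avg \<mu> (admissible \<alpha>) \<phi> z \<le> \<Phi> \<zeta>) \<and>
      (\<integral>\<^sup>+\<zeta>. enn_powr (\<Phi> \<zeta>) s \<partial>\<mu>) \<le> ennreal (L powr s * C) * (\<integral>\<^sup>+\<zeta>. enn_powr (\<phi> \<zeta>) s \<partial>\<mu>)"
    proof (intro bexI[of _ "\<lambda>\<zeta>. ennreal L * F.maximal_fun \<phi> \<zeta>"] conjI ballI impI)
      show "(\<lambda>\<zeta>. ennreal L * F.maximal_fun \<phi> \<zeta>) \<in> borel_measurable \<mu>" by measurable
    next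
      have "(\<integral>\<^sup>+\<zeta>. enn_powr (ennreal L * F.maximal_fun \<phi> \<zeta>) s \<partial>\<mu>) = ennreal (L powr s) * (\<integral>\<^sup>+\<zeta>. enn_powr (F.maximal_fun \<phi> \<zeta>) s \<partial>\<mu>)"
        using L by (simp add: enn_powr_mult nn_integral_cmult)
      also have "\<dots> \<le> ennreal (L powr s) * (ennreal C * (\<integral>\<^sup>+\<zeta>. enn_powr (\<phi> \<zeta>) s \<partial>\<mu>))"
        unfolding C_def by (intro mult_left_mono F.maximal_strong_type \<phi> s) simp
      also have "\<dots> = ennreal (L powr s * C) * (\<integral>\<^sup>+\<zeta>. enn_powr (\<phi> \<zeta>) s \<partial>\<mu>)"
        using C by (simp add: ennreal_mult mult.assoc)
      finally show "(\<integral>\<^sup>+\<zeta>. enn_powr (ennreal L * F.maximal_fun \<phi> \<zeta>) s \<partial>\<mu>) \<le> ennreal (L powr s * C) * (\<integral>\<^sup>+\<zeta>. enn_powr (\<phi> \<zeta>) s \<partial>\<mu>)" .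
    next
      fix \<zeta> z assume \<zeta>: "\<zeta> \<in> space \<mu>" and z: "z \<in> space ball_measure" and adm: "z \<in> admissible \<alpha> \<zeta>"
      have zn: "norm z < 1" using z by simp
      obtain i where i: "shadow z \<subseteq> noniso_ball (c i) (r i)" "emeasure \<mu> (noniso_ball (c i) (r i)) \<le> ennreal L * emeasure \<mu> (shadow z)"
        using sh[OF zn] by blast
      define m where "m = emeasure \<mu> (shadow z)"
      have m: "0 < m" "m < top" using tent_mass_pos[OF zn] \<mu>.emeasure_finite[of "shadow z"] by (auto simp: m_def tent_mass_eq zn less_top[symmetric])
      have "(\<integral>\<^sup>+\<zeta>. \<phi> \<zeta> * indicator (admissible \<alpha> \<zeta>) z \<partial>\<mu>) \<le> (\<integral>\<^sup>+\<zeta>\<in>noniso_ball (c i) (r i). \<phi> \<zeta> \<partial>\<mu>)"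
        using i(1) by (intro nn_integral_mono) (auto simp: shadow_def split: split_indicator)
      also have "\<dots> = F.avg \<phi> i * emeasure \<mu> (noniso_ball (c i) (r i))"
        using F.V_pos[of i] \<mu>.emeasure_finite[of "noniso_ball (c i) (r i)"]
        by (simp add: F.avg_def ennreal_divide_times ennreal_divide_self less_top[symmetric])
      also have "\<dots> \<le> F.avg \<phi> i * (ennreal L * m)" using i(2) by (intro mult_left_mono) (auto simp: m_def)
      finally have "tent_avg \<mu> (admissible \<alpha>) \<phi> z \<le> (F.avg \<phi> i * ennreal L * m) / m"
        unfolding tent_avg_def tent_mass_eq[OF zn] m_def[symmetric] by (intro divide_right_mono_ennreal) (simp add: mult.assoc)
      also have "\<dots> = F.avg \<phi> i * ennreal L" using m by (simp add: mult_divide_eq_ennreal)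
      also have "\<dots> \<le> F.maximal_fun \<phi> \<zeta> * ennreal L"
      proof (intro mult_right_mono F.avg_le_maximal_fun)
        show "\<zeta> \<in> noniso_ball (c i) (r i)" using i(1) \<zeta> adm by (auto simp: shadow_def)
      qed simp
      finally show "tent_avg \<mu> (admissible \<alpha>) \<phi> z \<le> ennreal L * F.maximal_fun \<phi> \<zeta>" by (simp add: mult.commute)
    qed
  qed
qed

text \<open>
  The density of \<open>dv / (1 - |z|\<^sup>2)^{n+1}\<close> with respect to the measure
  \<open>E(z) dv / (1 - |z|\<^sup>2)\<close>.
\<close>

definition \<theta> :: "complex ^ 'n \<Rightarrow> real" where
  "\<theta> z = inverse (E_fun \<alpha> z * (1 - (norm z)\<^sup>2) ^ CARD('n))"

text \<open>
  This is \<open>E(z) \<simeq> (1 - |z|\<^sup>2)^{-n}\<close>, and \<open>1 - |z| \<le> 1 - |z|\<^sup>2 \<le> 2 (1 - |z|)\<close>.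
\<close>

lemma \<theta>_bounds:
  obtains c1 c2 where "0 < c1" "\<And>z. norm z < 1 \<Longrightarrow> c1 \<le> \<theta> z" "\<And>z. norm z < 1 \<Longrightarrow> \<theta> z \<le> c2"
proof -
  obtain a b where ab: "0 < a" "0 < b" and lo: "\<And>z. norm z < 1 \<Longrightarrow> a * (1 - norm z) ^ CARD('n) \<le> measure \<sigma> (shadow z)"
    and up: "\<And>z. norm z < 1 \<Longrightarrow> measure \<sigma> (shadow z) \<le> b * (1 - norm z) ^ CARD('n)"
    using shadow_measure_bounds by blast
  have eq: "\<theta> z = measure \<sigma> (shadow z) / (1 - (norm z)\<^sup>2) ^ CARD('n)" if "norm z < 1" for z
    using that by (simp add: \<theta>_def E_fun_eq divide_inverse)
  have fac: "1 - (norm z)\<^sup>2 = (1 - norm z) * (1 + norm z)" for z :: "complex ^ 'n" by (simp add: power2_eq_square algebra_simps)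
  have le1: "1 - norm z \<le> 1 - (norm z)\<^sup>2" and le2: "1 - (norm z)\<^sup>2 \<le> 2 * (1 - norm z)" if "norm z < 1" for z :: "complex ^ 'n"
  proof -
    have "(1 - norm z) * 1 \<le> (1 - norm z) * (1 + norm z)" using that by (intro mult_left_mono) auto
    then show "1 - norm z \<le> 1 - (norm z)\<^sup>2" by (simp add: fac)
    have "(1 - norm z) * (1 + norm z) \<le> (1 - norm z) * 2" using that by (intro mult_left_mono) auto
    then show "1 - (norm z)\<^sup>2 \<le> 2 * (1 - norm z)" by (simp add: fac)
  qed
  show ?thesis
  proof (rule that[of "a / 2 ^ CARD('n)" b])
    show "0 < a / 2 ^ CARD('n)" using ab by simp
    fix z :: "complex ^ 'n" assume z: "norm z < 1"
    have "(1 - (norm z)\<^sup>2) ^ CARD('n) \<le> (2 * (1 - norm z)) ^ CARD('n)"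
      using le2[OF z] one_minus_norm_sq[OF z] by (intro power_mono) auto
    then have "a / 2 ^ CARD('n) * (1 - (norm z)\<^sup>2) ^ CARD('n) \<le> a / 2 ^ CARD('n) * (2 * (1 - norm z)) ^ CARD('n)"
      using ab by (intro mult_left_mono) auto
    also have "\<dots> = a * (1 - norm z) ^ CARD('n)" by (simp only: power_mult_distrib) simp
    also have "\<dots> \<le> measure \<sigma> (shadow z)" by (rule lo[OF z])
    finally show "a / 2 ^ CARD('n) \<le> \<theta> z"
      using one_minus_norm_sq[OF z] by (simp add: eq[OF z] pos_le_divide_eq)
    have "measure \<sigma> (shadow z) \<le> b * (1 - norm z) ^ CARD('n)" by (rule up[OF z])
    also have "\<dots> \<le> b * (1 - (norm z)\<^sup>2) ^ CARD('n)"
      using ab z le1[OF z] by (intro mult_left_mono power_mono) auto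
    finally show "\<theta> z \<le> b" using one_minus_norm_sq[OF z] by (simp add: eq[OF z] pos_divide_le_eq)
  qed
qed

text \<open>
  Bounds for \<open>\<theta>\<close> are chosen once and for all, so that they can serve as parameters of the tent
  space.
\<close>

definition \<theta>_lower :: real where
  "\<theta>_lower = (SOME c. 0 < c \<and> (\<forall>z. norm z < 1 \<longrightarrow> c \<le> \<theta> z))"

definition \<theta>_upper :: real where
  "\<theta>_upper = (SOME c. \<forall>z. norm z < 1 \<longrightarrow> \<theta> z \<le> c)"

sublocale tent: weighted_tent_space \<mu> ball_measure "admissible \<alpha>" \<theta> \<theta>_lower \<theta>_upper
proof -
  obtain c1 c2 where c: "0 < c1" "\<And>z. norm z < 1 \<Longrightarrow> c1 \<le> \<theta> z" "\<And>z. norm z < 1 \<Longrightarrow> \<theta> z \<le> c2"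
    using \<theta>_bounds by blast
  have lower: "0 < \<theta>_lower \<and> (\<forall>z. norm z < 1 \<longrightarrow> \<theta>_lower \<le> \<theta> z)"
    unfolding \<theta>_lower_def by (rule someI[of _ c1]) (use c in blast)
  have upper: "\<forall>z. norm z < 1 \<longrightarrow> \<theta> z \<le> \<theta>_upper"
    unfolding \<theta>_upper_def by (rule someI[of _ c2]) (use c in blast)
  interpret N: sigma_finite_measure ball_measure by (rule ball_measure_sigma_finite)
  show "weighted_tent_space \<mu> ball_measure (admissible \<alpha>) \<theta> \<theta>_lower \<theta>_upper"
  proof
    show "Measurable.pred (\<mu> \<Otimes>\<^sub>M ball_measure) (\<lambda>x. snd x \<in> admissible \<alpha> (fst x))" by measurable
    show "\<theta> \<in> borel_measurable ball_measure" unfolding \<theta>_def by measurable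
  qed (use lower upper tent_mass_pos tent_maximal in auto)
qed

end

section \<open>The duality theorem\<close>

context Ap_tent
begin

lemma F_integral_eq:
  assumes [measurable]: "f \<in> borel_measurable (lebesgue_on (ball 0 1))"
  shows "F_integral \<alpha> a b w f = tent.tent_integral a b f"
proof -
  have inner: "(\<integral>\<^sup>+z. ennreal (indicator (admissible \<alpha> \<zeta>) z * cmod (f z) powr b * (E_fun \<alpha> z / (1 - (norm z)\<^sup>2))) \<partial>lebesgue_on (ball 0 1))
    = tent.area (\<lambda>z. ennreal (cmod (f z) powr b)) \<zeta>" if \<zeta> [measurable]: "\<zeta> \<in> space \<sigma>" for \<zeta>
  proof -
    have "tent.area (\<lambda>z. ennreal (cmod (f z) powr b)) \<zeta>
      = (\<integral>\<^sup>+z. ennreal (E_fun \<alpha> z / (1 - (norm z)\<^sup>2)) * (ennreal (cmod (f z) powr b) * indicator (admissible \<alpha> \<zeta>) z) \<partial>lebesgue_on (ball 0 1))"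
      unfolding tent.area_def unfolding ball_measure_def by (rule nn_integral_density) measurable
    also have "\<dots> = (\<integral>\<^sup>+z. ennreal (indicator (admissible \<alpha> \<zeta>) z * cmod (f z) powr b * (E_fun \<alpha> z / (1 - (norm z)\<^sup>2))) \<partial>lebesgue_on (ball 0 1))"
    proof (rule nn_integral_cong)
      fix z :: "complex ^ 'n" assume "z \<in> space (lebesgue_on (ball 0 1))"
      then have "0 < E_fun \<alpha> z / (1 - (norm z)\<^sup>2)" by (intro density_pos) simp
      then show "ennreal (E_fun \<alpha> z / (1 - (norm z)\<^sup>2)) * (ennreal (cmod (f z) powr b) * indicator (admissible \<alpha> \<zeta>) z)
        = ennreal (indicator (admissible \<alpha> \<zeta>) z * cmod (f z) powr b * (E_fun \<alpha> z / (1 - (norm z)\<^sup>2)))"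
        by (simp add: ennreal_mult[symmetric] mult.commute split: split_indicator)
    qed
    finally show ?thesis by simp
  qed
  have "tent.tent_integral a b f = (\<integral>\<^sup>+\<zeta>. ennreal (w \<zeta>) * enn_powr (tent.area (\<lambda>z. ennreal (cmod (f z) powr b)) \<zeta>) (a / b) \<partial>\<sigma>)"
  proof -
    have "(\<lambda>\<zeta>. enn_powr (tent.area (\<lambda>z. ennreal (cmod (f z) powr b)) \<zeta>) (a / b)) \<in> borel_measurable \<mu>"
      by measurable
    then have "(\<lambda>\<zeta>. enn_powr (tent.area (\<lambda>z. ennreal (cmod (f z) powr b)) \<zeta>) (a / b)) \<in> borel_measurable \<sigma>"
      by (simp cong: measurable_cong_sets)
    then show ?thesis
      unfolding tent.tent_integral_def \<mu>_def[THEN arg_cong, of "\<lambda>m. nn_integral m _"]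
      by (intro nn_integral_density) auto
  qed
  also have "\<dots> = F_integral \<alpha> a b w f"
    unfolding F_integral_def
  proof (rule nn_integral_cong)
    fix \<zeta> :: "complex ^ 'n" assume "\<zeta> \<in> space \<sigma>"
    from inner[OF this]
    show "ennreal (w \<zeta>) * enn_powr (tent.area (\<lambda>z. ennreal (cmod (f z) powr b)) \<zeta>) (a / b)
      = enn_powr (\<integral>\<^sup>+z. ennreal (indicator (admissible \<alpha> \<zeta>) z * cmod (f z) powr b * (E_fun \<alpha> z / (1 - (norm z)\<^sup>2)))
          \<partial>lebesgue_on (ball 0 1)) (a / b) * ennreal (w \<zeta>)"
      by (simp only: mult.commute[of "ennreal (w \<zeta>)"])
  qed
  finally show ?thesis by simp
qed

lemma F_space_eq: "F_space \<alpha> a b w = tent.tent_fun a b"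
proof -
  have "borel_measurable (lebesgue_on (ball 0 1)) = (borel_measurable ball_measure :: (complex ^ 'n \<Rightarrow> complex) set)"
    by (rule measurable_cong_sets) simp_all
  then show ?thesis by (auto simp: F_space_def tent.tent_fun_def F_integral_eq)
qed

lemma F_norm_eq: "f \<in> tent.tent_fun a b \<Longrightarrow> F_norm \<alpha> a b w f = tent.tent_norm a b f"
  unfolding F_norm_def tent.tent_norm_def by (subst F_integral_eq) (auto simp: tent.tent_fun_def cong: measurable_cong_sets)

lemma kappa_density:
  assumes "z \<in> ball 0 1"
  shows "tent.\<kappa> z * (E_fun \<alpha> z / (1 - (norm z)\<^sup>2)) = enn2real (tent_mass \<mu> (admissible \<alpha>) z) / (1 - (norm z)\<^sup>2) ^ (CARD('n) + 1)"
    and "0 \<le> tent.\<kappa> z"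
proof -
  have z: "norm z < 1" using assms by simp
  have "0 < E_fun \<alpha> z" using shadow_pos[OF z] by (simp add: E_fun_eq[OF z])
  then show "tent.\<kappa> z * (E_fun \<alpha> z / (1 - (norm z)\<^sup>2)) = enn2real (tent_mass \<mu> (admissible \<alpha>) z) / (1 - (norm z)\<^sup>2) ^ (CARD('n) + 1)"
    using one_minus_norm_sq[OF z] by (simp add: tent.\<kappa>_def \<theta>_def field_simps)
  show "0 \<le> tent.\<kappa> z" using \<open>0 < E_fun \<alpha> z\<close> one_minus_norm_sq[OF z] by (simp add: tent.\<kappa>_def \<theta>_def)
qed

lemma tent_mass_sphere:
  assumes [measurable]: "z \<in> ball 0 1"
  shows "tent_mass \<mu> (admissible \<alpha>) z = (\<integral>\<^sup>+\<zeta>. ennreal (indicator (admissible \<alpha> \<zeta>) z * w \<zeta>) \<partial>\<sigma>)"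
proof -
  have [measurable]: "z \<in> space (lebesgue_on (ball 0 1))" using assms by simp
  have "tent_mass \<mu> (admissible \<alpha>) z = (\<integral>\<^sup>+\<zeta>. ennreal (w \<zeta>) * indicator (admissible \<alpha> \<zeta>) z \<partial>\<sigma>)"
    unfolding tent_mass_def \<mu>_def by (rule nn_integral_density) measurable
  also have "\<dots> = (\<integral>\<^sup>+\<zeta>. ennreal (indicator (admissible \<alpha> \<zeta>) z * w \<zeta>) \<partial>\<sigma>)"
    by (intro nn_integral_cong) (simp split: split_indicator)
  finally show ?thesis .
qed

lemma F_pairing_eq:
  assumes [measurable]: "f \<in> borel_measurable (lebesgue_on (ball 0 1))" "g \<in> borel_measurable (lebesgue_on (ball 0 1))"
  shows "F_pairing \<alpha> w f g = tent.pairing f g"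
proof -
  have [measurable]: "tent.\<kappa> \<in> borel_measurable (lebesgue_on (ball 0 1))"
    using tent.\<kappa>_measurable by (simp cong: measurable_cong_sets)
  have "(\<integral>z. f z * cnj (g z) * complex_of_real (tent.\<kappa> z) \<partial>ball_measure)
    = (\<integral>z. (E_fun \<alpha> z / (1 - (norm z)\<^sup>2)) *\<^sub>R (f z * cnj (g z) * complex_of_real (tent.\<kappa> z)) \<partial>lebesgue_on (ball 0 1))"
    unfolding ball_measure_def
    by (rule integral_density) (auto intro!: AE_I2 less_imp_le[OF density_pos])
  also have "\<dots> = F_pairing \<alpha> w f g"
    unfolding F_pairing_def
  proof (rule Bochner_Integration.integral_cong[OF refl])
    fix z :: "complex ^ 'n" assume "z \<in> space (lebesgue_on (ball 0 1))"
    then have z: "z \<in> ball 0 1" and [measurable]: "z \<in> space (lebesgue_on (ball 0 1))" by auto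
    have "(LINT \<zeta>|\<sigma>. indicator (admissible \<alpha> \<zeta>) z * w \<zeta>) = enn2real (tent_mass \<mu> (admissible \<alpha>) z)"
      unfolding tent_mass_sphere[OF z] using w_nonneg by (intro integral_eq_nn_integral) auto
    then have "(LINT \<zeta>|\<sigma>. f z * cnj (g z) * complex_of_real (indicator (admissible \<alpha> \<zeta>) z * w \<zeta>))
       = f z * cnj (g z) * complex_of_real (enn2real (tent_mass \<mu> (admissible \<alpha>) z))"
      by (simp only: integral_mult_right_zero integral_complex_of_real)
    then have lint: "(LINT \<zeta>|\<sigma>. f z * cnj (g z) * indicator (admissible \<alpha> \<zeta>) z * complex_of_real (w \<zeta>))
       = f z * cnj (g z) * complex_of_real (enn2real (tent_mass \<mu> (admissible \<alpha>) z))"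
      by (simp add: mult.assoc of_real_indicator)
    have "r *\<^sub>R (f z * cnj (g z) * complex_of_real (tent.\<kappa> z)) = f z * cnj (g z) * complex_of_real (tent.\<kappa> z * r)" for r
      by (simp add: scaleR_conv_of_real mult_ac)
    from this[of "E_fun \<alpha> z / (1 - (norm z)\<^sup>2)"]
    have "(E_fun \<alpha> z / (1 - (norm z)\<^sup>2)) *\<^sub>R (f z * cnj (g z) * complex_of_real (tent.\<kappa> z))
      = f z * cnj (g z) * complex_of_real (enn2real (tent_mass \<mu> (admissible \<alpha>) z) / (1 - (norm z)\<^sup>2) ^ (CARD('n) + 1))"
      unfolding kappa_density(1)[OF z] .
    then show "(E_fun \<alpha> z / (1 - (norm z)\<^sup>2)) *\<^sub>R (f z * cnj (g z) * complex_of_real (tent.\<kappa> z))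
      = (LINT \<zeta>|\<sigma>. f z * cnj (g z) * indicator (admissible \<alpha> \<zeta>) z * complex_of_real (w \<zeta>))
        / complex_of_real ((1 - (norm z)\<^sup>2) ^ (CARD('n) + 1))"
      unfolding lint by (simp only: of_real_divide times_divide_eq_right)
  qed
  finally show ?thesis by (simp add: tent.pairing_def)
qed

lemma F_pairing_abs_convergent_iff:
  assumes [measurable]: "f \<in> borel_measurable (lebesgue_on (ball 0 1))" "g \<in> borel_measurable (lebesgue_on (ball 0 1))"
  shows "F_pairing_abs_convergent \<alpha> w f g \<longleftrightarrow> (\<integral>\<^sup>+z. ennreal (cmod (f z * g z) * tent.\<kappa> z) \<partial>ball_measure) < top"
proof -
  have [measurable]: "tent.\<kappa> \<in> borel_measurable (lebesgue_on (ball 0 1))"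
    using tent.\<kappa>_measurable by (simp cong: measurable_cong_sets)
  have "(\<integral>\<^sup>+z. ennreal (cmod (f z * g z) * tent.\<kappa> z) \<partial>ball_measure)
    = (\<integral>\<^sup>+z. ennreal (E_fun \<alpha> z / (1 - (norm z)\<^sup>2)) * ennreal (cmod (f z * g z) * tent.\<kappa> z) \<partial>lebesgue_on (ball 0 1))"
    unfolding ball_measure_def by (rule nn_integral_density) measurable
  also have "\<dots> = (\<integral>\<^sup>+z. (\<integral>\<^sup>+\<zeta>. ennreal (cmod (f z * cnj (g z)) * indicator (admissible \<alpha> \<zeta>) z * w \<zeta>)
               \<partial>sphere_measure) * ennreal (1 / (1 - (norm z)\<^sup>2) ^ (CARD('n) + 1)) \<partial>lebesgue_on (ball 0 1))"
  proof (rule nn_integral_cong)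
    fix z :: "complex ^ 'n" assume "z \<in> space (lebesgue_on (ball 0 1))"
    then have z: "z \<in> ball 0 1" and [measurable]: "z \<in> space (lebesgue_on (ball 0 1))" by auto
    define m where "m = enn2real (tent_mass \<mu> (admissible \<alpha>) z)"
    have m: "tent_mass \<mu> (admissible \<alpha>) z = ennreal m" using tent.mass_finite[of z] by (simp add: m_def)
    have "(\<integral>\<^sup>+\<zeta>. ennreal (cmod (f z * cnj (g z)) * indicator (admissible \<alpha> \<zeta>) z * w \<zeta>) \<partial>\<sigma>)
      = (\<integral>\<^sup>+\<zeta>. ennreal (cmod (f z * g z)) * ennreal (indicator (admissible \<alpha> \<zeta>) z * w \<zeta>) \<partial>\<sigma>)"
      using w_nonneg by (intro nn_integral_cong) (auto simp: norm_mult ennreal_mult split: split_indicator)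
    also have "\<dots> = ennreal (cmod (f z * g z)) * ennreal m"
      by (subst nn_integral_cmult) (auto simp: tent_mass_sphere[OF z, symmetric] m)
    finally have 1: "(\<integral>\<^sup>+\<zeta>. ennreal (cmod (f z * cnj (g z)) * indicator (admissible \<alpha> \<zeta>) z * w \<zeta>) \<partial>\<sigma>)
      = ennreal (cmod (f z * g z)) * ennreal m" .
    have 2: "E_fun \<alpha> z / (1 - (norm z)\<^sup>2) * (cmod (f z * g z) * tent.\<kappa> z) = cmod (f z * g z) * m * (1 / (1 - (norm z)\<^sup>2) ^ (CARD('n) + 1))"
    proof -
      have "r * (x * tent.\<kappa> z) = x * (tent.\<kappa> z * r)" for r x by (simp add: mult_ac)
      from this[of "E_fun \<alpha> z / (1 - (norm z)\<^sup>2)" "cmod (f z * g z)"]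
      show ?thesis unfolding kappa_density(1)[OF z] m_def[symmetric] by simp
    qed
    define d where "d = 1 / (1 - (norm z)\<^sup>2) ^ (CARD('n) + 1)"
    have pos: "0 \<le> E_fun \<alpha> z / (1 - (norm z)\<^sup>2)" "0 \<le> d" "0 \<le> m"
      using z density_pos[of z] one_minus_norm_sq[of z] by (auto simp: d_def m_def intro: less_imp_le)
    have "ennreal (E_fun \<alpha> z / (1 - (norm z)\<^sup>2)) * ennreal (cmod (f z * g z) * tent.\<kappa> z)
      = ennreal (E_fun \<alpha> z / (1 - (norm z)\<^sup>2) * (cmod (f z * g z) * tent.\<kappa> z))"
      using pos(1) kappa_density(2)[OF z] by (intro ennreal_mult[symmetric]) auto
    also have "\<dots> = ennreal (cmod (f z * g z)) * ennreal m * ennreal d"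
      unfolding 2 d_def[symmetric] using pos(2,3) by (simp only: ennreal_mult mult_nonneg_nonneg norm_ge_zero)
    finally show "ennreal (E_fun \<alpha> z / (1 - (norm z)\<^sup>2)) * ennreal (cmod (f z * g z) * tent.\<kappa> z)
      = (\<integral>\<^sup>+\<zeta>. ennreal (cmod (f z * cnj (g z)) * indicator (admissible \<alpha> \<zeta>) z * w \<zeta>) \<partial>\<sigma>) * ennreal (1 / (1 - (norm z)\<^sup>2) ^ (CARD('n) + 1))"
      unfolding 1 d_def .
  qed
  finally show ?thesis by (simp add: F_pairing_abs_convergent_def)
qed

end

theorem corollary2p5:
  fixes \<alpha> p q p' q' :: real and w :: "complex ^ 'n \<Rightarrow> real"
  assumes "1 < p" and "1 < q" and "1 < \<alpha>"
    and "1 / p + 1 / p' = 1" and "1 / q + 1 / q' = 1"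
    and "Ap_weight p w"
  shows
    "(\<forall>f\<in>F_space \<alpha> p q w. \<forall>g\<in>F_space \<alpha> p' q' w. F_pairing_abs_convergent \<alpha> w f g) \<and>
     (\<forall>f\<in>F_space \<alpha> p q w. \<forall>g\<in>F_space \<alpha> p' q' w. \<forall>h\<in>F_space \<alpha> p' q' w.
        F_pairing \<alpha> w f (\<lambda>z. g z + h z) = F_pairing \<alpha> w f g + F_pairing \<alpha> w f h) \<and>
     (\<forall>c. \<forall>f\<in>F_space \<alpha> p q w. \<forall>g\<in>F_space \<alpha> p' q' w.
        F_pairing \<alpha> w f (\<lambda>z. c * g z) = cnj c * F_pairing \<alpha> w f g) \<and>
     (\<forall>g\<in>F_space \<alpha> p' q' w. (\<lambda>f. F_pairing \<alpha> w f g) \<in> F_dual \<alpha> p q w) \<and>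
     (\<forall>T\<in>F_dual \<alpha> p q w. \<exists>g\<in>F_space \<alpha> p' q' w.
        (\<forall>f\<in>F_space \<alpha> p q w. T f = F_pairing \<alpha> w f g) \<and>
        (\<forall>h\<in>F_space \<alpha> p' q' w. (\<forall>f\<in>F_space \<alpha> p q w. T f = F_pairing \<alpha> w f h) \<longrightarrow>
           (AE z in lebesgue_on (ball 0 1). h z = g z))) \<and>
     (\<exists>c>0. \<exists>C>0. \<forall>g\<in>F_space \<alpha> p' q' w.
        c * F_norm \<alpha> p' q' w g \<le> F_dual_norm \<alpha> p q w (\<lambda>f. F_pairing \<alpha> w f g) \<and>
        F_dual_norm \<alpha> p q w (\<lambda>f. F_pairing \<alpha> w f g) \<le> C * F_norm \<alpha> p' q' w g)"
proof -
  note pq = assms(1,2,4,5)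
  interpret Ap_tent p w \<alpha>
    by unfold_locales (use assms in auto)
  let ?F = "tent.tent_fun p q" and ?G = "tent.tent_fun p' q'"
  let ?B = "tent.pairing" and ?nF = "tent.tent_norm p q" and ?nG = "tent.tent_norm p' q'"
  define c2 where "c2 = \<bar>\<theta>_upper\<bar> + 1"
  have c2: "0 < c2" by (simp add: c2_def)
  have meas: "f \<in> borel_measurable (lebesgue_on (ball 0 1))" if "f \<in> tent.tent_fun a b" for f a b
    using that by (simp add: tent.tent_fun_def cong: measurable_cong_sets)
  have measB: "f \<in> borel_measurable ball_measure" if "f \<in> tent.tent_fun a b" for f a b
    using that by (simp add: tent.tent_fun_def)
  have pair: "F_pairing \<alpha> w f g = ?B f g" if "f \<in> ?F" "g \<in> ?G" for f g
    using that by (intro F_pairing_eq meas)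
  note pairable = tent.pairing_bounded(2)[OF pq]
  note int = pairable[unfolded tent.pairable_def]
  have bound: "cmod (?B f g) \<le> c2 * ?nG g * ?nF f" if fg: "f \<in> ?F" "g \<in> ?G" for f g
  proof -
    have "\<bar>\<theta>_upper\<bar> * ?nG g * ?nF f \<le> c2 * ?nG g * ?nF f" by (intro mult_right_mono) (auto simp: c2_def)
    then show ?thesis using tent.pairing_bounded(3)[OF pq fg] by linarith
  qed
  have B_add: "?B (\<lambda>z. f z + f' z) g = ?B f g + ?B f' g" if "f \<in> ?F" "f' \<in> ?F" "g \<in> ?G" for f f' g
    unfolding tent.pairing_def using int[OF that(1,3)] int[OF that(2,3)] by (simp add: distrib_right)
  have B_scale: "?B (\<lambda>z. c * f z) g = c * ?B f g" for c f g
    unfolding tent.pairing_def by (simp add: mult.assoc)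
  have functional: "(\<lambda>f. F_pairing \<alpha> w f g) \<in> F_dual \<alpha> p q w" if g: "g \<in> ?G" for g
    unfolding F_dual_def F_space_eq
  proof (intro CollectI conjI ballI allI)
    fix f f' assume f: "f \<in> ?F" and f': "f' \<in> ?F"
    have "F_pairing \<alpha> w (\<lambda>z. f z + f' z) g = ?B (\<lambda>z. f z + f' z) g"
      using f f' g by (intro F_pairing_eq borel_measurable_add meas)
    then show "F_pairing \<alpha> w (\<lambda>z. f z + f' z) g = F_pairing \<alpha> w f g + F_pairing \<alpha> w f' g"
      using f f' g by (simp add: pair B_add)
  next
    fix c f assume f: "f \<in> ?F"
    have "F_pairing \<alpha> w (\<lambda>z. c * f z) g = ?B (\<lambda>z. c * f z) g"
      using f g by (intro F_pairing_eq borel_measurable_times borel_measurable_const meas)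
    then show "F_pairing \<alpha> w (\<lambda>z. c * f z) g = c * F_pairing \<alpha> w f g"
      using f g by (simp add: pair B_scale)
  next
    show "\<exists>C. \<forall>f\<in>?F. cmod (F_pairing \<alpha> w f g) \<le> C * F_norm \<alpha> p q w f"
      using bound[OF _ g] g by (intro exI[of _ "c2 * ?nG g"] ballI) (simp add: pair F_norm_eq tent.tent_norm_def)
  qed
  obtain h0 where h0 [measurable]: "h0 \<in> borel_measurable ball_measure" and h0_int: "integral\<^sup>N ball_measure h0 \<noteq> \<infinity>"
    and h0_pos: "\<forall>z\<in>space ball_measure. 0 < h0 z \<and> h0 z < \<infinity>"
    using tent.N.Ex_finite_integrable_function by blast
  define h where "h z = enn2real (h0 z)" for z
  have h [measurable]: "h \<in> borel_measurable ball_measure" unfolding h_def by measurable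
  have h_pos: "\<forall>z\<in>space ball_measure. 0 < h z" using h0_pos by (simp add: h_def enn2real_positive_iff)
  have h_int: "(\<integral>\<^sup>+z. ennreal (h z) \<partial>ball_measure) < top"
  proof -
    have "(\<integral>\<^sup>+z. ennreal (h z) \<partial>ball_measure) = integral\<^sup>N ball_measure h0"
      using h0_pos by (intro nn_integral_cong) (auto simp: h_def)
    then show ?thesis using h0_int by (simp add: less_top)
  qed
  obtain K where K: "K > 0" and norming: "\<forall>g\<in>borel_measurable ball_measure. \<forall>L\<ge>0. tent.functional_bound p q h g L \<longrightarrow>
      enn_powr (tent.tent_integral p' q' g) (1 / p') \<le> ennreal (K * L)"
    using tent.norm_le_functional[OF pq h h_pos h_int] by blast
  have lower: "?nG g \<le> K * L" if g: "g \<in> ?G" and L: "0 \<le> L" and le: "\<And>f. f \<in> ?F \<Longrightarrow> cmod (?B f g) \<le> L * ?nF f" for g L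
  proof -
    have "tent.functional_bound p q h g L"
      using pairable[OF _ g] le by (simp add: tent.functional_bound_def)
    then have "ennreal (?nG g) \<le> ennreal (K * L)"
      using norming measB[OF g] L by (simp add: tent.enn_powr_tent_integral[OF g, symmetric])
    then show ?thesis using K L by (simp add: ennreal_le_iff)
  qed
  have unique: "AE z in lebesgue_on (ball 0 1). g' z = g z"
    if g: "g \<in> ?G" and g': "g' \<in> ?G" and eq: "\<And>f. f \<in> ?F \<Longrightarrow> ?B f g = ?B f g'" for g g'
  proof -
    define d where "d z = g' z - g z" for z
    have d: "d \<in> borel_measurable ball_measure" unfolding d_def using g g' by (intro borel_measurable_diff measB)
    have dint: "f z * cnj (d z) * complex_of_real (tent.\<kappa> z)
        = f z * cnj (g' z) * complex_of_real (tent.\<kappa> z) - f z * cnj (g z) * complex_of_real (tent.\<kappa> z)"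
      for f :: "complex ^ 'n \<Rightarrow> complex" and z
      by (simp add: d_def algebra_simps)
    have "tent.functional_bound p q h d 0"
      using int[OF _ g] int[OF _ g'] eq by (simp add: tent.functional_bound_def tent.pairable_def tent.pairing_def dint)
    then have "enn_powr (tent.tent_integral p' q' d) (1 / p') \<le> ennreal (K * 0)"
      using norming d by blast
    then have "tent.tent_integral p' q' d = 0" by simp
    then have "AE z in ball_measure. d z = 0" by (rule tent.tent_integral_eq_0[OF d])
    then have "AE z in lebesgue_on (ball 0 1). 0 < ennreal (E_fun \<alpha> z / (1 - (norm z)\<^sup>2)) \<longrightarrow> d z = 0"
      unfolding ball_measure_def by (subst (asm) AE_density) auto
    with AE_space show ?thesis
    proof eventually_elim
      case (elim z)
      then show ?case using density_pos[of z] by (simp add: d_def)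
    qed
  qed
  have represent: "\<exists>g\<in>?G. \<forall>f\<in>?F. T f = ?B f g" if T: "T \<in> F_dual \<alpha> p q w" for T
  proof -
    obtain C where C: "\<forall>f\<in>?F. cmod (T f) \<le> C * F_norm \<alpha> p q w f"
      using T by (auto simp: F_dual_def F_space_eq)
    interpret T: tent_functional \<mu> ball_measure "admissible \<alpha>" \<theta> \<theta>_lower \<theta>_upper p q p' q' h T C
      by unfold_locales (use pq h_pos h_int T C in \<open>auto simp: F_dual_def F_space_eq F_norm_eq\<close>)
    show ?thesis by (rule T.representation)
  qed
  have zeroF: "(\<lambda>_. 0) \<in> ?F" "?nF (\<lambda>_. 0) = 0"
    using assms by (auto simp: tent.tent_fun_def tent.tent_norm_def tent.tent_integral_def tent.area_def)
  have dual_norm: "?nG g \<le> K * F_dual_norm \<alpha> p q w (\<lambda>f. F_pairing \<alpha> w f g) \<and> F_dual_norm \<alpha> p q w (\<lambda>f. F_pairing \<alpha> w f g) \<le> c2 * ?nG g"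
    if g: "g \<in> ?G" for g
  proof -
    let ?S = "{f \<in> ?F. ?nF f \<le> 1}"
    have norm_eq: "F_dual_norm \<alpha> p q w (\<lambda>f. F_pairing \<alpha> w f g) = (SUP f\<in>?S. cmod (?B f g))"
      unfolding F_dual_norm_def F_space_eq using g by (intro SUP_cong) (auto simp: F_norm_eq tent.tent_norm_def pair)
    have le: "cmod (?B f g) \<le> c2 * ?nG g" if "f \<in> ?S" for f
    proof -
      have "cmod (?B f g) \<le> c2 * ?nG g * ?nF f" using that g by (intro bound) auto
      also have "\<dots> \<le> c2 * ?nG g * 1" using that c2 by (intro mult_left_mono) (auto simp: tent.tent_norm_def)
      finally show ?thesis by simp
    qed
    have ne: "?S \<noteq> {}" using zeroF by force
    have bdd: "bdd_above ((\<lambda>f. cmod (?B f g)) ` ?S)" using le by (rule bdd_aboveI2)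
    define L where "L = (SUP f\<in>?S. cmod (?B f g))"
    have in_S: "cmod (?B f g) \<le> L" if "f \<in> ?S" for f unfolding L_def using that bdd by (rule cSUP_upper)
    have L0: "0 \<le> L" 
    proof -
      have "(\<lambda>_. 0) \<in> ?S" using zeroF by simp
      from order_trans[OF norm_ge_zero in_S[OF this]] show ?thesis .
    qed
    have "L \<le> c2 * ?nG g" unfolding L_def using ne le by (rule cSUP_least)
    moreover have "?nG g \<le> K * L"
    proof (rule lower[OF g L0])
      fix f assume f: "f \<in> ?F"
      show "cmod (?B f g) \<le> L * ?nF f"
      proof (cases "?nF f = 0")
        case True
        then show ?thesis using bound[OF f g] by simp
      next
        case False
        then have n: "0 < ?nF f" by (simp add: tent.tent_norm_def)
        \<comment> \<open>The supremum in the dual norm runs over the unit ball only, so \<open>f\<close> is normalised.\<close>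
        define f1 where "f1 z = complex_of_real (1 / ?nF f) * f z" for z
        have int1: "tent.tent_integral p q f1 = ennreal ((1 / ?nF f) powr p) * tent.tent_integral p q f"
        proof -
          have "cmod (complex_of_real (1 / ?nF f)) = 1 / ?nF f" unfolding norm_of_real using n by simp
          moreover have "tent.tent_integral p q f1 = ennreal (cmod (complex_of_real (1 / ?nF f)) powr p) * tent.tent_integral p q f"
            unfolding f1_def using assms(2) measB[OF f] by (intro tent.tent_integral_scale) auto
          ultimately show ?thesis by (simp only:)
        qed
        obtain x where x: "tent.tent_integral p q f = ennreal x" "0 \<le> x"
          using f by (cases "tent.tent_integral p q f") (auto simp: tent.tent_fun_def)
        have "x \<noteq> 0" using n x by (auto simp: tent.tent_norm_def)
        then have "(1 / ?nF f) powr p * x = 1" using x assms(1) by (simp add: tent.tent_norm_def powr_divide powr_powr)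
        then have int1': "tent.tent_integral p q f1 = 1" unfolding int1 using x by (simp add: ennreal_mult[symmetric])
        have "f1 \<in> borel_measurable ball_measure" unfolding f1_def using measB[OF f] by measurable
        then have "?nF f1 = 1" "f1 \<in> ?F" using int1' by (auto simp: tent.tent_norm_def tent.tent_fun_def)
        then have "cmod (?B f1 g) \<le> L" by (intro in_S) simp
        moreover have "cmod (?B f1 g) = 1 / ?nF f * cmod (?B f g)"
          unfolding f1_def B_scale norm_mult norm_of_real using n by simp
        ultimately show ?thesis using n by (simp add: divide_le_eq)
      qed
    qed
    ultimately show ?thesis by (simp add: norm_eq L_def)
  qed
  show ?thesis
    unfolding F_space_eq
  proof (intro conjI)
    show "\<forall>f\<in>?F. \<forall>g\<in>?G. F_pairing_abs_convergent \<alpha> w f g"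
    proof (intro ballI)
      fix f g assume fg: "f \<in> ?F" "g \<in> ?G"
      show "F_pairing_abs_convergent \<alpha> w f g"
        using fg tent.pairing_bounded(1)[OF pq fg] by (subst F_pairing_abs_convergent_iff) (auto intro: meas)
    qed
    show "\<forall>f\<in>?F. \<forall>g\<in>?G. \<forall>h\<in>?G. F_pairing \<alpha> w f (\<lambda>z. g z + h z) = F_pairing \<alpha> w f g + F_pairing \<alpha> w f h"
    proof (intro ballI)
      fix f g h assume f: "f \<in> ?F" and g: "g \<in> ?G" and h: "h \<in> ?G"
      have "F_pairing \<alpha> w f (\<lambda>z. g z + h z) = ?B f (\<lambda>z. g z + h z)"
        using f g h by (intro F_pairing_eq borel_measurable_add meas)
      also have "\<dots> = ?B f g + ?B f h"
        unfolding tent.pairing_def using int[OF f g] int[OF f h] by (simp add: distrib_left distrib_right)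
      finally show "F_pairing \<alpha> w f (\<lambda>z. g z + h z) = F_pairing \<alpha> w f g + F_pairing \<alpha> w f h"
        using f g h by (simp add: pair)
    qed
    show "\<forall>c. \<forall>f\<in>?F. \<forall>g\<in>?G. F_pairing \<alpha> w f (\<lambda>z. c * g z) = cnj c * F_pairing \<alpha> w f g"
    proof (intro ballI allI)
      fix c f g assume f: "f \<in> ?F" and g: "g \<in> ?G"
      have "F_pairing \<alpha> w f (\<lambda>z. c * g z) = ?B f (\<lambda>z. c * g z)"
        using f g by (intro F_pairing_eq borel_measurable_times borel_measurable_const meas)
      also have "\<dots> = (\<integral>z. cnj c * (f z * cnj (g z) * complex_of_real (tent.\<kappa> z)) \<partial>ball_measure)"
        unfolding tent.pairing_def by (simp add: mult_ac)
      also have "\<dots> = cnj c * ?B f g" unfolding tent.pairing_def by (rule integral_mult_right_zero)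
      finally show "F_pairing \<alpha> w f (\<lambda>z. c * g z) = cnj c * F_pairing \<alpha> w f g" using f g by (simp add: pair)
    qed
    show "\<forall>g\<in>?G. (\<lambda>f. F_pairing \<alpha> w f g) \<in> F_dual \<alpha> p q w" using functional by blast
    show "\<forall>T\<in>F_dual \<alpha> p q w. \<exists>g\<in>?G. (\<forall>f\<in>?F. T f = F_pairing \<alpha> w f g) \<and>
        (\<forall>h\<in>?G. (\<forall>f\<in>?F. T f = F_pairing \<alpha> w f h) \<longrightarrow> (AE z in lebesgue_on (ball 0 1). h z = g z))"
    proof
      fix T assume "T \<in> F_dual \<alpha> p q w"
      then obtain g where g: "g \<in> ?G" "\<forall>f\<in>?F. T f = ?B f g" using represent by blast
      show "\<exists>g\<in>?G. (\<forall>f\<in>?F. T f = F_pairing \<alpha> w f g) \<and>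
        (\<forall>h\<in>?G. (\<forall>f\<in>?F. T f = F_pairing \<alpha> w f h) \<longrightarrow> (AE z in lebesgue_on (ball 0 1). h z = g z))"
      proof (intro bexI[OF _ g(1)] conjI ballI impI)
        show "T f = F_pairing \<alpha> w f g" if "f \<in> ?F" for f using that g by (simp add: pair)
        fix h assume h: "h \<in> ?G" "\<forall>f\<in>?F. T f = F_pairing \<alpha> w f h"
        show "AE z in lebesgue_on (ball 0 1). h z = g z"
          by (rule unique[OF g(1) h(1)]) (use g h in \<open>simp add: pair\<close>)
      qed
    qed
    show "\<exists>c>0. \<exists>C>0. \<forall>g\<in>?G. c * F_norm \<alpha> p' q' w g \<le> F_dual_norm \<alpha> p q w (\<lambda>f. F_pairing \<alpha> w f g) \<and>
        F_dual_norm \<alpha> p q w (\<lambda>f. F_pairing \<alpha> w f g) \<le> C * F_norm \<alpha> p' q' w g"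
    proof (rule exI[of _ "1 / K"], intro conjI, simp add: K, rule exI[of _ c2], intro conjI ballI c2)
      fix g assume g: "g \<in> ?G"
      show "1 / K * F_norm \<alpha> p' q' w g \<le> F_dual_norm \<alpha> p q w (\<lambda>f. F_pairing \<alpha> w f g)"
        using dual_norm[OF g] g K by (simp add: F_norm_eq divide_le_eq mult.commute)
      show "F_dual_norm \<alpha> p q w (\<lambda>f. F_pairing \<alpha> w f g) \<le> c2 * F_norm \<alpha> p' q' w g"
        using dual_norm[OF g] g by (simp add: F_norm_eq)
    qed
  qed
qed

end
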